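(* Let $A$ be unbounded and assume the following periodicity and controllability conditions (i) and (ii). (i) $T_i>0$ ($i=1,\dots,n$) are real numbers and $f(x,a)$, $l(x,a)$ are periodic in $x_i$ with period $T_i$ ($i=1,\dots,n$); moreover there are $L,M>0$ such that for all $x,x_1,x_2\in\mathbb{T}^n$ and $a\in A$: $|f(x_1,a)-f(x_2,a)|\le L(1+|a|^p)|x_1-x_2|$, $|l(x_1,a)-l(x_2,a)|\le L(1+|a|^q)|x_1-x_2|$, $l(x,a)\le M(1+|a|^q)$, $|f(x,a)|\le M(1+|a|^p)$. (ii) There are $C,\gamma>0$ such that for any pair $x\neq z$ in $\mathbb{T}^n$ there exist $S>0$ and $\mu\in\Gamma^r$ such that $\xi^r_x(S,\mu)=z$ (in $\mathbb{T}^n$) and $S\le C|x-z|^\gamma$. For $\delta>0$ let $\mathcal{V}_\delta(x)=\inf_{\alpha\in\mathcal{A}}\int_0^{+\infty}e^{-\delta t}\,l(y_x(t,\alpha),\alpha(t))\,dt$, $\mathcal{W}_\delta(x)=\mathcal{V}_\delta(x)-\mathcal{V}_\delta(0)$, and for $t\geq 0$ let $\mathcal{V}(t,x)=\inf_{\alpha\in\mathcal{A}}\int_0^t l(y_x(\tau,\alpha),\alpha(\tau))\,d\tau$. Then there exists a constant $\lambda\ge0$ such that $$\lim_{\delta\to0^+}\delta\,\mathcal{V}_\delta(x)=\lambda,\qquad \lim_{t\to+\infty}\mathcal{V}(t,x)/t=\lambda\qquad\text{uniformly in }\mathbb{R}^n.$$ Moreover, there exists some sequence $\delta_n\to0^+$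 such that $$\lim_{n\to+\infty}\mathcal{W}_{\delta_n}(x)=\mathcal{W}_0(x)\qquad\text{uniformly in }\mathbb{R}^n,$$ and $\mathcal{W}_0\in BUC(\mathbb{R}^n)$ is a viscosity solution of $$\tilde H_\lambda(x,Du(x))=0\quad\text{in }\mathbb{R}^n,$$ where $$\tilde H_\lambda(x,p)=\max_{(w_0,w)\in S(A)}\left\{-\langle\overline f(x,w_0,w),p\rangle-\overline l(x,w_0,w)+\lambda w_0^q\right\}.$$
   Context: Notation. $\mathbb{R}_+=[0,+\infty)$; $\overline{B(0,1)}$ is the closed unit ball of $\mathbb{R}^m$; $BUC(\mathbb{R}^n)$ is the space of bounded uniformly continuous functions on $\mathbb{R}^n$. For given real numbers $T_i>0$ ($i=1,\dots,n$), $\mathbb{T}^n$ denotes the $n$-dimensional torus $\mathbb{R}^n/(\prod_{i=1}^nT_i\mathbb{Z})$, identified with $\prod_{i=1}^n[0,T_i]$. Data (standing assumptions). $A\subset\mathbb{R}^m$ is an (unbounded) convex, closed, nontrivial cone containing the origin; $f:\mathbb{R}^n\times A\to\mathbb{R}^n$ and $l:\mathbb{R}^n\times A\to\mathbb{R}$ are continuous, $l\ge0$; $q\ge p\ge1$ are integers. There are $C_1\ge0$, $C_2>0$ with $l(x,a)\ge C_2|a|^q-C_1$ for all $(x,a)\in\mathbb{R}^n\times A$, and for $\Phi\in\{f,l\}$ there is a continuous function $\Phi^\infty$ with $\lim_{\rho\to0^+}\rho^q\Phi(x,\rho^{-1}a)=\Phi^\infty(x,a)$ uniformly on compact subsets of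 $\mathbb{R}^n\times A$. Controls. $\mathcal{A}$ is the set of Borel measurable $\alpha:\mathbb{R}_+\to A$ belonging to $L^q_{loc}(\mathbb{R}_+,A)$; $y_x(\cdot,\alpha)$ is the solution of $\dot y=f(y,\alpha)$, $y(0)=x$. Extended data. For $\Phi\in\{f,l\}$, $\overline{\Phi}(x,w_0,w)=w_0^q\Phi(x,w_0^{-1}w)$ if $w_0\ne0$ and $\overline\Phi(x,0,w)=\Phi^\infty(x,w)$, for $(x,w_0,w)\in\mathbb{R}^n\times\mathbb{R}_+\times A$. $S(A)=\{(w_0,w)\in\mathbb{R}_+\times A:\ w_0^q+|w|^q=1\}$. Relaxed extended trajectories. $\Gamma^r=L^\infty(\mathbb{R}_+,\mathcal{P}(\overline{B(0,1)}\cap A))$, where $\mathcal{P}(\overline{B(0,1)}\cap A)$ is the set of Radon probability measures on $\overline{B(0,1)}\cap A$ with the weak$^*$ topology; $\overline f^r(x,\mu)=\int_{\overline{B(0,1)}\cap A}\overline f(x,(1-|w|^q)^{1/q},w)\,d\mu$; for $\mu\in\Gamma^r$, $\xi^r_x(\cdot,\mu)$ solves $\dot\xi^r=\overline f^r(\xi^r,\mu)$, $\xi^r(0)=x$. *)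

theory Defs
  imports "HOL-Probability.Probability"
begin

text \<open>Solutions of \<open>y' = F(t, y)\<close>, \<open>y(0) = x\<close> are understood in the sense of Caratheodory:
  absolutely continuous functions satisfying the equation almost everywhere, i.e. solutions of the
  Lebesgue integral equation on \<open>[0, \<infinity>)\<close>. The time argument of \<open>F\<close> carries the control. Values at
  negative times are irrelevant, so the solution is unique only on \<open>[0, \<infinity>)\<close> and
  \<open>trajectory\<close> picks its value at each single time.\<close>

definition caratheodory_solution ::
    "(real \<Rightarrow> 'a::euclidean_space \<Rightarrow> 'a) \<Rightarrow> 'a \<Rightarrow> (real \<Rightarrow> 'a) \<Rightarrow> bool" where
  "caratheodory_solution F x y \<longleftrightarrow>
     (\<forall>t\<ge>0. (\<lambda>s. F s (y s)) absolutely_integrable_on {0..t} \<and>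
            y t = x + integral {0..t} (\<lambda>s. F s (y s)))"

definition trajectory :: "(real \<Rightarrow> 'a::euclidean_space \<Rightarrow> 'a) \<Rightarrow> 'a \<Rightarrow> real \<Rightarrow> 'a" where
  "trajectory F x t = (THE v. \<exists>y. caratheodory_solution F x y \<and> v = y t)"

definition controls :: "'b::euclidean_space set \<Rightarrow> nat \<Rightarrow> (real \<Rightarrow> 'b) set" where
  "controls A q =
     {\<alpha>. \<alpha> \<in> borel_measurable (restrict_space borel {0..}) \<and> (\<forall>t\<ge>0. \<alpha> t \<in> A) \<and>
         (\<forall>t\<ge>0. set_integrable lborel {0..t} (\<lambda>s. norm (\<alpha> s) ^ q))}"

text \<open>The running costs are nonnegative but need not have a finite integral, so costs and infima
  are taken in \<^typ>\<open>ennreal\<close>. The infima are finite when \<open>l(\<cdot>, 0)\<close> is bounded (take \<open>\<alpha> = 0\<close>).\<close>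

definition discounted_value ::
    "'b::euclidean_space set \<Rightarrow> nat \<Rightarrow> ('a::euclidean_space \<Rightarrow> 'b \<Rightarrow> 'a) \<Rightarrow> ('a \<Rightarrow> 'b \<Rightarrow> real) \<Rightarrow>
     real \<Rightarrow> 'a \<Rightarrow> real" where
  "discounted_value A q f l \<delta> x = enn2real (INF \<alpha>\<in>controls A q.
     \<integral>\<^sup>+t\<in>{0..}. ennreal (exp (- \<delta> * t) * l (trajectory (\<lambda>s y. f y (\<alpha> s)) x t) (\<alpha> t)) \<partial>lborel)"

definition finite_horizon_value ::
    "'b::euclidean_space set \<Rightarrow> nat \<Rightarrow> ('a::euclidean_space \<Rightarrow> 'b \<Rightarrow> 'a) \<Rightarrow> ('a \<Rightarrow> 'b \<Rightarrow> real) \<Rightarrow>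
     real \<Rightarrow> 'a \<Rightarrow> real" where
  "finite_horizon_value A q f l t x = enn2real (INF \<alpha>\<in>controls A q.
     \<integral>\<^sup>+\<tau>\<in>{0..t}. ennreal (l (trajectory (\<lambda>s y. f y (\<alpha> s)) x \<tau>) (\<alpha> \<tau>)) \<partial>lborel)"

definition recession_limit ::
    "'b::euclidean_space set \<Rightarrow> nat \<Rightarrow> ('a::euclidean_space \<Rightarrow> 'b \<Rightarrow> 'c::euclidean_space) \<Rightarrow>
     ('a \<Rightarrow> 'b \<Rightarrow> 'c) \<Rightarrow> bool" where
  "recession_limit A q \<Phi> \<Phi>_inf \<longleftrightarrow>
     continuous_on (UNIV \<times> A) (\<lambda>(x, a). \<Phi>_inf x a) \<and>
     (\<forall>K. compact K \<and> K \<subseteq> UNIV \<times> A \<longrightarrow>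
        uniform_limit K (\<lambda>\<rho> (x, a). \<rho> ^ q *\<^sub>R \<Phi> x (a /\<^sub>R \<rho>)) (\<lambda>(x, a). \<Phi>_inf x a) (at_right 0))"

definition extended ::
    "nat \<Rightarrow> ('a \<Rightarrow> 'b::real_vector \<Rightarrow> 'c::real_vector) \<Rightarrow> ('a \<Rightarrow> 'b \<Rightarrow> 'c) \<Rightarrow>
     'a \<Rightarrow> real \<Rightarrow> 'b \<Rightarrow> 'c" where
  "extended q \<Phi> \<Phi>_inf x w0 w =
     (if w0 = 0 then \<Phi>_inf x w else w0 ^ q *\<^sub>R \<Phi> x (w /\<^sub>R w0))"

definition extended_sphere :: "'b::real_normed_vector set \<Rightarrow> nat \<Rightarrow> (real \<times> 'b) set" where
  "extended_sphere A q = {(w0, w). 0 \<le> w0 \<and> w \<in> A \<and> w0 ^ q + norm w ^ q = 1}"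

text \<open>Every Borel probability measure on the sets \<open>K\<close> used below (compact subsets of a Euclidean
  space) is Radon.\<close>

definition prob_measures :: "'b::euclidean_space set \<Rightarrow> 'b measure set" where
  "prob_measures K = {\<nu>. prob_space \<nu> \<and> sets \<nu> = sets (restrict_space borel K)}"

definition weak_star_topology :: "'b::euclidean_space set \<Rightarrow> 'b measure topology" where
  "weak_star_topology K = topology_generated_by
     {{\<nu> \<in> prob_measures K. (\<integral>w. \<phi> w \<partial>\<nu>) \<in> U} | (\<phi> :: 'b \<Rightarrow> real) U.
        continuous_on K \<phi> \<and> open U}"

definition relaxed_controls :: "'b::euclidean_space set \<Rightarrow> (real \<Rightarrow> 'b measure) set" where
  "relaxed_controls A = (let K = cball 0 1 \<inter> A in
     measurable (lebesgue_on {0..})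
       (sigma (prob_measures K) {U. openin (weak_star_topology K) U}))"

text \<open>The integral is over \<open>cball 0 1 \<inter> A\<close>, the space of the measure \<open>\<nu>\<close>.\<close>

definition relaxed_field ::
    "nat \<Rightarrow> ('a \<Rightarrow> 'b::euclidean_space \<Rightarrow> 'a::euclidean_space) \<Rightarrow> ('a \<Rightarrow> 'b \<Rightarrow> 'a) \<Rightarrow>
     'a \<Rightarrow> 'b measure \<Rightarrow> 'a" where
  "relaxed_field q f f_inf x \<nu> =
     (\<integral>w. extended q f f_inf x (root q (1 - norm w ^ q)) w \<partial>\<nu>)"

definition relaxed_trajectory ::
    "nat \<Rightarrow> ('a \<Rightarrow> 'b::euclidean_space \<Rightarrow> 'a::euclidean_space) \<Rightarrow> ('a \<Rightarrow> 'b \<Rightarrow> 'a) \<Rightarrow>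
     'a \<Rightarrow> (real \<Rightarrow> 'b measure) \<Rightarrow> real \<Rightarrow> 'a" where
  "relaxed_trajectory q f f_inf x \<mu> = trajectory (\<lambda>s y. relaxed_field q f f_inf y (\<mu> s)) x"

definition torus_eq :: "real ^ 'n \<Rightarrow> real ^ 'n \<Rightarrow> real ^ 'n \<Rightarrow> bool" where
  "torus_eq T x z \<longleftrightarrow> (\<forall>i. \<exists>k::int. x $ i - z $ i = of_int k * T $ i)"

text \<open>The greatest element exists for continuous data, since \<open>extended_sphere A q\<close> is then
  compact and nonempty.\<close>

definition ergodic_hamiltonian ::
    "'b::euclidean_space set \<Rightarrow> nat \<Rightarrow> ('a::euclidean_space \<Rightarrow> 'b \<Rightarrow> 'a) \<Rightarrow> ('a \<Rightarrow> 'b \<Rightarrow> 'a) \<Rightarrow>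
     ('a \<Rightarrow> 'b \<Rightarrow> real) \<Rightarrow> ('a \<Rightarrow> 'b \<Rightarrow> real) \<Rightarrow> real \<Rightarrow> 'a \<Rightarrow> 'a \<Rightarrow> real" where
  "ergodic_hamiltonian A q f f_inf l l_inf c x p =
     (GREATEST v. v \<in> (\<lambda>(w0, w). - (extended q f f_inf x w0 w \<bullet> p) - extended q l l_inf x w0 w
                                  + c * w0 ^ q) ` extended_sphere A q)"

definition BUC :: "('a::metric_space \<Rightarrow> real) set" where
  "BUC = {u. bounded (range u) \<and> uniformly_continuous_on UNIV u}"

definition viscosity_subsolution :: "('a::euclidean_space \<Rightarrow> 'a \<Rightarrow> real) \<Rightarrow> ('a \<Rightarrow> real) \<Rightarrow> bool" where
  "viscosity_subsolution H u \<longleftrightarrow>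
     (\<forall>\<phi> D x. (\<forall>y. GDERIV \<phi> y :> D y) \<and> continuous_on UNIV D \<and>
        (\<forall>\<^sub>F y in nhds x. u y - \<phi> y \<le> u x - \<phi> x) \<longrightarrow> H x (D x) \<le> 0)"

definition viscosity_supersolution :: "('a::euclidean_space \<Rightarrow> 'a \<Rightarrow> real) \<Rightarrow> ('a \<Rightarrow> real) \<Rightarrow> bool" where
  "viscosity_supersolution H u \<longleftrightarrow>
     (\<forall>\<phi> D x. (\<forall>y. GDERIV \<phi> y :> D y) \<and> continuous_on UNIV D \<and>
        (\<forall>\<^sub>F y in nhds x. u y - \<phi> y \<ge> u x - \<phi> x) \<longrightarrow> H x (D x) \<ge> 0)"

definition viscosity_solution :: "('a::euclidean_space \<Rightarrow> 'a \<Rightarrow> real) \<Rightarrow> ('a \<Rightarrow> real) \<Rightarrow> bool" where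
  "viscosity_solution H u \<longleftrightarrow>
     continuous_on UNIV u \<and> viscosity_subsolution H u \<and> viscosity_supersolution H u"

end

(* Relaxed controls are never approximated by ordinary ones. By dynamic programming with constant
   controls, V_delta is a viscosity subsolution of -<fbar(x,w0,w), Du> <= K for every extended control
   (w0,w). This inequality is linear in the velocity, so it can be averaged over a relaxed control, and
   a sup-convolution argument along a relaxed trajectory from x to z in time S gives
   V_delta(x) <= V_delta(z) + K S. Controllability thus makes the V_delta equicontinuous with
   oscillation bounded independently of delta. If (lambda, W) is a limit of
   (delta V_delta(0), V_delta - V_delta(0)) along a subsequence, which exists by Arzela-Ascoli, the
   dynamic programming principle passes to the limit: W(x) = inf (int_0^t (l - lambda) + W(y(t))).
   Hence |V(t,x) - lambda t| is bounded, so lambda does not depend on the subsequence, and W is a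
   viscosity solution of the limit equation. *)

theory Submission
  imports Defs "HOL-Complex_Analysis.Great_Picard"
begin

section \<open>Calculus along absolutely continuous curves\<close>

text \<open>Everything is measured by the single weight \<open>1 + norm a ^ q\<close>: times
  \<open>K\<close> it bounds the speed, the running cost and the Lipschitz constants in space, and
  by coercivity its integral over a bounded time is controlled by the cost. Scaling the control by
  \<open>w0\<close> and the data by \<open>w0 ^ q\<close> turns it into
  \<open>w0 ^ q + norm w ^ q\<close>, which is 1 on \<open>S(A)\<close>; there the data are bounded,
  and the face \<open>w0 = 0\<close> is reached by limits. The obstacle is that \<open>f\<close> may
  grow as fast as \<open>l\<close>: a control of bounded cost can move the state a fixed distance in
  arbitrarily short time. The stability estimate for ordinary controls yields a modulus of
  continuity that depends on \<delta>; a uniform one comes from relaxed trajectories, whose speed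
  and cost rate are at most \<open>K\<close>. In the supersolution proof the trajectory is stopped
  on leaving a ball, so one control has to be near-optimal at all times at once. The limit is
  therefore taken in the dynamic programming principle, with this order of quantifiers, and not in
  the equation.\<close>

lemma increment_le_if_small_increment_le:
  fixes g G :: "real \<Rightarrow> real"
  assumes "d > 0"
    and small: "\<And>a b. t0 \<le> a \<Longrightarrow> a \<le> b \<Longrightarrow> b \<le> t1 \<Longrightarrow> b - a \<le> d \<Longrightarrow> g b - g a \<le> G b - G a"
    and "t0 \<le> t1"
  shows "g t1 - g t0 \<le> G t1 - G t0"
proof -
  \<comment> \<open>Induction on the number of steps of length \<open>d\<close> back from
    \<open>b\<close> to \<open>t0\<close>. This replaces differentiation: an increment estimate that
    is uniform in position adds up over the whole interval.\<close>
  have "g b - g t0 \<le> G b - G t0" if "t0 \<le> b" "b \<le> t1" "b - t0 \<le> real n * d" for n b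
    using that
  proof (induction n arbitrary: b)
    case 0
    then have "b = t0" by simp
    then show ?case by simp
  next
    case (Suc n)
    define c where "c = max t0 (b - d)"
    have "c - t0 \<le> real n * d"
      using Suc.prems \<open>d > 0\<close> by (auto simp: c_def max_def algebra_simps)
    then have "g c - g t0 \<le> G c - G t0"
      using Suc \<open>d > 0\<close> by (intro Suc.IH) (auto simp: c_def)
    moreover have "g b - g c \<le> G b - G c"
      using Suc.prems \<open>d > 0\<close> by (intro small) (auto simp: c_def)
    ultimately show ?case by simp
  qed
  moreover obtain n where "(t1 - t0) / d \<le> real n"
    using real_arch_simple by blast
  ultimately show ?thesis
    using assms by (simp add: field_simps)
qed

lemma GDERIV_mean_value:
  assumes "\<And>x. GDERIV \<phi> x :> D x"
  shows "\<exists>z\<in>closed_segment a b. \<phi> b - \<phi> a = (b - a) \<bullet> D z"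
proof -
  have "((\<lambda>r. \<phi> (a + r *\<^sub>R (b - a))) has_real_derivative (b - a) \<bullet> D (a + r *\<^sub>R (b - a))) (at r)" for r
  proof -
    have "((\<lambda>r. \<phi> (a + r *\<^sub>R (b - a))) has_derivative
        (\<lambda>h. (h *\<^sub>R (b - a)) \<bullet> D (a + r *\<^sub>R (b - a)))) (at r)"
      using assms[of "a + r *\<^sub>R (b - a)"] unfolding gderiv_def
      by (intro has_derivative_compose[where g = \<phi> and f = "\<lambda>r. a + r *\<^sub>R (b - a)"])
        (auto intro!: derivative_eq_intros)
    then show ?thesis
      by (simp add: has_field_derivative_def mult_commute_abs)
  qed
  from MVT2[of 0 1, OF _ this] obtain r where "0 < r" "r < 1"
    "\<phi> b - \<phi> a = (b - a) \<bullet> D (a + r *\<^sub>R (b - a))"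
    by force
  moreover have "a + r *\<^sub>R (b - a) \<in> closed_segment a b"
    using \<open>0 < r\<close> \<open>r < 1\<close> by (auto simp: in_segment algebra_simps intro!: exI[of _ r])
  ultimately show ?thesis by blast
qed

lemmas integral_combine_HK = Henstock_Kurzweil_Integration.integral_combine

lemma absolutely_integrable_on_norm:
  fixes h :: "real \<Rightarrow> 'a::euclidean_space"
  assumes "h absolutely_integrable_on S"
  shows "(\<lambda>s. norm (h s)) integrable_on S"
  using assms unfolding absolutely_integrable_on_def by simp

lemma absolutely_integrable_continuous_inner:
  fixes g h :: "real \<Rightarrow> 'a::euclidean_space"
  assumes "continuous_on {a..b} g" "h absolutely_integrable_on {a..b}"
  shows "(\<lambda>s. g s \<bullet> h s) absolutely_integrable_on {a..b}"
proof (rule absolutely_integrable_bounded_measurable_product[where h = "(\<bullet>)"])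
  show "bilinear ((\<bullet>) :: 'a \<Rightarrow> 'a \<Rightarrow> real)"
    using bilinear_conv_bounded_bilinear bounded_bilinear_inner by blast
  show "g \<in> borel_measurable (lebesgue_on {a..b})"
    using assms(1) by (simp add: continuous_imp_measurable_on_sets_lebesgue)
  show "bounded (g ` {a..b})"
    using assms(1) compact_continuous_image compact_imp_bounded by blast
qed (use assms in auto)

text \<open>Only increments over small intervals are compared, so no differentiation almost everywhere
  is needed.\<close>

lemma integral_chain_rule:
  fixes y h :: "real \<Rightarrow> 'a::euclidean_space"
  assumes \<phi>: "\<And>x. GDERIV \<phi> x :> D x" "continuous_on UNIV D"
    and h: "h absolutely_integrable_on {0..t}"
    and y: "\<And>s. s \<in> {0..t} \<Longrightarrow> y s = x + integral {0..s} h"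
    and "0 \<le> t"
  shows "(\<lambda>s. D (y s) \<bullet> h s) absolutely_integrable_on {0..t}"
    and "integral {0..t} (\<lambda>s. D (y s) \<bullet> h s) = \<phi> (y t) - \<phi> x"
proof -
  have hint: "h integrable_on {0..t}"
    using h by (simp add: absolutely_integrable_on_def)
  have cont: "continuous_on {0..t} y"
  proof -
    have "continuous_on {0..t} (\<lambda>s. x + integral {0..s} h)"
      using hint by (intro continuous_intros indefinite_integral_continuous_1)
    then show ?thesis
      using y by (metis (mono_tags, lifting) continuous_on_cong)
  qed
  have "continuous_on {0..t} (\<lambda>s. D (y s))"
    using continuous_on_compose2[OF \<phi>(2) cont] by auto
  from absolutely_integrable_continuous_inner[OF this h]
  show Dh: "(\<lambda>s. D (y s) \<bullet> h s) absolutely_integrable_on {0..t}" .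
  then have Dhint: "(\<lambda>s. D (y s) \<bullet> h s) integrable_on {0..t}"
    by (simp add: absolutely_integrable_on_def)
  have nint: "(\<lambda>s. norm (h s)) integrable_on {0..t}"
    using h by (rule absolutely_integrable_on_norm)
  obtain R where R: "y ` {0..t} \<subseteq> cball 0 R"
    using compact_imp_bounded[OF compact_continuous_image[OF cont compact_Icc]] that
    unfolding bounded_iff by (auto simp: subset_iff)
  have uD: "uniformly_continuous_on (cball 0 R) D"
    using \<phi>(2) by (intro compact_uniformly_continuous) (auto intro: continuous_on_subset)
  have uy: "uniformly_continuous_on {0..t} y"
    using cont by (intro compact_uniformly_continuous) auto
  define N where "N = integral {0..t} (\<lambda>s. norm (h s))"
  \<comment> \<open>The defect of the chain rule; the aim is that its total increment
    vanishes.\<close>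
  define g where "g = (\<lambda>r. \<phi> (y r) - integral {0..r} (\<lambda>s. D (y s) \<bullet> h s))"
  have "N \<ge> 0" unfolding N_def by (intro integral_nonneg nint) auto
  have bound: "\<bar>g t - g 0\<bar> \<le> e * N" if "e > 0" for e
  proof -
    obtain d1 where "d1 > 0"
      and d1: "\<And>u v. u \<in> cball 0 R \<Longrightarrow> v \<in> cball 0 R \<Longrightarrow> dist u v < d1 \<Longrightarrow> dist (D u) (D v) < e"
      using uD \<open>e > 0\<close> unfolding uniformly_continuous_on_def by metis
    obtain d2 where "d2 > 0"
      and d2: "\<And>u v. u \<in> {0..t} \<Longrightarrow> v \<in> {0..t} \<Longrightarrow> dist u v < d2 \<Longrightarrow> dist (y u) (y v) < d1"
      using uy \<open>d1 > 0\<close> unfolding uniformly_continuous_on_def by metis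
    \<comment> \<open>By the mean value theorem the increment of \<open>\<phi> (y r)\<close> over
      \<open>{a..b}\<close> is \<open>y b - y a\<close> paired with \<open>D z\<close>. As
      \<open>z\<close> is within \<open>d1\<close> of every \<open>y s\<close>, replacing
      \<open>D z\<close> by \<open>D (y s)\<close> under the integral costs at most \<open>e\<close>
      times the integral of \<open>norm (h s)\<close>, and these errors add up to
      \<open>e * N\<close>.\<close>
    have *: "\<bar>g b - g a\<bar> \<le> e * integral {0..b} (\<lambda>s. norm (h s)) - e * integral {0..a} (\<lambda>s. norm (h s))"
      if ab: "0 \<le> a" "a \<le> b" "b \<le> t" "b - a \<le> d2 / 2" for a b
    proof -
      have sub: "{0..b} \<subseteq> {0..t}" "{a..b} \<subseteq> {0..t}" using ab by auto
      obtain z where z: "z \<in> closed_segment (y a) (y b)" "\<phi> (y b) - \<phi> (y a) = (y b - y a) \<bullet> D z"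
        using GDERIV_mean_value[OF \<phi>(1)] by blast
      have zR: "z \<in> cball 0 R"
      proof -
        have "y a \<in> cball 0 R" "y b \<in> cball 0 R" using R ab by (auto simp: image_subset_iff)
        then show ?thesis using z(1) closed_segment_subset[of "y a" "cball 0 R" "y b"] by auto
      qed
      have close: "norm (D z - D (y s)) \<le> e" if "s \<in> {a..b}" for s
      proof -
        have *: "y a \<in> ball (y s) d1" "y b \<in> ball (y s) d1"
          using d2[of s a] d2[of s b] that ab \<open>d2 > 0\<close> by (auto simp: dist_real_def)
        then have "z \<in> ball (y s) d1"
          using z(1) closed_segment_subset[of "y a" "ball (y s) d1" "y b"] convex_ball by blast
        then have "dist (D z) (D (y s)) < e"
          using that ab zR R by (intro d1) (auto simp: dist_commute image_subset_iff)
        then show ?thesis by (simp add: dist_norm)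
      qed
      have hab: "h integrable_on {a..b}" "(\<lambda>s. D (y s) \<bullet> h s) integrable_on {a..b}"
        "(\<lambda>s. norm (h s)) integrable_on {a..b}"
        using hint Dhint nint sub integrable_on_subinterval by blast+
      have hb: "h integrable_on {0..b}" "(\<lambda>s. D (y s) \<bullet> h s) integrable_on {0..b}"
        "(\<lambda>s. norm (h s)) integrable_on {0..b}"
        using hint Dhint nint sub integrable_on_subinterval by blast+
      have yab: "y b - y a = integral {a..b} h"
        using y[of a] y[of b] ab integral_combine_HK[of 0 a b h] hb(1)
        by (auto simp: algebra_simps)
      have "integral {0..b} (\<lambda>s. D (y s) \<bullet> h s) - integral {0..a} (\<lambda>s. D (y s) \<bullet> h s)
          = integral {a..b} (\<lambda>s. D (y s) \<bullet> h s)"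
        using ab integral_combine_HK[of 0 a b "\<lambda>s. D (y s) \<bullet> h s"] hb(2)
        by (auto simp: algebra_simps)
      then have "g b - g a = integral {a..b} h \<bullet> D z - integral {a..b} (\<lambda>s. D (y s) \<bullet> h s)"
        using z(2) yab by (simp add: g_def)
      also have "integral {a..b} h \<bullet> D z = integral {a..b} (\<lambda>s. h s \<bullet> D z)"
        using integral_component_eq hab(1) integral_linear[OF hab(1) bounded_linear_inner_left[of "D z"]]
        by (simp add: o_def)
      also have "integral {a..b} (\<lambda>s. h s \<bullet> D z) - integral {a..b} (\<lambda>s. D (y s) \<bullet> h s)
          = integral {a..b} (\<lambda>s. h s \<bullet> D z - D (y s) \<bullet> h s)"
        using hab integrable_linear[OF hab(1) bounded_linear_inner_left[of "D z"]]
        by (intro integral_diff[symmetric]) (auto simp: o_def)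
      finally have eq: "g b - g a = integral {a..b} (\<lambda>s. h s \<bullet> D z - D (y s) \<bullet> h s)" .
      have "norm (integral {a..b} (\<lambda>s. h s \<bullet> D z - D (y s) \<bullet> h s)) \<le> integral {a..b} (\<lambda>s. e * norm (h s))"
      proof (rule integral_norm_bound_integral)
        show "(\<lambda>s. h s \<bullet> D z - D (y s) \<bullet> h s) integrable_on {a..b}"
          using hab integrable_linear[OF hab(1) bounded_linear_inner_left[of "D z"]]
          by (intro integrable_diff) (auto simp: o_def)
        show "(\<lambda>s. e * norm (h s)) integrable_on {a..b}"
          using hab by (intro integrable_on_mult_right) auto
        fix s assume s: "s \<in> {a..b}"
        have "norm (h s \<bullet> D z - D (y s) \<bullet> h s) = \<bar>(D z - D (y s)) \<bullet> h s\<bar>"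
          by (simp add: inner_diff_left inner_commute[of "h s"])
        also have "\<dots> \<le> norm (D z - D (y s)) * norm (h s)"
          by (rule Cauchy_Schwarz_ineq2)
        also have "\<dots> \<le> e * norm (h s)"
          using close[OF s] by (intro mult_right_mono) auto
        finally show "norm (h s \<bullet> D z - D (y s) \<bullet> h s) \<le> e * norm (h s)" .
      qed
      also have "\<dots> = e * integral {0..b} (\<lambda>s. norm (h s)) - e * integral {0..a} (\<lambda>s. norm (h s))"
        using ab integral_combine_HK[of 0 a b "\<lambda>s. norm (h s)"] hb(3)
        by (auto simp: distrib_left[symmetric] right_diff_distrib[symmetric] simp del: distrib_left_numeral)
      finally show ?thesis using eq by simp
    qed
    have "g t - g 0 \<le> e * integral {0..t} (\<lambda>s. norm (h s)) - e * integral {0..0} (\<lambda>s. norm (h s))"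
      by (rule increment_le_if_small_increment_le[of "d2 / 2"]) (use * \<open>d2 > 0\<close> \<open>0 \<le> t\<close> in fastforce)+
    moreover have "- g t - (- g 0) \<le> e * integral {0..t} (\<lambda>s. norm (h s)) - e * integral {0..0} (\<lambda>s. norm (h s))"
      by (rule increment_le_if_small_increment_le[of "d2 / 2"]) (use * \<open>d2 > 0\<close> \<open>0 \<le> t\<close> in fastforce)+
    ultimately show ?thesis
      unfolding N_def by simp
  qed
  have "\<bar>g t - g 0\<bar> \<le> 0"
  proof (rule field_le_epsilon)
    fix e :: real assume "e > 0"
    \<comment> \<open>\<open>N\<close> may vanish, so \<open>e\<close> is divided by
      \<open>N + 1\<close>.\<close>
    then have "\<bar>g t - g 0\<bar> \<le> (e / (N + 1)) * N" using \<open>N \<ge> 0\<close> by (intro bound) auto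
    also have "\<dots> \<le> 0 + e" using \<open>N \<ge> 0\<close> \<open>e > 0\<close> by (simp add: field_simps)
    finally show "\<bar>g t - g 0\<bar> \<le> 0 + e" .
  qed
  then show "integral {0..t} (\<lambda>s. D (y s) \<bullet> h s) = \<phi> (y t) - \<phi> x"
    using y[of 0] \<open>0 \<le> t\<close> by (simp add: g_def)
qed

text \<open>The chain rule for \<open>exp (2 * x) / 2\<close> along the indefinite integral of
  \<open>k\<close>. The factor \<open>1/2\<close> on the right becomes the contraction constant of
  the Picard map.\<close>

lemma integral_times_exp_indefinite_integral:
  fixes k :: "real \<Rightarrow> real"
  assumes k: "k absolutely_integrable_on {0..t}" and "0 \<le> t"
  shows "(\<lambda>s. k s * exp (2 * integral {0..s} k)) absolutely_integrable_on {0..t}"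
    and "integral {0..t} (\<lambda>s. k s * exp (2 * integral {0..s} k)) = (exp (2 * integral {0..t} k) - 1) / 2"
proof -
  have 1: "GDERIV (\<lambda>x::real. exp (2 * x) / 2) x :> exp (2 * x)" for x
    by (auto intro!: derivative_eq_intros)
  have 2: "continuous_on UNIV (\<lambda>x::real. exp (2 * x))"
    by (intro continuous_intros)
  note * = integral_chain_rule[OF 1 2 k, where y = "\<lambda>s. integral {0..s} k" and x = 0, OF _ \<open>0 \<le> t\<close>]
  show "(\<lambda>s. k s * exp (2 * integral {0..s} k)) absolutely_integrable_on {0..t}"
    and "integral {0..t} (\<lambda>s. k s * exp (2 * integral {0..s} k)) = (exp (2 * integral {0..t} k) - 1) / 2"
    using * by (simp_all add: mult.commute diff_divide_distrib)
qed

section \<open>Caratheodory equations\<close>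

lemma continuous_on_atLeastI:
  fixes g :: "real \<Rightarrow> 'a::topological_space"
  assumes "\<And>t. 0 \<le> t \<Longrightarrow> continuous_on {0..t} g"
  shows "continuous_on {0..} g"
  unfolding continuous_on_eq_continuous_within
proof
  fix s :: real assume s: "s \<in> {0..}"
  then have "continuous (at s within {0..s+1}) g"
    using assms[of "s + 1"] by (auto simp: continuous_on_eq_continuous_within)
  moreover have "at s within {0..} = at s within {0..s+1}"
    by (rule at_within_nhd[of s "{..<s+1}"]) auto
  ultimately show "continuous (at s within {0..}) g" by simp
qed

text \<open>Caratheodory conditions: measurability in time for each fixed state, and one locally
  integrable \<open>k\<close> that serves both as Lipschitz constant and as bound at the origin.
  Ordinary controls give a \<open>k\<close> that may be unbounded, relaxed ones the constant
  \<open>K\<close>.\<close>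

locale lipschitz_field =
  fixes F :: "real \<Rightarrow> 'a::euclidean_space \<Rightarrow> 'a" and k :: "real \<Rightarrow> real"
  assumes F_measurable: "\<And>y. (\<lambda>s. F s y) \<in> borel_measurable (lebesgue_on {0..})"
    and k_integrable: "\<And>t. 0 \<le> t \<Longrightarrow> k integrable_on {0..t}"
    and F_lipschitz: "\<And>s x y. 0 \<le> s \<Longrightarrow> norm (F s x - F s y) \<le> k s * norm (x - y)"
    and F_zero: "\<And>s. 0 \<le> s \<Longrightarrow> norm (F s 0) \<le> k s"
begin

lemma k_nonneg: "0 \<le> s \<Longrightarrow> 0 \<le> k s"
  using F_zero norm_ge_zero order_trans by blast

lemma k_absolutely_integrable: "0 \<le> t \<Longrightarrow> k absolutely_integrable_on {0..t}"
  using k_integrable k_nonneg by (intro nonnegative_absolutely_integrable_1) auto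

definition \<kappa> :: "real \<Rightarrow> real" where "\<kappa> t = integral {0..t} k"

lemma \<kappa>_nonneg: "0 \<le> t \<Longrightarrow> 0 \<le> \<kappa> t"
  unfolding \<kappa>_def using k_nonneg by (intro integral_nonneg k_integrable) auto

lemma \<kappa>_continuous: "continuous_on {0..t} \<kappa>"
proof (cases "0 \<le> t")
  case True
  then show ?thesis
    unfolding \<kappa>_def using k_integrable by (intro indefinite_integral_continuous_1) auto
qed auto

lemma integral_k_exp_\<kappa>_le:
  assumes "0 \<le> t"
  shows "(\<lambda>s. k s * exp (2 * \<kappa> s)) integrable_on {0..t}"
    and "integral {0..t} (\<lambda>s. k s * exp (2 * \<kappa> s)) \<le> exp (2 * \<kappa> t) / 2"
  using integral_times_exp_indefinite_integral[OF k_absolutely_integrable[OF assms] assms]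
  by (auto simp: \<kappa>_def absolutely_integrable_on_def)

text \<open>The curve is sampled on the grid of mesh \<open>1 / Suc n\<close>. The sampled curve
  takes countably many values, so measurability for fixed states suffices, and the Lipschitz bound
  carries it to the limit.\<close>

lemma field_along_measurable:
  assumes y: "continuous_on {0..} y"
  shows "(\<lambda>s. F s (y s)) \<in> borel_measurable (lebesgue_on {0..})"
proof (rule borel_measurable_LIMSEQ_metric)
  define Y where "Y = (\<lambda>(n::nat) s. of_int \<lfloor>real (Suc n) * s\<rfloor> / real (Suc n))"
  fix n
  show "(\<lambda>s. F s (y (Y n s))) \<in> borel_measurable (lebesgue_on {0..})"
  proof -
    have "(\<lambda>s. \<lfloor>real (Suc n) * s\<rfloor>) \<in> measurable lborel (count_space UNIV)"
      by measurable
    then have "(\<lambda>s. \<lfloor>real (Suc n) * s\<rfloor>) \<in> measurable lebesgue (count_space UNIV)"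
      by (rule measurable_completion)
    then have "(\<lambda>s. \<lfloor>real (Suc n) * s\<rfloor>) \<in> measurable (lebesgue_on {0..}) (count_space UNIV)"
      by (rule measurable_restrict_space1)
    then show ?thesis
      unfolding Y_def by (rule measurable_compose_countable[OF F_measurable])
  qed
next
  define Y where "Y = (\<lambda>(n::nat) s. of_int \<lfloor>real (Suc n) * s\<rfloor> / real (Suc n) :: real)"
  fix s :: real assume "s \<in> space (lebesgue_on {0..})"
  then have s: "s \<ge> 0" by (simp add: space_restrict_space)
  have near: "norm (Y n s - s) \<le> 1 / real (Suc n)" and Ynn: "Y n s \<ge> 0" for n
  proof -
    have "\<bar>of_int \<lfloor>real (Suc n) * s\<rfloor> - real (Suc n) * s\<bar> \<le> 1"
      by linarith
    then have "\<bar>of_int \<lfloor>real (Suc n) * s\<rfloor> - real (Suc n) * s\<bar> / real (Suc n) \<le> 1 / real (Suc n)"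
      by (intro divide_right_mono) auto
    also have "\<bar>of_int \<lfloor>real (Suc n) * s\<rfloor> - real (Suc n) * s\<bar> / real (Suc n)
        = \<bar>(of_int \<lfloor>real (Suc n) * s\<rfloor> - real (Suc n) * s) / real (Suc n)\<bar>"
      by (subst abs_divide) simp
    also have "(of_int \<lfloor>real (Suc n) * s\<rfloor> - real (Suc n) * s) / real (Suc n) = Y n s - s"
      by (simp add: Y_def diff_divide_distrib del: of_nat_Suc)
    finally show "norm (Y n s - s) \<le> 1 / real (Suc n)"
      by simp
    show "Y n s \<ge> 0" using s by (simp add: Y_def)
  qed
  have "(\<lambda>n. Y n s - s) \<longlonglongrightarrow> 0"
    by (rule Lim_null_comparison[OF _ lim_1_over_n[THEN LIMSEQ_Suc]]) (use near in auto)
  then have "(\<lambda>n. Y n s) \<longlonglongrightarrow> s"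
    by (simp add: LIM_zero_iff)
  then have ylim: "(\<lambda>n. y (Y n s)) \<longlonglongrightarrow> y s"
    using y s Ynn continuous_on_tendsto_compose[OF y, of "\<lambda>n. Y n s" s sequentially] by auto
  have "(\<lambda>n. k s * norm (y (Y n s) - y s)) \<longlonglongrightarrow> k s * norm (y s - y s)"
    using ylim by (intro tendsto_intros)
  then have null: "(\<lambda>n. k s * norm (y (Y n s) - y s)) \<longlonglongrightarrow> 0" by simp
  have "\<forall>n. norm (F s (y (Y n s)) - F s (y s)) \<le> k s * norm (y (Y n s) - y s)"
    by (intro allI F_lipschitz s)
  from Lim_null_comparison[OF always_eventually[OF this] null]
  have "(\<lambda>n. F s (y (Y n s)) - F s (y s)) \<longlonglongrightarrow> 0" .
  then show "(\<lambda>n. F s (y (of_int \<lfloor>real (Suc n) * s\<rfloor> / real (Suc n)))) \<longlonglongrightarrow> F s (y s)"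
    by (simp add: LIM_zero_iff Y_def)
qed

lemma norm_F_le: "0 \<le> s \<Longrightarrow> norm (F s x) \<le> k s * (1 + norm x)"
  using F_lipschitz[of s x 0] F_zero[of s] norm_triangle_ineq[of "F s x - F s 0" "F s 0"]
  by (simp add: algebra_simps)

lemma field_along_absolutely_integrable:
  assumes y: "continuous_on {0..} y" and t: "0 \<le> t"
  shows "(\<lambda>s. F s (y s)) absolutely_integrable_on {0..t}"
proof -
  have "continuous_on {0..t} y" using y by (rule continuous_on_subset) auto
  then obtain B where B: "norm (y s) \<le> B" if "s \<in> {0..t}" for s
    using compact_imp_bounded[OF compact_continuous_image[of "{0..t}" y]]
    unfolding bounded_iff by (auto simp: image_iff) (meson atLeastAtMost_iff)
  show ?thesis
  proof (rule measurable_bounded_by_integrable_imp_absolutely_integrable)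
  show "(\<lambda>s. F s (y s)) \<in> borel_measurable (lebesgue_on {0..t})"
    by (rule measurable_restrict_mono[OF field_along_measurable[OF y]]) auto
  show "(\<lambda>s. k s * (1 + B)) integrable_on {0..t}"
    using k_integrable[OF t] by (rule integrable_on_mult_left)
  show "norm (F s (y s)) \<le> k s * (1 + B)" if "s \<in> {0..t}" for s
    using norm_F_le[of s "y s"] B[OF that] that k_nonneg[of s] mult_left_mono[of "1 + norm (y s)" "1 + B" "k s"]
    by auto
  qed auto
qed

lemma solution_continuous:
  assumes "caratheodory_solution F x y"
  shows "continuous_on {0..} y"
proof (rule continuous_on_atLeastI)
  fix t :: real assume t: "0 \<le> t"
  have "continuous_on {0..t} (\<lambda>s. x + integral {0..s} (\<lambda>s. F s (y s)))"
    using assms t unfolding caratheodory_solution_def absolutely_integrable_on_def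
    by (intro continuous_intros indefinite_integral_continuous_1) auto
  moreover have "y s = x + integral {0..s} (\<lambda>s. F s (y s))" if "s \<in> {0..t}" for s
    using assms that unfolding caratheodory_solution_def by auto
  ultimately show "continuous_on {0..t} y" by (metis (mono_tags, lifting) continuous_on_cong)
qed

text \<open>The weighted sup norm with weight \<open>exp (- 2 * \<kappa>)\<close> makes the Picard map a contraction with
  constant \<open>1/2\<close>; the same weight gives existence, uniqueness and stability.\<close>

lemma solution_stability:
  assumes y: "continuous_on {0..t} y" "\<And>s. s \<in> {0..t} \<Longrightarrow> (\<lambda>r. F r (y r)) integrable_on {0..s}"
      "\<And>s. s \<in> {0..t} \<Longrightarrow> y s = x + integral {0..s} (\<lambda>r. F r (y r))"
    and y': "continuous_on {0..t} y'" "\<And>s. s \<in> {0..t} \<Longrightarrow> (\<lambda>r. F r (y' r)) integrable_on {0..s}"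
      "\<And>s. s \<in> {0..t} \<Longrightarrow> y' s = x' + integral {0..s} (\<lambda>r. F r (y' r))"
    and s: "s \<in> {0..t}"
  shows "norm (y s - y' s) \<le> 2 * exp (2 * \<kappa> s) * norm (x - x')"
proof -
  define \<psi> where "\<psi> = (\<lambda>s. exp (- 2 * \<kappa> s) * norm (y s - y' s))"
  have "continuous_on {0..t} \<psi>"
    unfolding \<psi>_def by (intro continuous_intros \<kappa>_continuous y y')
  then obtain r where r: "r \<in> {0..t}" "\<And>s. s \<in> {0..t} \<Longrightarrow> \<psi> s \<le> \<psi> r"
    using continuous_attains_sup[of "{0..t}" \<psi>] s by auto
  \<comment> \<open>At a maximum point \<open>r\<close> of the weighted distance the integral term
    is at most half of \<open>norm (y r - y' r)\<close> and is absorbed on the left.\<close>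
  define m where "m = \<psi> r"
  have m: "norm (y s - y' s) \<le> m * exp (2 * \<kappa> s)" if "s \<in> {0..t}" for s
    using r(2)[OF that] by (simp add: \<psi>_def m_def exp_minus field_simps)
  have "norm (y r - y' r) = norm (x - x' + integral {0..r} (\<lambda>q. F q (y q) - F q (y' q)))"
    using y(2,3)[OF r(1)] y'(2,3)[OF r(1)] by (simp add: integral_diff algebra_simps)
  also have "\<dots> \<le> norm (x - x') + norm (integral {0..r} (\<lambda>q. F q (y q) - F q (y' q)))"
    by (rule norm_triangle_ineq)
  also have "norm (integral {0..r} (\<lambda>q. F q (y q) - F q (y' q)))
      \<le> integral {0..r} (\<lambda>q. m * (k q * exp (2 * \<kappa> q)))"
  proof (rule integral_norm_bound_integral)
    show "(\<lambda>q. F q (y q) - F q (y' q)) integrable_on {0..r}"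
      using y(2)[OF r(1)] y'(2)[OF r(1)] by (rule integrable_diff)
    show "(\<lambda>q. m * (k q * exp (2 * \<kappa> q))) integrable_on {0..r}"
      using integral_k_exp_\<kappa>_le(1)[of r] r(1) by (intro integrable_on_mult_right) auto
    fix q assume q: "q \<in> {0..r}"
    then have "norm (F q (y q) - F q (y' q)) \<le> k q * norm (y q - y' q)"
      by (intro F_lipschitz) auto
    also have "\<dots> \<le> k q * (m * exp (2 * \<kappa> q))"
      using q r(1) by (intro mult_left_mono m k_nonneg) auto
    finally show "norm (F q (y q) - F q (y' q)) \<le> m * (k q * exp (2 * \<kappa> q))"
      by (simp add: algebra_simps)
  qed
  also have "\<dots> = m * integral {0..r} (\<lambda>q. k q * exp (2 * \<kappa> q))"
    by simp
  also have "\<dots> \<le> m * (exp (2 * \<kappa> r) / 2)"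
    using r(1) by (intro mult_left_mono integral_k_exp_\<kappa>_le) (auto simp: m_def \<psi>_def)
  also have "m * (exp (2 * \<kappa> r) / 2) = norm (y r - y' r) / 2"
    by (simp add: m_def \<psi>_def exp_minus field_simps)
  finally have "norm (y r - y' r) \<le> 2 * norm (x - x')" by simp
  moreover have "exp (- 2 * \<kappa> r) \<le> 1" using \<kappa>_nonneg[of r] r(1) by auto
  ultimately have "m \<le> 1 * (2 * norm (x - x'))"
    unfolding m_def \<psi>_def by (intro mult_mono) auto
  then have "m * exp (2 * \<kappa> s) \<le> 2 * norm (x - x') * exp (2 * \<kappa> s)"
    by (intro mult_right_mono) auto
  also have "2 * norm (x - x') * exp (2 * \<kappa> s) = 2 * exp (2 * \<kappa> s) * norm (x - x')" by simp
  finally show ?thesis using m[OF s] by linarith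
qed

lemma solution_exists: "\<exists>y. caratheodory_solution F x y"
proof -
  \<comment> \<open>The unknown \<open>z\<close> is the weighted curve
    \<open>exp (- 2 * \<kappa> s) *\<^sub>R y s\<close>. \<open>Q\<close> freezes the Picard image
    at its initial value for negative times, since the bounded continuous functions used here live
    on the whole line.\<close>
  define P where "P = (\<lambda>(z :: real \<Rightarrow>\<^sub>C 'a) s. exp (- 2 * \<kappa> s) *\<^sub>R
      (x + integral {0..s} (\<lambda>r. F r (exp (2 * \<kappa> r) *\<^sub>R z r))))"
  define Q where "Q = (\<lambda>z s. P z (max 0 s))"
  have \<kappa>cont: "continuous_on {0..} \<kappa>"
    by (rule continuous_on_atLeastI[OF \<kappa>_continuous])
  have wcont: "continuous_on {0..} (\<lambda>r. exp (2 * \<kappa> r) *\<^sub>R apply_bcontfun z r)" for z :: "real \<Rightarrow>\<^sub>C 'a"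
    by (intro continuous_intros \<kappa>cont) auto
  note abs_int = field_along_absolutely_integrable[OF wcont]
  have int: "(\<lambda>r. F r (exp (2 * \<kappa> r) *\<^sub>R apply_bcontfun z r)) integrable_on {0..t}" if "0 \<le> t" for z t
    using abs_int[OF that] by (simp add: absolutely_integrable_on_def)
  have Pcont: "continuous_on {0..} (P z)" for z
  proof (rule continuous_on_atLeastI)
    show "continuous_on {0..t} (P z)" if "0 \<le> t" for t
      unfolding P_def using int[OF that]
      by (intro continuous_intros indefinite_integral_continuous_1 \<kappa>_continuous) auto
  qed
  have Qcont: "continuous_on UNIV (Q z)" for z
    unfolding Q_def by (rule continuous_on_compose2[OF Pcont]) (auto intro!: continuous_intros)
  \<comment> \<open>One estimate for two uses: applied to \<open>F\<close> along a curve it bounds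
    \<open>Q z\<close>, applied to a difference it gives the contraction constant
    \<open>1/2\<close>.\<close>
  have weighted: "norm (exp (- 2 * \<kappa> s) *\<^sub>R integral {0..s} h) \<le> c / 2"
    if "0 \<le> s" "h integrable_on {0..s}" "c \<ge> 0"
      "\<And>r. r \<in> {0..s} \<Longrightarrow> norm (h r) \<le> c * (k r * exp (2 * \<kappa> r))" for s c and h :: "real \<Rightarrow> 'a"
  proof -
    have "norm (integral {0..s} h) \<le> integral {0..s} (\<lambda>r. c * (k r * exp (2 * \<kappa> r)))"
    proof (rule integral_norm_bound_integral)
      show "(\<lambda>r. c * (k r * exp (2 * \<kappa> r))) integrable_on {0..s}"
        using integral_k_exp_\<kappa>_le(1)[OF that(1)] by (rule integrable_on_mult_right)
    qed (use that in blast)+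
    also have "\<dots> = c * integral {0..s} (\<lambda>r. k r * exp (2 * \<kappa> r))" by simp
    also have "\<dots> \<le> c * (exp (2 * \<kappa> s) / 2)"
      using that(1,3) by (intro mult_left_mono integral_k_exp_\<kappa>_le)
    finally have "exp (- 2 * \<kappa> s) * norm (integral {0..s} h) \<le> exp (- 2 * \<kappa> s) * (c * (exp (2 * \<kappa> s) / 2))"
      by (intro mult_left_mono) auto
    also have "\<dots> = c / 2"
      by (simp add: mult_exp_exp)
    finally show ?thesis by simp
  qed
  have Qbounded: "norm (Q z s) \<le> norm x + (1 + norm z) / 2" for z s
  proof -
    define s' where "s' = max 0 s"
    have s': "s' \<ge> 0" by (simp add: s'_def)
    have "norm (exp (- 2 * \<kappa> s') *\<^sub>R integral {0..s'} (\<lambda>r. F r (exp (2 * \<kappa> r) *\<^sub>R apply_bcontfun z r)))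
        \<le> (1 + norm z) / 2"
    proof (rule weighted[OF s' int[OF s']])
      fix r assume r: "r \<in> {0..s'}"
      have "norm (F r (exp (2 * \<kappa> r) *\<^sub>R z r)) \<le> k r * (1 + norm (exp (2 * \<kappa> r) *\<^sub>R z r))"
        using r by (intro norm_F_le) auto
      moreover have "1 + norm (exp (2 * \<kappa> r) *\<^sub>R z r) \<le> exp (2 * \<kappa> r) + exp (2 * \<kappa> r) * norm z"
        using norm_bounded[of z r] \<kappa>_nonneg[of r] r by (intro add_mono) (auto intro: mult_left_mono)
      moreover have "0 \<le> k r" using k_nonneg r by auto
      ultimately have "norm (F r (exp (2 * \<kappa> r) *\<^sub>R z r)) \<le> k r * (exp (2 * \<kappa> r) + exp (2 * \<kappa> r) * norm z)"
        by (meson mult_left_mono order_trans)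
      then show "norm (F r (exp (2 * \<kappa> r) *\<^sub>R z r)) \<le> (1 + norm z) * (k r * exp (2 * \<kappa> r))"
        by (simp add: algebra_simps)
    qed simp
    moreover have "norm (exp (- 2 * \<kappa> s') *\<^sub>R x) \<le> norm x"
      using \<kappa>_nonneg[OF s'] by (simp add: mult_left_le_one_le)
    ultimately show ?thesis
      unfolding Q_def P_def s'_def[symmetric] scaleR_add_right
      by (meson add_mono norm_triangle_ineq order_trans)
  qed
  define \<Phi> where "\<Phi> = (\<lambda>z. Bcontfun (Q z))"
  have \<Phi>: "apply_bcontfun (\<Phi> z) = Q z" for z
    unfolding \<Phi>_def by (intro Bcontfun_inverse bcontfun_normI[OF Qcont Qbounded])
  have "\<exists>!z. \<Phi> z = z"
  proof (rule banach_fix_type[of "1/2"])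
    show "\<forall>z z'. dist (\<Phi> z) (\<Phi> z') \<le> 1/2 * dist z z'"
    proof (intro allI dist_bound)
      fix z z' :: "real \<Rightarrow>\<^sub>C 'a" and s :: real
      define s' where "s' = max 0 s"
      have s': "s' \<ge> 0" by (simp add: s'_def)
      have "norm (exp (- 2 * \<kappa> s') *\<^sub>R integral {0..s'} (\<lambda>r. F r (exp (2 * \<kappa> r) *\<^sub>R apply_bcontfun z r)
          - F r (exp (2 * \<kappa> r) *\<^sub>R apply_bcontfun z' r))) \<le> dist z z' / 2"
      proof (rule weighted[OF s' integrable_diff[OF int[OF s'] int[OF s']]])
        fix r assume r: "r \<in> {0..s'}"
        then have "norm (F r (exp (2 * \<kappa> r) *\<^sub>R z r) - F r (exp (2 * \<kappa> r) *\<^sub>R z' r))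
            \<le> k r * norm (exp (2 * \<kappa> r) *\<^sub>R z r - exp (2 * \<kappa> r) *\<^sub>R z' r)"
          by (intro F_lipschitz) auto
        also have "\<dots> = k r * exp (2 * \<kappa> r) * dist (z r) (z' r)"
          by (simp add: dist_norm scaleR_diff_right[symmetric])
        also have "\<dots> \<le> k r * exp (2 * \<kappa> r) * dist z z'"
          using k_nonneg[of r] r by (intro mult_left_mono dist_bounded) auto
        finally show "norm (F r (exp (2 * \<kappa> r) *\<^sub>R z r) - F r (exp (2 * \<kappa> r) *\<^sub>R z' r))
            \<le> dist z z' * (k r * exp (2 * \<kappa> r))" by (simp add: algebra_simps)
      qed simp
      then show "dist (\<Phi> z s) (\<Phi> z' s) \<le> 1/2 * dist z z'"
        unfolding \<Phi> Q_def P_def s'_def[symmetric] dist_norm scaleR_diff_right[symmetric]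
        by (simp add: integral_diff[OF int[OF s'] int[OF s']] dist_norm)
    qed
  qed auto
  then obtain z where "\<Phi> z = z" by blast
  then have z: "apply_bcontfun z s = P z s" if "s \<ge> 0" for s
    using that \<Phi>[of z] by (simp add: Q_def)
  define y where "y = (\<lambda>s. exp (2 * \<kappa> s) *\<^sub>R apply_bcontfun z s)"
  have "y s = x + integral {0..s} (\<lambda>r. F r (y r))" if "s \<ge> 0" for s
    unfolding y_def z[OF that] by (subst P_def) (simp add: mult_exp_exp)
  moreover have "(\<lambda>r. F r (y r)) absolutely_integrable_on {0..s}" if "s \<ge> 0" for s
    unfolding y_def by (rule abs_int[OF that])
  ultimately show ?thesis
    unfolding caratheodory_solution_def by blast
qed

text \<open>Stability with equal starting points forces every global solution to agree with
  \<open>y\<close> on \<open>{0..t}\<close>, and the existence of a global one gives the definite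
  description its meaning. As \<open>y\<close> has to solve the equation on \<open>{0..t}\<close>
  only, the lemma also compares controls that agree up to time \<open>t\<close>.\<close>

lemma trajectory_eq:
  assumes y: "continuous_on {0..t} y" "\<And>s. s \<in> {0..t} \<Longrightarrow> (\<lambda>r. F r (y r)) integrable_on {0..s}"
      "\<And>s. s \<in> {0..t} \<Longrightarrow> y s = x + integral {0..s} (\<lambda>r. F r (y r))"
    and s: "s \<in> {0..t}"
  shows "trajectory F x s = y s"
proof -
  have unique: "y' s = y s" if "caratheodory_solution F x y'" for y'
  proof -
    have "norm (y' s - y s) \<le> 2 * exp (2 * \<kappa> s) * norm (x - x)"
    proof (rule solution_stability[OF _ _ _ y s])
      show "continuous_on {0..t} y'"
        using solution_continuous[OF that] continuous_on_subset by fastforce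
    qed (use that in \<open>auto simp: caratheodory_solution_def absolutely_integrable_on_def\<close>)
    then show ?thesis by simp
  qed
  obtain y' where y': "caratheodory_solution F x y'" using solution_exists by blast
  show ?thesis
    unfolding trajectory_def
  proof (rule the_equality)
    show "\<exists>y'. caratheodory_solution F x y' \<and> y s = y' s"
      using y' unique[OF y'] by metis
  qed (use unique in blast)
qed

lemma trajectory_solution: "caratheodory_solution F x (trajectory F x)"
proof -
  obtain y where y: "caratheodory_solution F x y" using solution_exists by blast
  have eq: "trajectory F x s = y s" if "s \<ge> 0" for s
  proof (rule trajectory_eq)
    show "continuous_on {0..s} y" using solution_continuous[OF y] by (rule continuous_on_subset) auto
  qed (use y that in \<open>auto simp: caratheodory_solution_def absolutely_integrable_on_def\<close>)
  have "(\<lambda>s. F s (trajectory F x s)) absolutely_integrable_on {0..t} \<longleftrightarrow>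
      (\<lambda>s. F s (y s)) absolutely_integrable_on {0..t}" for t
    by (rule set_integrable_cong) (simp_all add: eq)
  moreover have "integral {0..t} (\<lambda>s. F s (trajectory F x s)) = integral {0..t} (\<lambda>s. F s (y s))" for t
    by (rule integral_cong) (simp add: eq)
  ultimately show ?thesis
    using y unfolding caratheodory_solution_def by (simp add: eq)
qed

lemma trajectory_continuous: "continuous_on {0..} (trajectory F x)"
  by (rule solution_continuous[OF trajectory_solution])

lemma trajectory_integrable: "0 \<le> t \<Longrightarrow> (\<lambda>s. F s (trajectory F x s)) absolutely_integrable_on {0..t}"
  using trajectory_solution unfolding caratheodory_solution_def by blast

lemma trajectory_integral: "0 \<le> t \<Longrightarrow> trajectory F x t = x + integral {0..t} (\<lambda>s. F s (trajectory F x s))"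
  using trajectory_solution unfolding caratheodory_solution_def by blast

lemma trajectory_0: "trajectory F x 0 = x"
  using trajectory_integral[of 0 x] by simp

lemma trajectory_continuous_on: "continuous_on {0..t} (trajectory F x)"
  using trajectory_continuous by (rule continuous_on_subset) auto

lemma trajectory_stability:
  "0 \<le> t \<Longrightarrow>
    norm (trajectory F x t - trajectory F x' t) \<le> 2 * exp (2 * integral {0..t} k) * norm (x - x')"
  by (rule solution_stability[of t, unfolded \<kappa>_def])
    (use trajectory_integrable trajectory_integral trajectory_continuous_on in
      \<open>auto simp: absolutely_integrable_on_def\<close>)

end

section \<open>Controls and costs\<close>

lemmas lipschitz_field_trajectory =
  lipschitz_field.trajectory_continuous lipschitz_field.trajectory_continuous_on
  lipschitz_field.trajectory_integrable lipschitz_field.trajectory_integral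
  lipschitz_field.trajectory_0 lipschitz_field.trajectory_stability

section \<open>Translation of integrals and measurability of controls\<close>

lemma has_integral_shift:
  fixes h :: "real \<Rightarrow> 'a::banach"
  assumes "(h has_integral i) {t + a..t + b}"
  shows "((\<lambda>s. h (t + s)) has_integral i) {a..b}"
proof -
  have "((\<lambda>x. h (1 *\<^sub>R x + t)) has_integral (1 / \<bar>1\<bar> ^ DIM(real)) *\<^sub>R i)
      ((\<lambda>x. (1/1) *\<^sub>R x + - ((1/1) *\<^sub>R t)) ` cbox (t + a) (t + b))"
    using assms by (intro has_integral_affinity) auto
  moreover have "(\<lambda>x. (1/1) *\<^sub>R x + - ((1/1) *\<^sub>R t)) ` cbox (t + a) (t + b) = {a..b}"
    by (auto simp: image_iff intro!: bexI[of _ "t + _"])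
  ultimately show ?thesis by (simp add: add.commute)
qed

lemma integrable_on_shift:
  fixes h :: "real \<Rightarrow> 'a::banach"
  assumes "h integrable_on {t + a..t + b}"
  shows "(\<lambda>s. h (t + s)) integrable_on {a..b}"
  using has_integral_shift[OF integrable_integral[OF assms]] by blast

lemma integral_shift:
  fixes h :: "real \<Rightarrow> 'a::banach"
  assumes "h integrable_on {t + a..t + b}"
  shows "integral {a..b} (\<lambda>s. h (t + s)) = integral {t + a..t + b} h"
  using has_integral_shift[OF integrable_integral[OF assms]] by (rule integral_unique)

lemma borel_measurable_lebesgue_on:
  assumes "g \<in> borel_measurable (restrict_space borel S)"
  shows "g \<in> borel_measurable (lebesgue_on S)"
proof -
  have "(\<lambda>x. x) \<in> measurable lebesgue borel"
    by (intro measurable_completion) simp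
  then have "(\<lambda>x. x) \<in> measurable (lebesgue_on S) (restrict_space borel S)"
    by (rule measurable_restrict_space3) auto
  from measurable_comp[OF this assms] show ?thesis by (simp add: o_def)
qed

text \<open>For a nonnegative integrand gauge integrability is absolute, and Borel measurability
  brings it back from Lebesgue measure to \<open>lborel\<close>. From here on costs and weights can
  be handled as gauge integrals.\<close>

lemma controls_iff:
  "\<alpha> \<in> controls A q \<longleftrightarrow> \<alpha> \<in> borel_measurable (restrict_space borel {0..}) \<and> (\<forall>t\<ge>0. \<alpha> t \<in> A) \<and>
     (\<forall>t\<ge>0. (\<lambda>s. norm (\<alpha> s) ^ q) integrable_on {0..t})"
proof -
  have "set_integrable lborel {0..t} (\<lambda>s. norm (\<alpha> s) ^ q) \<longleftrightarrow> (\<lambda>s. norm (\<alpha> s) ^ q) integrable_on {0..t}"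
    if meas: "\<alpha> \<in> borel_measurable (restrict_space borel {0..})" for t
  proof
    assume "set_integrable lborel {0..t} (\<lambda>s. norm (\<alpha> s) ^ q)"
    then show "(\<lambda>s. norm (\<alpha> s) ^ q) integrable_on {0..t}"
      by (rule set_borel_integral_eq_integral)
  next
    assume "(\<lambda>s. norm (\<alpha> s) ^ q) integrable_on {0..t}"
    then have *: "set_integrable lebesgue {0..t} (\<lambda>s. norm (\<alpha> s) ^ q)"
      by (rule nonnegative_absolutely_integrable_1) auto
    have "\<alpha> \<in> borel_measurable (restrict_space borel {0..t})"
      using meas by (rule measurable_restrict_mono) auto
    then have "(\<lambda>s. norm (\<alpha> s) ^ q) \<in> borel_measurable (restrict_space borel {0..t})"
      by measurable
    then have "(\<lambda>s. indicator {0..t} s *\<^sub>R norm (\<alpha> s) ^ q) \<in> borel_measurable borel"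
      by (subst (asm) borel_measurable_restrict_space_iff) auto
    then show "set_integrable lborel {0..t} (\<lambda>s. norm (\<alpha> s) ^ q)"
      using * unfolding set_integrable_def by (simp add: integrable_completion)
  qed
  then show ?thesis
    unfolding controls_def by auto
qed

text \<open>The form of the data after two reductions: from the exponent \<open>p\<close> to
  \<open>q\<close>, and from one period cell to the whole space. One constant \<open>K\<close>
  stands for all growth and Lipschitz constants.\<close>

locale control_problem =
  fixes A :: "'b::euclidean_space set" and f :: "'a::euclidean_space \<Rightarrow> 'b \<Rightarrow> 'a"
    and l :: "'a \<Rightarrow> 'b \<Rightarrow> real" and q :: nat and K C1 C2 :: real
  assumes closed_A: "closed A" and cone_A: "cone A" and zero_A: "0 \<in> A"
    and f_continuous: "continuous_on (UNIV \<times> A) (\<lambda>(x, a). f x a)"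
    and l_continuous: "continuous_on (UNIV \<times> A) (\<lambda>(x, a). l x a)"
    and l_nonneg: "\<And>x a. a \<in> A \<Longrightarrow> 0 \<le> l x a"
    and q_pos: "1 \<le> q" and K_pos: "0 < K"
    and f_lipschitz: "\<And>x y a. a \<in> A \<Longrightarrow> norm (f x a - f y a) \<le> K * (1 + norm a ^ q) * norm (x - y)"
    and l_lipschitz: "\<And>x y a. a \<in> A \<Longrightarrow> \<bar>l x a - l y a\<bar> \<le> K * (1 + norm a ^ q) * norm (x - y)"
    and f_bound: "\<And>x a. a \<in> A \<Longrightarrow> norm (f x a) \<le> K * (1 + norm a ^ q)"
    and l_bound: "\<And>x a. a \<in> A \<Longrightarrow> l x a \<le> K * (1 + norm a ^ q)"
    and C1_nonneg: "0 \<le> C1" and C2_pos: "0 < C2"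
    and coercive: "\<And>x a. a \<in> A \<Longrightarrow> C2 * norm a ^ q - C1 \<le> l x a"
begin

abbreviation \<A> :: "(real \<Rightarrow> 'b) set" where "\<A> \<equiv> controls A q"

text \<open>Dominates at each time the speed, the running cost and both Lipschitz constants in space
  of the controlled system.\<close>

definition k :: "(real \<Rightarrow> 'b) \<Rightarrow> real \<Rightarrow> real" where "k \<alpha> s = K * (1 + norm (\<alpha> s) ^ q)"

definition traj :: "(real \<Rightarrow> 'b) \<Rightarrow> 'a \<Rightarrow> real \<Rightarrow> 'a" where
  "traj \<alpha> x = trajectory (\<lambda>s y. f y (\<alpha> s)) x"

definition cost :: "real \<Rightarrow> (real \<Rightarrow> 'b) \<Rightarrow> 'a \<Rightarrow> real \<Rightarrow> real" where
  "cost \<delta> \<alpha> x t = integral {0..t} (\<lambda>s. exp (- \<delta> * s) * l (traj \<alpha> x s) (\<alpha> s))"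

definition total_cost :: "real \<Rightarrow> (real \<Rightarrow> 'b) \<Rightarrow> 'a \<Rightarrow> ennreal" where
  "total_cost \<delta> \<alpha> x =
     (\<integral>\<^sup>+t\<in>{0..}. ennreal (exp (- \<delta> * t) * l (traj \<alpha> x t) (\<alpha> t)) \<partial>lborel)"

abbreviation running_cost :: "real \<Rightarrow> (real \<Rightarrow> 'b) \<Rightarrow> 'a \<Rightarrow> real \<Rightarrow> real" where
  "running_cost \<delta> \<alpha> x s \<equiv> exp (- \<delta> * s) * l (traj \<alpha> x s) (\<alpha> s)"

lemma k_integrable: "\<alpha> \<in> \<A> \<Longrightarrow> 0 \<le> t \<Longrightarrow> k \<alpha> integrable_on {0..t}"
  unfolding k_def by (intro integrable_on_mult_right integrable_add integrable_const_ivl) (auto simp: controls_iff)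

lemma k_nonneg: "0 \<le> k \<alpha> s"
  using K_pos by (simp add: k_def)

lemma along_measurable:
  fixes G :: "'a \<Rightarrow> 'b \<Rightarrow> 'c::real_normed_vector"
  assumes "continuous_on (UNIV \<times> A) (\<lambda>(x, a). G x a)" "continuous_on {0..} y" "\<alpha> \<in> \<A>"
  shows "(\<lambda>s. G (y s) (\<alpha> s)) \<in> borel_measurable (restrict_space borel {0..})"
proof -
  have y: "y \<in> borel_measurable (restrict_space borel {0..})"
    using assms(2) by (rule borel_measurable_continuous_on_restrict)
  have \<alpha>: "\<alpha> \<in> borel_measurable (restrict_space borel {0..})"
    using assms(3) by (simp add: controls_iff)
  have "(\<lambda>s. (y s, \<alpha> s)) \<in> measurable (restrict_space borel {0..}) (restrict_space borel (UNIV \<times> A))"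
  proof (rule measurable_restrict_space2)
    show "(\<lambda>s. (y s, \<alpha> s)) \<in> space (restrict_space borel {0..}) \<rightarrow> UNIV \<times> A"
      using assms(3) by (auto simp: controls_iff space_restrict_space)
    show "(\<lambda>s. (y s, \<alpha> s)) \<in> borel_measurable (restrict_space borel {0..})"
      using y \<alpha> by (rule borel_measurable_Pair)
  qed
  from measurable_comp[OF this borel_measurable_continuous_on_restrict[OF assms(1)]]
  show ?thesis by (simp add: o_def)
qed

lemma lipschitz_field_control:
  assumes \<alpha>: "\<alpha> \<in> \<A>"
  shows "lipschitz_field (\<lambda>s y. f y (\<alpha> s)) (k \<alpha>)"
proof
  show "(\<lambda>s. f y (\<alpha> s)) \<in> borel_measurable (lebesgue_on {0..})" for y
    using along_measurable[OF f_continuous _ \<alpha>, of "\<lambda>_. y"]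
    by (intro borel_measurable_lebesgue_on) auto
  have A: "\<alpha> s \<in> A" if "0 \<le> s" for s using \<alpha> that by (simp add: controls_iff)
  show "norm (f x (\<alpha> s) - f y (\<alpha> s)) \<le> k \<alpha> s * norm (x - y)" if "0 \<le> s" for s x y
    unfolding k_def by (intro f_lipschitz A that)
  show "norm (f 0 (\<alpha> s)) \<le> k \<alpha> s" if "0 \<le> s" for s
    unfolding k_def by (intro f_bound A that)
qed (use k_integrable[OF \<alpha>] in auto)

lemma traj_facts:
  assumes "\<alpha> \<in> \<A>"
  shows traj_continuous: "continuous_on {0..} (traj \<alpha> x)"
    and traj_continuous_on: "continuous_on {0..t} (traj \<alpha> x)"
    and traj_integrable: "0 \<le> t \<Longrightarrow> (\<lambda>s. f (traj \<alpha> x s) (\<alpha> s)) absolutely_integrable_on {0..t}"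
    and traj_integral: "0 \<le> t \<Longrightarrow> traj \<alpha> x t = x + integral {0..t} (\<lambda>s. f (traj \<alpha> x s) (\<alpha> s))"
    and traj_0: "traj \<alpha> x 0 = x"
    and traj_stability: "0 \<le> t \<Longrightarrow>
      norm (traj \<alpha> x t - traj \<alpha> x' t) \<le> 2 * exp (2 * integral {0..t} (k \<alpha>)) * norm (x - x')"
  unfolding traj_def
  by (rule lipschitz_field_trajectory[OF lipschitz_field_control[OF assms]] | assumption)+

abbreviation velocity :: "(real \<Rightarrow> 'b) \<Rightarrow> 'a \<Rightarrow> real \<Rightarrow> 'a" where
  "velocity \<alpha> x s \<equiv> f (traj \<alpha> x s) (\<alpha> s)"

lemma traj_integrable': "\<alpha> \<in> \<A> \<Longrightarrow> 0 \<le> t \<Longrightarrow> (velocity \<alpha> x) integrable_on {0..t}"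
  using traj_integrable by (simp add: absolutely_integrable_on_def)

lemma traj_unique:
  assumes "\<alpha> \<in> \<A>" "continuous_on {0..t} y"
    "\<And>s. s \<in> {0..t} \<Longrightarrow> (\<lambda>r. f (y r) (\<alpha> r)) integrable_on {0..s}"
    "\<And>s. s \<in> {0..t} \<Longrightarrow> y s = x + integral {0..s} (\<lambda>r. f (y r) (\<alpha> r))"
    "s \<in> {0..t}"
  shows "traj \<alpha> x s = y s"
  unfolding traj_def
  by (rule lipschitz_field.trajectory_eq[OF lipschitz_field_control]) (use assms in auto)

section \<open>Time shift and concatenation of controls\<close>

lemma shift_controls:
  assumes "\<alpha> \<in> \<A>" "0 \<le> t"
  shows "(\<lambda>s. \<alpha> (t + s)) \<in> \<A>"
  unfolding controls_iff
proof safe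
  have "(\<lambda>s. t + s) \<in> measurable (restrict_space borel {0..}) (restrict_space borel {0..})"
    using \<open>0 \<le> t\<close> by (intro measurable_restrict_space3) auto
  then show "(\<lambda>s. \<alpha> (t + s)) \<in> borel_measurable (restrict_space borel {0..})"
    using assms(1) measurable_comp[of "\<lambda>s. t + s" _ _ \<alpha>] by (auto simp: controls_iff o_def)
  show "\<alpha> (t + s) \<in> A" if "0 \<le> s" for s using assms that by (auto simp: controls_iff)
  show "(\<lambda>s. norm (\<alpha> (t + s)) ^ q) integrable_on {0..r}" if "0 \<le> r" for r
  proof (rule integrable_on_shift)
    have "(\<lambda>s. norm (\<alpha> s) ^ q) integrable_on {0..t+r}"
      using assms that by (auto simp: controls_iff)
    then show "(\<lambda>s. norm (\<alpha> s) ^ q) integrable_on {t+0..t+r}"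
      using \<open>0 \<le> t\<close> by (elim integrable_on_subinterval) auto
  qed
qed

text \<open>Both sides solve the shifted equation from the same starting point, so uniqueness
  applies.\<close>

lemma traj_shift:
  assumes \<alpha>: "\<alpha> \<in> \<A>" and t: "0 \<le> t" and s: "0 \<le> s"
  shows "traj (\<lambda>s. \<alpha> (t + s)) (traj \<alpha> x t) s = traj \<alpha> x (t + s)"
proof (rule traj_unique[where t = s])
  show "continuous_on {0..s} (\<lambda>s. traj \<alpha> x (t + s))"
    using t by (intro continuous_on_compose2[OF traj_continuous[OF \<alpha>]] continuous_intros) auto
  have sub: "velocity \<alpha> x integrable_on {t + 0..t + s'}" if "0 \<le> s'" for s'
    by (rule integrable_on_subinterval[OF traj_integrable'[OF \<alpha>, of "t + s'" x]]) (use t that in auto)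
  show "(\<lambda>r. f (traj \<alpha> x (t + r)) (\<alpha> (t + r))) integrable_on {0..s'}" if "s' \<in> {0..s}" for s'
    using that by (intro integrable_on_shift[OF sub]) auto
  show "traj \<alpha> x (t + s') = traj \<alpha> x t + integral {0..s'} (\<lambda>r. f (traj \<alpha> x (t + r)) (\<alpha> (t + r)))"
    if "s' \<in> {0..s}" for s'
  proof -
    have "traj \<alpha> x (t + s') = x + integral {0..t + s'} (velocity \<alpha> x)"
      using t that by (intro traj_integral[OF \<alpha>]) auto
    also have "integral {0..t + s'} (velocity \<alpha> x) =
        integral {0..t} (velocity \<alpha> x) + integral {t..t + s'} (velocity \<alpha> x)"
      using t that traj_integrable'[OF \<alpha>, of "t + s'" x]
      by (intro integral_combine_HK[symmetric]) auto
    also have "integral {t..t + s'} (velocity \<alpha> x) =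
        integral {0..s'} (\<lambda>r. f (traj \<alpha> x (t + r)) (\<alpha> (t + r)))"
      using integral_shift[OF sub[of s']] that by simp
    finally show ?thesis using traj_integral[OF \<alpha> t, of x] by (simp add: add.assoc)
  qed
qed (use shift_controls[OF \<alpha> t] s in auto)

definition switch_control :: "real \<Rightarrow> (real \<Rightarrow> 'b) \<Rightarrow> (real \<Rightarrow> 'b) \<Rightarrow> real \<Rightarrow> 'b" where
  "switch_control t \<alpha> \<beta> s = (if s < t then \<alpha> s else \<beta> (s - t))"

lemma switch_control_shift: "0 \<le> s \<Longrightarrow> switch_control t \<alpha> \<beta> (t + s) = \<beta> s"
  by (simp add: switch_control_def)

lemma switch_control_controls:
  assumes \<alpha>: "\<alpha> \<in> \<A>" and \<beta>: "\<beta> \<in> \<A>" and t: "0 \<le> t"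
  shows "switch_control t \<alpha> \<beta> \<in> \<A>"
  unfolding controls_iff
proof safe
  show "switch_control t \<alpha> \<beta> s \<in> A" if "0 \<le> s" for s
    using \<alpha> \<beta> that by (auto simp: controls_iff switch_control_def)
  \<comment> \<open>\<open>max 0\<close> keeps the argument of \<open>\<beta>\<close> in
    \<open>{0..}\<close>, where \<open>\<beta>\<close> is known to be measurable.\<close>
  have mb: "(\<lambda>s. \<beta> (max 0 (s - t))) \<in> borel_measurable (restrict_space borel {0..})"
  proof -
    have "(\<lambda>s. max 0 (s - t)) \<in> measurable (restrict_space borel {0..}) (restrict_space borel {0..})"
      by (intro measurable_restrict_space3) auto
    then show ?thesis
      using \<beta> measurable_comp[of "\<lambda>s. max 0 (s - t)" _ _ \<beta>] by (auto simp: controls_iff o_def)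
  qed
  have "(\<lambda>s. if s < t then \<alpha> s else \<beta> (max 0 (s - t))) \<in> borel_measurable (restrict_space borel {0..})"
  proof (rule measurable_If)
    show "\<alpha> \<in> borel_measurable (restrict_space borel {0..})" using \<alpha> by (simp add: controls_iff)
    have "{x \<in> space (restrict_space borel {0..}). x < t} = {0..} \<inter> {..<t}"
      by (auto simp: space_restrict_space)
    then show "{x \<in> space (restrict_space borel {0..}). x < t} \<in> sets (restrict_space borel {0..})"
      by (simp add: sets_restrict_space image_iff) (metis Int_commute borel_open open_lessThan)
  qed (rule mb)
  moreover have "switch_control t \<alpha> \<beta> = (\<lambda>s. if s < t then \<alpha> s else \<beta> (max 0 (s - t)))"
    by (auto simp: switch_control_def fun_eq_iff max_def)
  ultimately show "switch_control t \<alpha> \<beta> \<in> borel_measurable (restrict_space borel {0..})" by simp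
  show "(\<lambda>s. norm (switch_control t \<alpha> \<beta> s) ^ q) integrable_on {0..r}" if "0 \<le> r" for r
  proof -
    have "(\<lambda>s. norm (switch_control t \<alpha> \<beta> s) ^ q) integrable_on {0..t}"
    proof (rule integrable_spike_finite[of "{t}"])
      show "(\<lambda>s. norm (\<alpha> s) ^ q) integrable_on {0..t}" using \<alpha> t by (simp add: controls_iff)
    qed (auto simp: switch_control_def)
    moreover have "(\<lambda>s. norm (switch_control t \<alpha> \<beta> s) ^ q) integrable_on {t..t + r}"
    proof (rule integrable_eq)
      have "(\<lambda>s. norm (\<beta> s) ^ q) integrable_on {- t + t..- t + (t + r)}"
        using \<beta> that by (simp add: controls_iff)
      then show "(\<lambda>s. norm (\<beta> (- t + s)) ^ q) integrable_on {t..t + r}"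
        by (rule integrable_on_shift)
    qed (auto simp: switch_control_def)
    ultimately have "(\<lambda>s. norm (switch_control t \<alpha> \<beta> s) ^ q) integrable_on {0..t + r}"
      using t that by (intro Henstock_Kurzweil_Integration.integrable_combine[of 0 t "t + r"]) auto
    then show ?thesis using t by (elim integrable_on_subinterval) auto
  qed
qed

text \<open>Agreement on the half-open interval suffices up to and including time \<open>t\<close>,
  because one instant does not change the integrals. This is the form supplied by
  \<open>switch_control\<close>, which already follows the second control at time
  \<open>t\<close>.\<close>

lemma traj_cong:
  assumes \<alpha>: "\<alpha> \<in> \<A>" and \<beta>: "\<beta> \<in> \<A>"
    and eq: "\<And>s. 0 \<le> s \<Longrightarrow> s < t \<Longrightarrow> \<alpha> s = \<beta> s" and s: "s \<in> {0..t}"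
  shows "traj \<alpha> x s = traj \<beta> x s"
proof (rule traj_unique[OF \<alpha> _ _ _ s])
  show "(\<lambda>r. f (traj \<beta> x r) (\<alpha> r)) integrable_on {0..r}" if "r \<in> {0..t}" for r
    by (rule integrable_spike_finite[of "{t}", OF _ _ traj_integrable'[OF \<beta>, of r x]]) (use that eq in auto)
  show "traj \<beta> x r = x + integral {0..r} (\<lambda>r. f (traj \<beta> x r) (\<alpha> r))" if "r \<in> {0..t}" for r
  proof -
    have "integral {0..r} (\<lambda>r. f (traj \<beta> x r) (\<alpha> r)) = integral {0..r} (\<lambda>r. f (traj \<beta> x r) (\<beta> r))"
      by (rule integral_spike[of "{t}"]) (use that eq in auto)
    then show ?thesis using traj_integral[OF \<beta>, of r x] that by simp
  qed
qed (rule traj_continuous_on[OF \<beta>])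

section \<open>Cost integrals\<close>

lemma running_cost_measurable:
  assumes \<alpha>: "\<alpha> \<in> \<A>"
  shows "running_cost \<delta> \<alpha> x \<in> borel_measurable (restrict_space borel {0..})"
proof -
  have [measurable]: "(\<lambda>s. l (traj \<alpha> x s) (\<alpha> s)) \<in> borel_measurable (restrict_space borel {0..})"
    by (intro along_measurable l_continuous traj_continuous \<alpha>)
  have [measurable]: "(\<lambda>s. exp (- \<delta> * s)) \<in> borel_measurable (restrict_space borel {0..})"
    by (intro borel_measurable_continuous_on_restrict continuous_intros)
  show ?thesis by measurable
qed

lemma cost_integrand_integrable:
  assumes \<alpha>: "\<alpha> \<in> \<A>" and "0 \<le> \<delta>" "0 \<le> t"
  shows "(running_cost \<delta> \<alpha> x) integrable_on {0..t}"
proof -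
  have "(running_cost \<delta> \<alpha> x) absolutely_integrable_on {0..t}"
  proof (rule measurable_bounded_by_integrable_imp_absolutely_integrable[OF _ _ k_integrable[OF \<alpha> \<open>0 \<le> t\<close>]])
    show "running_cost \<delta> \<alpha> x \<in> borel_measurable (lebesgue_on {0..t})"
      by (rule measurable_restrict_mono[OF borel_measurable_lebesgue_on[OF running_cost_measurable[OF \<alpha>]]])
        auto
    fix s assume s: "s \<in> {0..t}"
    then have "\<alpha> s \<in> A" using \<alpha> by (simp add: controls_iff)
    then have *: "0 \<le> l (traj \<alpha> x s) (\<alpha> s)" "l (traj \<alpha> x s) (\<alpha> s) \<le> k \<alpha> s"
      using l_nonneg l_bound by (auto simp: k_def)
    have "running_cost \<delta> \<alpha> x s \<le> 1 * k \<alpha> s"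
      using s \<open>0 \<le> \<delta>\<close> * by (intro mult_mono) auto
    then show "norm (running_cost \<delta> \<alpha> x s) \<le> k \<alpha> s"
      using * by simp
  qed auto
  then show ?thesis by (simp add: absolutely_integrable_on_def)
qed

lemma nn_integral_cost:
  assumes \<alpha>: "\<alpha> \<in> \<A>" and "0 \<le> \<delta>" "0 \<le> t"
  shows "(\<integral>\<^sup>+s\<in>{0..t}. ennreal (running_cost \<delta> \<alpha> x s) \<partial>lborel) = ennreal (cost \<delta> \<alpha> x t)"
  unfolding cost_def
  by (rule nn_integral_has_integral_lebesgue'[OF _ integrable_integral[OF cost_integrand_integrable]])
    (use assms l_nonneg in \<open>auto simp: controls_iff\<close>)

lemma cost_nonneg:
  assumes \<alpha>: "\<alpha> \<in> \<A>" and "0 \<le> \<delta>" "0 \<le> t"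
  shows "0 \<le> cost \<delta> \<alpha> x t"
  unfolding cost_def
  by (rule integral_nonneg[OF cost_integrand_integrable]) (use assms l_nonneg in \<open>auto simp: controls_iff\<close>)

text \<open>Cutting the integral at \<open>t\<close> and translating the tail turns the discount
  into the factor \<open>exp (- \<delta> * t)\<close>. The identity is stated in
  \<open>ennreal\<close> and so covers controls of infinite total cost.\<close>

lemma total_cost_split:
  assumes \<alpha>: "\<alpha> \<in> \<A>" and \<delta>: "0 \<le> \<delta>" and t: "0 \<le> t"
  shows "total_cost \<delta> \<alpha> x = ennreal (cost \<delta> \<alpha> x t) +
    ennreal (exp (- \<delta> * t)) * total_cost \<delta> (\<lambda>s. \<alpha> (t + s)) (traj \<alpha> x t)"
proof -
  define g where "g = (\<lambda>s. ennreal (running_cost \<delta> \<alpha> x s))"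
  have meas: "(\<lambda>s. g s * indicator S s) \<in> borel_measurable borel" if "S \<in> sets borel" "S \<subseteq> {0..}" for S
  proof -
    have "running_cost \<delta> \<alpha> x \<in> borel_measurable (restrict_space borel S)"
      by (rule measurable_restrict_mono[OF running_cost_measurable[OF \<alpha>]]) (use that in auto)
    then have "g \<in> borel_measurable (restrict_space borel S)"
      unfolding g_def by measurable
    then show ?thesis
      using that by (subst (asm) borel_measurable_restrict_space_iff_ennreal) (auto simp: mult.commute)
  qed
  have "total_cost \<delta> \<alpha> x = (\<integral>\<^sup>+s. g s * indicator {0..t} s + g s * indicator {t<..} s \<partial>lborel)"
    unfolding total_cost_def g_def using t by (intro nn_integral_cong) (auto simp: indicator_def)
  also have "\<dots> = (\<integral>\<^sup>+s. g s * indicator {0..t} s \<partial>lborel) + (\<integral>\<^sup>+s. g s * indicator {t<..} s \<partial>lborel)"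
    using meas[of "{0..t}"] meas[of "{t<..}"] t by (intro nn_integral_add) (auto simp: subset_iff)
  also have "(\<integral>\<^sup>+s. g s * indicator {0..t} s \<partial>lborel) = ennreal (cost \<delta> \<alpha> x t)"
    unfolding g_def by (rule nn_integral_cost[OF \<alpha> \<delta> t])
  also have "(\<integral>\<^sup>+s. g s * indicator {t<..} s \<partial>lborel) =
      (\<integral>\<^sup>+s. g (t + s) * indicator {t<..} (t + s) \<partial>lborel)"
    using nn_integral_real_affine[OF meas[of "{t<..}"], of 1 t] t by (auto simp: subset_iff)
  also have "\<dots> = (\<integral>\<^sup>+s. ennreal (exp (- \<delta> * t)) * (ennreal (running_cost \<delta> (\<lambda>s. \<alpha> (t + s)) (traj \<alpha> x t) s) * indicator {0..} s) \<partial>lborel)"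
  proof (rule nn_integral_cong_AE)
    \<comment> \<open>The translated tail lives on \<open>{0<..}\<close>, the total cost on
      \<open>{0..}\<close>; they differ at the instant 0 only.\<close>
    have "AE s in lborel. s \<noteq> (0::real)" by (rule AE_lborel_singleton)
    then show "AE s in lborel. g (t + s) * indicator {t<..} (t + s) =
      ennreal (exp (- \<delta> * t)) * (ennreal (running_cost \<delta> (\<lambda>s. \<alpha> (t + s)) (traj \<alpha> x t) s) * indicator {0..} s)"
    proof eventually_elim
      case (elim s)
      show ?case
      proof (cases "s \<ge> 0")
        case True
        have "exp (- \<delta> * (t + s)) = exp (- \<delta> * t) * exp (- \<delta> * s)"
          by (simp add: mult_exp_exp algebra_simps)
        then show ?thesis
          using True elim traj_shift[OF \<alpha> t True, of x]
          by (simp add: g_def indicator_def ennreal_mult' mult.assoc)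
      qed (simp add: indicator_def)
    qed
  qed
  also have "\<dots> = ennreal (exp (- \<delta> * t)) * total_cost \<delta> (\<lambda>s. \<alpha> (t + s)) (traj \<alpha> x t)"
  proof -
    have [measurable]: "(running_cost \<delta> (\<lambda>s. \<alpha> (t + s)) (traj \<alpha> x t)) \<in> borel_measurable (restrict_space borel {0..})"
      by (intro running_cost_measurable shift_controls \<alpha> t)
    have "(\<lambda>s. ennreal (running_cost \<delta> (\<lambda>s. \<alpha> (t + s)) (traj \<alpha> x t) s))
        \<in> borel_measurable (restrict_space borel {0..})"
      by measurable
    then have "(\<lambda>s. ennreal (running_cost \<delta> (\<lambda>s. \<alpha> (t + s)) (traj \<alpha> x t) s) * indicator {0..} s)
        \<in> borel_measurable borel"
      by (subst (asm) borel_measurable_restrict_space_iff_ennreal) (auto simp: mult.commute)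
    then show ?thesis
      unfolding total_cost_def by (intro nn_integral_cmult) simp
  qed
  finally show ?thesis .
qed

section \<open>Dynamic programming\<close>

definition V :: "real \<Rightarrow> 'a \<Rightarrow> real" where "V \<delta> x = discounted_value A q f l \<delta> x"

definition VT :: "real \<Rightarrow> 'a \<Rightarrow> real" where "VT t x = finite_horizon_value A q f l t x"

lemma constant_control: "a \<in> A \<Longrightarrow> (\<lambda>_. a) \<in> \<A>"
  by (auto simp: controls_iff)

lemma cost_cong:
  assumes \<alpha>: "\<alpha> \<in> \<A>" and \<beta>: "\<beta> \<in> \<A>"
    and eq: "\<And>s. 0 \<le> s \<Longrightarrow> s < t \<Longrightarrow> \<alpha> s = \<beta> s"
  shows "cost \<delta> \<alpha> x t = cost \<delta> \<beta> x t"
  unfolding cost_def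
  by (rule integral_spike[of "{t}"]) (use traj_cong[OF \<alpha> \<beta> eq] eq in auto)

lemma total_cost_cong:
  assumes \<alpha>: "\<alpha> \<in> \<A>" and \<beta>: "\<beta> \<in> \<A>"
    and eq: "\<And>s. 0 \<le> s \<Longrightarrow> \<alpha> s = \<beta> s"
  shows "total_cost \<delta> \<alpha> x = total_cost \<delta> \<beta> x"
proof -
  have "traj \<alpha> x s = traj \<beta> x s" if "0 \<le> s" for s
    by (rule traj_cong[OF \<alpha> \<beta>, of s]) (use eq that in auto)
  then show ?thesis
    unfolding total_cost_def using eq by (intro nn_integral_cong) (auto simp: indicator_def)
qed

lemma V_eq: "V \<delta> x = enn2real (INF \<alpha>\<in>\<A>. total_cost \<delta> \<alpha> x)"
  unfolding V_def discounted_value_def total_cost_def traj_def by simp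

lemma l_zero_le: "l x 0 \<le> K"
  using l_bound[OF zero_A, of x] q_pos by (simp add: power_0_left)

lemma total_cost_zero_le:
  assumes "0 < \<delta>"
  shows "total_cost \<delta> (\<lambda>_. 0) x \<le> ennreal (K / \<delta>)"
proof -
  have "total_cost \<delta> (\<lambda>_. 0) x \<le> (\<integral>\<^sup>+t\<in>{0..}. ennreal (K * exp (- \<delta> * t)) \<partial>lborel)"
    unfolding total_cost_def
    using l_zero_le l_nonneg[OF zero_A]
    by (intro nn_integral_mono) (auto simp: indicator_def mult.commute intro!: ennreal_leI mult_right_mono)
  also have "\<dots> = ennreal (K * (exp (- \<delta> * 0) / \<delta>))"
    using has_integral_exp_minus_to_infinity[OF assms, of 0] K_pos
    by (intro nn_integral_has_integral_lebesgue' has_integral_mult_right) auto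
  finally show ?thesis by simp
qed

text \<open>The zero control has finite total cost, so the infimum is finite and
  \<open>enn2real\<close> loses nothing.\<close>

lemma ennreal_V:
  assumes "0 < \<delta>"
  shows "ennreal (V \<delta> x) = (INF \<alpha>\<in>\<A>. total_cost \<delta> \<alpha> x)"
proof -
  have "(INF \<alpha>\<in>\<A>. total_cost \<delta> \<alpha> x) \<le> total_cost \<delta> (\<lambda>_. 0) x"
    by (rule INF_lower) (rule constant_control[OF zero_A])
  also have "\<dots> < \<top>"
    using total_cost_zero_le[OF assms] ennreal_less_top le_less_trans by blast
  finally show ?thesis unfolding V_eq by (simp add: ennreal_enn2real)
qed

lemma V_nonneg: "0 \<le> V \<delta> x"
  by (simp add: V_eq)

lemma V_le:
  assumes "0 < \<delta>"
  shows "V \<delta> x \<le> K / \<delta>"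
proof -
  have "ennreal (V \<delta> x) \<le> total_cost \<delta> (\<lambda>_. 0) x"
    unfolding ennreal_V[OF assms] by (rule INF_lower) (rule constant_control[OF zero_A])
  also note total_cost_zero_le[OF assms]
  finally show ?thesis using assms K_pos by simp
qed

lemma near_optimal:
  assumes "0 < \<delta>" "0 < e"
  shows "\<exists>\<alpha>\<in>\<A>. total_cost \<delta> \<alpha> x \<le> ennreal (V \<delta> x + e)"
proof -
  have "(INF \<alpha>\<in>\<A>. total_cost \<delta> \<alpha> x) < ennreal (V \<delta> x + e)"
    unfolding ennreal_V[OF assms(1), symmetric] using assms(2) V_nonneg[of \<delta> x]
    by (intro ennreal_lessI) auto
  then show ?thesis by (auto simp: INF_less_iff intro: less_imp_le)
qed

text \<open>Follow \<open>\<alpha>\<close> up to time \<open>t\<close>, then switch to a control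
  that is near-optimal from the point reached.\<close>

lemma V_le_cost:
  assumes \<delta>: "0 < \<delta>" and \<alpha>: "\<alpha> \<in> \<A>" and t: "0 \<le> t"
  shows "V \<delta> x \<le> cost \<delta> \<alpha> x t + exp (- \<delta> * t) * V \<delta> (traj \<alpha> x t)"
proof (rule field_le_epsilon)
  fix e :: real assume e: "0 < e"
  obtain \<beta> where \<beta>: "\<beta> \<in> \<A>" "total_cost \<delta> \<beta> (traj \<alpha> x t) \<le> ennreal (V \<delta> (traj \<alpha> x t) + e)"
    using near_optimal[OF \<delta> e] by blast
  define \<gamma> where "\<gamma> = switch_control t \<alpha> \<beta>"
  have \<gamma>: "\<gamma> \<in> \<A>" unfolding \<gamma>_def using \<alpha> \<beta>(1) t by (rule switch_control_controls)
  have eq: "\<gamma> s = \<alpha> s" if "0 \<le> s" "s < t" for s using that by (simp add: \<gamma>_def switch_control_def)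
  have "ennreal (V \<delta> x) \<le> total_cost \<delta> \<gamma> x"
    unfolding ennreal_V[OF \<delta>] using \<gamma> by (rule INF_lower)
  also have "\<dots> = ennreal (cost \<delta> \<gamma> x t) + ennreal (exp (- \<delta> * t)) * total_cost \<delta> (\<lambda>s. \<gamma> (t + s)) (traj \<gamma> x t)"
    using \<gamma> \<delta> t by (intro total_cost_split) auto
  also have "cost \<delta> \<gamma> x t = cost \<delta> \<alpha> x t" using cost_cong[OF \<gamma> \<alpha> eq] .
  also have "traj \<gamma> x t = traj \<alpha> x t" using traj_cong[OF \<gamma> \<alpha> eq] t by auto
  also have "total_cost \<delta> (\<lambda>s. \<gamma> (t + s)) (traj \<alpha> x t) = total_cost \<delta> \<beta> (traj \<alpha> x t)"
    using shift_controls[OF \<gamma> t] \<beta>(1) by (rule total_cost_cong) (simp add: \<gamma>_def switch_control_shift)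
  also have "ennreal (cost \<delta> \<alpha> x t) + ennreal (exp (- \<delta> * t)) * total_cost \<delta> \<beta> (traj \<alpha> x t)
      \<le> ennreal (cost \<delta> \<alpha> x t) + ennreal (exp (- \<delta> * t)) * ennreal (V \<delta> (traj \<alpha> x t) + e)"
    using \<beta>(2) by (intro add_left_mono mult_left_mono) auto
  also have "\<dots> = ennreal (cost \<delta> \<alpha> x t + exp (- \<delta> * t) * (V \<delta> (traj \<alpha> x t) + e))"
    using cost_nonneg[OF \<alpha>, of \<delta> t x] \<delta> t V_nonneg[of \<delta> "traj \<alpha> x t"] e
    by (simp add: ennreal_mult ennreal_plus)
  finally have "V \<delta> x \<le> cost \<delta> \<alpha> x t + exp (- \<delta> * t) * (V \<delta> (traj \<alpha> x t) + e)"
    using cost_nonneg[OF \<alpha>, of \<delta> t x] \<delta> t V_nonneg[of \<delta> "traj \<alpha> x t"] e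
    by (subst (asm) ennreal_le_iff) auto
  also have "\<dots> \<le> cost \<delta> \<alpha> x t + exp (- \<delta> * t) * V \<delta> (traj \<alpha> x t) + 1 * e"
    using \<delta> t e by (simp add: distrib_left)
  finally show "V \<delta> x \<le> cost \<delta> \<alpha> x t + exp (- \<delta> * t) * V \<delta> (traj \<alpha> x t) + e" by simp
qed

text \<open>A near-optimal control for the infinite horizon is near-optimal at all intermediate times
  simultaneously; this is what makes stopping at an exit time unproblematic later on.\<close>

lemma cost_le_V:
  assumes \<delta>: "0 < \<delta>" and e: "0 < e"
  shows "\<exists>\<alpha>\<in>\<A>. \<forall>t\<ge>0. cost \<delta> \<alpha> x t + exp (- \<delta> * t) * V \<delta> (traj \<alpha> x t) \<le> V \<delta> x + e"
proof -
  obtain \<alpha> where \<alpha>: "\<alpha> \<in> \<A>" "total_cost \<delta> \<alpha> x \<le> ennreal (V \<delta> x + e)"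
    using near_optimal[OF \<delta> e] by blast
  have "cost \<delta> \<alpha> x t + exp (- \<delta> * t) * V \<delta> (traj \<alpha> x t) \<le> V \<delta> x + e" if t: "0 \<le> t" for t
  proof -
    have "ennreal (cost \<delta> \<alpha> x t + exp (- \<delta> * t) * V \<delta> (traj \<alpha> x t))
        = ennreal (cost \<delta> \<alpha> x t) + ennreal (exp (- \<delta> * t)) * ennreal (V \<delta> (traj \<alpha> x t))"
      using cost_nonneg[OF \<alpha>(1), of \<delta> t x] \<delta> t V_nonneg[of \<delta> "traj \<alpha> x t"]
      by (simp add: ennreal_mult ennreal_plus)
    also have "\<dots> \<le> ennreal (cost \<delta> \<alpha> x t) + ennreal (exp (- \<delta> * t)) * total_cost \<delta> (\<lambda>s. \<alpha> (t + s)) (traj \<alpha> x t)"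
      unfolding ennreal_V[OF \<delta>]
      by (intro add_left_mono mult_left_mono INF_lower shift_controls[OF \<alpha>(1) t]) auto
    also have "\<dots> = total_cost \<delta> \<alpha> x"
      using \<alpha>(1) \<delta> t by (intro total_cost_split[symmetric]) auto
    also note \<alpha>(2)
    finally show ?thesis using V_nonneg[of \<delta> x] e by (subst (asm) ennreal_le_iff) auto
  qed
  then show ?thesis using \<alpha>(1) by blast
qed

lemma ennreal_VT:
  assumes "0 \<le> t"
  shows "ennreal (VT t x) = (INF \<alpha>\<in>\<A>. ennreal (cost 0 \<alpha> x t))"
proof -
  have "VT t x = enn2real (INF \<alpha>\<in>\<A>. ennreal (cost 0 \<alpha> x t))"
    unfolding VT_def finite_horizon_value_def
    using nn_integral_cost[of _ 0 t x] assms
    by (intro arg_cong[where f = enn2real] INF_cong) (auto simp: traj_def)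
  moreover have "(INF \<alpha>\<in>\<A>. ennreal (cost 0 \<alpha> x t)) < \<top>"
    using INF_lower[OF constant_control[OF zero_A], of "\<lambda>\<alpha>. ennreal (cost 0 \<alpha> x t)"] ennreal_less_top
      le_less_trans by blast
  ultimately show ?thesis by (simp add: ennreal_enn2real)
qed

lemma VT_le_cost:
  assumes "0 \<le> t" "\<alpha> \<in> \<A>"
  shows "VT t x \<le> cost 0 \<alpha> x t"
proof -
  have "ennreal (VT t x) \<le> ennreal (cost 0 \<alpha> x t)"
    unfolding ennreal_VT[OF assms(1)] using assms(2) by (rule INF_lower)
  then show ?thesis using cost_nonneg[OF assms(2), of 0 t x] assms(1) by simp
qed

lemma VT_ge:
  assumes "0 \<le> t" "\<And>\<alpha>. \<alpha> \<in> \<A> \<Longrightarrow> c \<le> cost 0 \<alpha> x t"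
  shows "c \<le> VT t x"
proof -
  have "ennreal c \<le> ennreal (VT t x)"
    unfolding ennreal_VT[OF assms(1)] by (intro INF_greatest ennreal_leI assms(2))
  moreover have "0 \<le> VT t x" by (simp add: VT_def finite_horizon_value_def)
  ultimately show ?thesis by (auto simp: ennreal_le_iff2)
qed

text \<open>Coercivity bounds \<open>norm (\<alpha> s) ^ q\<close> by the running cost, and the
  factor \<open>exp (\<delta> * t)\<close> undoes the discount on \<open>{0..t}\<close>. A bound on
  the cost thus bounds the exponent in the stability estimate.\<close>

lemma integral_k_le:
  assumes \<alpha>: "\<alpha> \<in> \<A>" and \<delta>: "0 \<le> \<delta>" and t: "0 \<le> t"
  shows "integral {0..t} (k \<alpha>) \<le> K * (t + (exp (\<delta> * t) * cost \<delta> \<alpha> x t + C1 * t) / C2)"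
proof -
  have int: "(running_cost \<delta> \<alpha> x) integrable_on {0..t}"
    by (rule cost_integrand_integrable[OF \<alpha> \<delta> t])
  have "integral {0..t} (k \<alpha>) \<le> integral {0..t}
      (\<lambda>s. K * (1 + C1 / C2) + (K * exp (\<delta> * t) / C2) * (running_cost \<delta> \<alpha> x s))"
  proof (rule integral_le[OF k_integrable[OF \<alpha> t]])
    show "(\<lambda>s. K * (1 + C1 / C2) + (K * exp (\<delta> * t) / C2) * (running_cost \<delta> \<alpha> x s)) integrable_on {0..t}"
      by (intro integrable_add integrable_const_ivl integrable_on_mult_right int)
    fix s assume s: "s \<in> {0..t}"
    then have A: "\<alpha> s \<in> A" using \<alpha> by (simp add: controls_iff)
    define L where "L = l (traj \<alpha> x s) (\<alpha> s)"
    have "exp (\<delta> * t) * exp (- \<delta> * s) = exp (\<delta> * (t - s))"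
      by (simp add: mult_exp_exp algebra_simps)
    moreover have "exp (\<delta> * (t - s)) \<ge> 1" using s \<delta> by simp
    ultimately have "1 * L \<le> exp (\<delta> * t) * exp (- \<delta> * s) * L"
      using l_nonneg[OF A] unfolding L_def by (intro mult_right_mono) auto
    moreover have "C2 * norm (\<alpha> s) ^ q \<le> L + C1" using coercive[OF A] by (simp add: L_def algebra_simps)
    ultimately have "C2 * norm (\<alpha> s) ^ q \<le> exp (\<delta> * t) * exp (- \<delta> * s) * L + C1" by simp
    then have "norm (\<alpha> s) ^ q \<le> (exp (\<delta> * t) * exp (- \<delta> * s) * L + C1) / C2"
      using C2_pos by (simp add: field_simps)
    then have "k \<alpha> s \<le> K * (1 + (exp (\<delta> * t) * exp (- \<delta> * s) * L + C1) / C2)"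
      unfolding k_def using K_pos by (intro mult_left_mono) auto
    also have "\<dots> = K * (1 + C1 / C2) + (K * exp (\<delta> * t) / C2) * (exp (- \<delta> * s) * L)"
      using C2_pos by (simp add: field_simps)
    finally show "k \<alpha> s \<le> K * (1 + C1 / C2) + (K * exp (\<delta> * t) / C2) * (running_cost \<delta> \<alpha> x s)"
      unfolding L_def .
  qed
  also have "\<dots> = t * (K * (1 + C1 / C2)) + (K * exp (\<delta> * t) / C2) * cost \<delta> \<alpha> x t"
    unfolding cost_def using t
    by (subst integral_add[OF integrable_const_ivl integrable_on_mult_right[OF int]]) simp
  also have "\<dots> = K * (t + (exp (\<delta> * t) * cost \<delta> \<alpha> x t + C1 * t) / C2)"
    using C2_pos by (simp add: field_simps)
  finally show ?thesis .
qed

text \<open>The same control is used from both points. The estimate depends on it only through the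
  integral of \<open>k\<close>, the quantity that a bound on the cost controls.\<close>

lemma cost_diff_le:
  assumes \<alpha>: "\<alpha> \<in> \<A>" and \<delta>: "0 \<le> \<delta>" and t: "0 \<le> t"
  shows "cost \<delta> \<alpha> x t - cost \<delta> \<alpha> z t
    \<le> integral {0..t} (k \<alpha>) * (2 * exp (2 * integral {0..t} (k \<alpha>)) * norm (x - z))"
proof -
  define B where "B = 2 * exp (2 * integral {0..t} (k \<alpha>)) * norm (x - z)"
  have "cost \<delta> \<alpha> x t - cost \<delta> \<alpha> z t = integral {0..t}
      (\<lambda>s. running_cost \<delta> \<alpha> x s - running_cost \<delta> \<alpha> z s)"
    unfolding cost_def by (intro integral_diff[symmetric] cost_integrand_integrable \<alpha> \<delta> t)
  also have "\<dots> \<le> integral {0..t} (\<lambda>s. k \<alpha> s * B)"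
  proof (rule integral_le)
    show "(\<lambda>s. running_cost \<delta> \<alpha> x s - running_cost \<delta> \<alpha> z s) integrable_on {0..t}"
      by (intro integrable_diff cost_integrand_integrable \<alpha> \<delta> t)
    show "(\<lambda>s. k \<alpha> s * B) integrable_on {0..t}"
      by (intro integrable_on_mult_left k_integrable \<alpha> t)
    fix s assume s: "s \<in> {0..t}"
    have "integral {0..s} (k \<alpha>) \<le> integral {0..t} (k \<alpha>)"
      using s k_integrable[OF \<alpha>] k_nonneg by (intro integral_subset_le) auto
    then have "2 * exp (2 * integral {0..s} (k \<alpha>)) * norm (x - z) \<le> B"
      unfolding B_def by (intro mult_right_mono) auto
    then have nB: "norm (traj \<alpha> x s - traj \<alpha> z s) \<le> B"
      using traj_stability[OF \<alpha>, of s x z] s by auto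
    have "\<alpha> s \<in> A" using \<alpha> s by (simp add: controls_iff)
    then have "\<bar>l (traj \<alpha> x s) (\<alpha> s) - l (traj \<alpha> z s) (\<alpha> s)\<bar> \<le> k \<alpha> s * norm (traj \<alpha> x s - traj \<alpha> z s)"
      unfolding k_def by (rule l_lipschitz)
    also have "\<dots> \<le> k \<alpha> s * B" using nB k_nonneg by (intro mult_left_mono)
    finally have *: "\<bar>l (traj \<alpha> x s) (\<alpha> s) - l (traj \<alpha> z s) (\<alpha> s)\<bar> \<le> k \<alpha> s * B" .
    have "running_cost \<delta> \<alpha> x s - running_cost \<delta> \<alpha> z s
        \<le> exp (- \<delta> * s) * \<bar>l (traj \<alpha> x s) (\<alpha> s) - l (traj \<alpha> z s) (\<alpha> s)\<bar>"
      unfolding right_diff_distrib[symmetric] by (intro mult_left_mono) auto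
    also have "\<dots> \<le> 1 * (k \<alpha> s * B)" using s \<delta> * by (intro mult_mono) auto
    finally show "running_cost \<delta> \<alpha> x s - running_cost \<delta> \<alpha> z s \<le> k \<alpha> s * B"
      by simp
  qed
  also have "\<dots> = integral {0..t} (k \<alpha>) * B" by simp
  finally show ?thesis unfolding B_def .
qed

text \<open>A control near-optimal from \<open>z\<close> is used from \<open>x\<close> up to a time
  after which the discounted tail is negligible. Its cost, hence the integral of its
  \<open>k\<close>, is bounded independently of \<open>z\<close>. The modulus obtained depends on
  \<open>\<delta>\<close>; it serves to make \<open>V \<delta>\<close> admissible for the
  sup-convolution.\<close>

lemma V_uniformly_continuous:
  assumes \<delta>: "0 < \<delta>"
  shows "uniformly_continuous_on UNIV (V \<delta>)"
proof -
  have "\<exists>d>0. \<forall>x z. norm (x - z) < d \<longrightarrow> V \<delta> x - V \<delta> z \<le> e" if e: "0 < e" for e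
  proof -
    have "((\<lambda>t. exp (- \<delta> * t) * (K / \<delta>)) \<longlongrightarrow> 0 * (K / \<delta>)) at_top"
      using \<delta> by (intro tendsto_mult tendsto_const filterlim_compose[OF exp_at_bot]
        filterlim_tendsto_neg_mult_at_bot[OF tendsto_const]) (auto simp: filterlim_ident)
    then have "eventually (\<lambda>t. exp (- \<delta> * t) * (K / \<delta>) < e / 3) at_top"
      using e by (intro order_tendstoD) auto
    then have "eventually (\<lambda>t. exp (- \<delta> * t) * (K / \<delta>) < e / 3 \<and> t \<ge> 0) at_top"
      using eventually_ge_at_top eventually_conj by blast
    then obtain t where t: "0 \<le> t" "exp (- \<delta> * t) * (K / \<delta>) < e / 3"
      by (auto simp: eventually_at_top_linorder)
    \<comment> \<open>\<open>R\<close> bounds the integral of \<open>k\<close> for every control of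
      cost at most \<open>K / \<delta> + e / 3\<close>; \<open>B\<close> is the Lipschitz constant
      that \<open>cost_diff_le\<close> then yields.\<close>
    define R where "R = K * (t + (exp (\<delta> * t) * (K / \<delta> + e / 3) + C1 * t) / C2)"
    define B where "B = R * (2 * exp (2 * R))"
    have R: "0 \<le> R" unfolding R_def using K_pos t \<delta> e C1_nonneg C2_pos by auto
    then have B: "0 \<le> B" unfolding B_def by simp
    have "V \<delta> x - V \<delta> z \<le> e" if close: "norm (x - z) < e / 3 / (B + 1)" for x z
    proof -
      obtain \<alpha> where \<alpha>: "\<alpha> \<in> \<A>"
        "\<And>t. 0 \<le> t \<Longrightarrow> cost \<delta> \<alpha> z t + exp (- \<delta> * t) * V \<delta> (traj \<alpha> z t) \<le> V \<delta> z + e / 3"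
        using cost_le_V[OF \<delta>, of "e / 3"] e by auto
      have cz: "cost \<delta> \<alpha> z t \<le> V \<delta> z + e / 3"
        using \<alpha>(2)[OF t(1)] V_nonneg[of \<delta> "traj \<alpha> z t"]
        by (smt (verit) exp_ge_zero mult_nonneg_nonneg)
      then have "cost \<delta> \<alpha> z t \<le> K / \<delta> + e / 3" using V_le[OF \<delta>, of z] by simp
      then have "K * (t + (exp (\<delta> * t) * cost \<delta> \<alpha> z t + C1 * t) / C2) \<le> R"
        unfolding R_def using K_pos C2_pos
        by (intro mult_left_mono add_left_mono divide_right_mono add_right_mono) auto
      then have kR: "integral {0..t} (k \<alpha>) \<le> R"
        using integral_k_le[OF \<alpha>(1), of \<delta> t z] \<delta> t(1) by simp
      have k0: "0 \<le> integral {0..t} (k \<alpha>)"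
        using k_nonneg by (intro integral_nonneg k_integrable \<alpha>(1) t(1))
      have "cost \<delta> \<alpha> x t - cost \<delta> \<alpha> z t
          \<le> integral {0..t} (k \<alpha>) * (2 * exp (2 * integral {0..t} (k \<alpha>)) * norm (x - z))"
        using \<delta> t(1) by (intro cost_diff_le \<alpha>(1)) auto
      also have "\<dots> \<le> R * (2 * exp (2 * R) * norm (x - z))"
        using kR k0 R by (intro mult_mono) auto
      also have "\<dots> = B * norm (x - z)" by (simp add: B_def)
      also have "\<dots> \<le> (B + 1) * (e / 3 / (B + 1))" using close B by (intro mult_mono) auto
      also have "\<dots> = e / 3" using nonzero_mult_div_cancel_left[of "B + 1" "e / 3"] B by (simp only: times_divide_eq_right)
      finally have "cost \<delta> \<alpha> x t \<le> V \<delta> z + 2 * (e / 3)" using cz by simp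
      moreover have "exp (- \<delta> * t) * V \<delta> (traj \<alpha> x t) \<le> exp (- \<delta> * t) * (K / \<delta>)"
        using V_le[OF \<delta>] by (intro mult_left_mono) auto
      ultimately show ?thesis
        using V_le_cost[OF \<delta> \<alpha>(1) t(1), of x] t(2) by linarith
    qed
    moreover have "0 < e / 3 / (B + 1)" using e B by simp
    ultimately show ?thesis by blast
  qed
  note * = this
  show ?thesis
    unfolding uniformly_continuous_on_def
  proof (intro allI impI)
    fix e :: real assume e: "0 < e"
    obtain d where d: "d > 0" "\<And>x z. norm (x - z) < d \<Longrightarrow> V \<delta> x - V \<delta> z \<le> e / 2"
      using *[of "e / 2"] e by auto
    have "dist (V \<delta> x') (V \<delta> x) < e" if "dist x' x < d" for x x'
      using d(2)[of x x'] d(2)[of x' x] that e by (auto simp: dist_real_def dist_norm norm_minus_commute)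
    then show "\<exists>d>0. \<forall>x\<in>UNIV. \<forall>x'\<in>UNIV. dist x' x < d \<longrightarrow> dist (V \<delta> x') (V \<delta> x) < e"
      using d(1) by blast
  qed
qed

end

section \<open>Extended data\<close>

text \<open>The delicate points are those with \<open>w0 = 0\<close>, which a sequence may approach
  with zero and positive \<open>w0\<close> mixed. There the recession limit is uniform on compact
  sets of \<open>(x, w)\<close>, so a moving base point does no harm. For \<open>w0 > 0\<close> the
  cone property keeps \<open>w /\<^sub>R w0\<close> in \<open>A\<close>.\<close>

lemma extended_continuous_on:
  fixes A :: "'b::euclidean_space set" and \<Phi> :: "'a::euclidean_space \<Rightarrow> 'b \<Rightarrow> 'c::euclidean_space"
  assumes "closed A" "cone A" and cont: "continuous_on (UNIV \<times> A) (\<lambda>(x, a). \<Phi> x a)"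
    and rec: "recession_limit A q \<Phi> \<Phi>_inf"
  shows "continuous_on (UNIV \<times> {0..} \<times> A) (\<lambda>(x, w0, w). extended q \<Phi> \<Phi>_inf x w0 w)"
proof (rule continuous_on_sequentiallyI)
  fix u :: "nat \<Rightarrow> 'a \<times> real \<times> 'b" and b
  assume u: "\<forall>n. u n \<in> UNIV \<times> {0..} \<times> A" and b: "b \<in> UNIV \<times> {0..} \<times> A" and lim: "u \<longlonglongrightarrow> b"
  define X r W where "X n = fst (u n)" and "r n = fst (snd (u n))" and "W n = snd (snd (u n))" for n
  define x r0 w where "x = fst b" and "r0 = fst (snd b)" and "w = snd (snd b)"
  have r: "0 \<le> r n" and W: "W n \<in> A" for n using u by (auto simp: r_def W_def mem_Times_iff)
  have r0: "0 \<le> r0" and w: "w \<in> A" using b by (auto simp: r0_def w_def mem_Times_iff)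
  have X: "X \<longlonglongrightarrow> x" and rlim: "r \<longlonglongrightarrow> r0" and Wlim: "W \<longlonglongrightarrow> w"
    unfolding X_def r_def W_def x_def r0_def w_def using lim by (auto intro!: tendsto_intros)
  have "(\<lambda>n. extended q \<Phi> \<Phi>_inf (X n) (r n) (W n)) \<longlonglongrightarrow> extended q \<Phi> \<Phi>_inf x r0 w"
  proof (cases "r0 = 0")
    case False
    with r0 have pos: "0 < r0" by simp
    have ev: "eventually (\<lambda>n. 0 < r n) sequentially" using rlim pos by (rule order_tendstoD)
    have "(\<lambda>n. (\<lambda>(x, a). \<Phi> x a) (X n, W n /\<^sub>R r n)) \<longlonglongrightarrow> (\<lambda>(x, a). \<Phi> x a) (x, w /\<^sub>R r0)"
    proof (rule continuous_on_tendsto_compose[OF cont])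
      show "(\<lambda>n. (X n, W n /\<^sub>R r n)) \<longlonglongrightarrow> (x, w /\<^sub>R r0)"
        using X Wlim rlim pos by (intro tendsto_intros) auto
      show "(x, w /\<^sub>R r0) \<in> UNIV \<times> A" using \<open>cone A\<close> w pos by (auto intro: mem_cone)
      show "eventually (\<lambda>n. (X n, W n /\<^sub>R r n) \<in> UNIV \<times> A) sequentially"
        using \<open>cone A\<close> W r by (auto intro!: always_eventually mem_cone)
    qed
    then have "(\<lambda>n. r n ^ q *\<^sub>R \<Phi> (X n) (W n /\<^sub>R r n)) \<longlonglongrightarrow> r0 ^ q *\<^sub>R \<Phi> x (w /\<^sub>R r0)"
      using rlim by (intro tendsto_intros) auto
    moreover have "eventually (\<lambda>n. r n ^ q *\<^sub>R \<Phi> (X n) (W n /\<^sub>R r n) = extended q \<Phi> \<Phi>_inf (X n) (r n) (W n)) sequentially"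
      using ev by eventually_elim (simp add: extended_def)
    ultimately show ?thesis using pos by (simp add: extended_def Lim_transform_eventually)
  next
    case True
    have cinf: "continuous_on (UNIV \<times> A) (\<lambda>(x, a). \<Phi>_inf x a)" using rec by (simp add: recession_limit_def)
    have "(\<lambda>n. (\<lambda>(x, a). \<Phi>_inf x a) (X n, W n)) \<longlonglongrightarrow> (\<lambda>(x, a). \<Phi>_inf x a) (x, w)"
      by (rule continuous_on_tendsto_compose[OF cinf]) (use X Wlim W w in \<open>auto intro!: tendsto_intros\<close>)
    then have 1: "(\<lambda>n. \<Phi>_inf (X n) (W n)) \<longlonglongrightarrow> \<Phi>_inf x w" by simp
    have 2: "(\<lambda>n. extended q \<Phi> \<Phi>_inf (X n) (r n) (W n) - \<Phi>_inf (X n) (W n)) \<longlonglongrightarrow> 0"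
      unfolding tendsto_iff
    proof (intro allI impI)
      fix e :: real assume e: "0 < e"
      \<comment> \<open>A compact neighbourhood of the limit point, cut to \<open>A\<close>, on
        which the recession limit is uniform; eventually it contains all
        \<open>(X n, W n)\<close>.\<close>
      define S where "S = cball x 1 \<times> (cball w 1 \<inter> A)"
      have "compact S" unfolding S_def using \<open>closed A\<close> by (intro compact_Times compact_Int_closed) auto
      then have "uniform_limit S (\<lambda>\<rho> (x, a). \<rho> ^ q *\<^sub>R \<Phi> x (a /\<^sub>R \<rho>)) (\<lambda>(x, a). \<Phi>_inf x a) (at_right 0)"
        using rec unfolding recession_limit_def S_def by blast
      then have "eventually (\<lambda>\<rho>. \<forall>z\<in>S. dist ((\<lambda>(x, a). \<rho> ^ q *\<^sub>R \<Phi> x (a /\<^sub>R \<rho>)) z) ((\<lambda>(x, a). \<Phi>_inf x a) z) < e) (at_right 0)"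
        using e by (rule uniform_limitD)
      then obtain d where d: "0 < d" and
        "\<forall>\<rho>>0. \<rho> < d \<longrightarrow> (\<forall>z\<in>S. dist ((\<lambda>(x, a). \<rho> ^ q *\<^sub>R \<Phi> x (a /\<^sub>R \<rho>)) z) ((\<lambda>(x, a). \<Phi>_inf x a) z) < e)"
        unfolding eventually_at_right_field by auto
      then have dS: "dist (\<rho> ^ q *\<^sub>R \<Phi> y (v /\<^sub>R \<rho>)) (\<Phi>_inf y v) < e" if "0 < \<rho>" "\<rho> < d" "(y, v) \<in> S" for \<rho> y v
        using that by fastforce
      have "eventually (\<lambda>n. r n < d) sequentially" using rlim d True by (intro order_tendstoD) auto
      moreover have "eventually (\<lambda>n. dist (X n) x < 1) sequentially" using X by (rule tendstoD) simp
      moreover have "eventually (\<lambda>n. dist (W n) w < 1) sequentially" using Wlim by (rule tendstoD) simp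
      ultimately show "eventually (\<lambda>n. dist (extended q \<Phi> \<Phi>_inf (X n) (r n) (W n) - \<Phi>_inf (X n) (W n)) 0 < e) sequentially"
      proof eventually_elim
        case (elim n)
        then have S: "(X n, W n) \<in> S" using W[of n] by (auto simp: S_def dist_commute)
        show ?case
        proof (cases "r n = 0")
          case False
          then have "0 < r n" using r[of n] by simp
          from dS[OF this elim(1) S] show ?thesis using False by (simp add: extended_def dist_norm)
        qed (use e in \<open>simp add: extended_def\<close>)
      qed
    qed
    from tendsto_add[OF 2 1] show ?thesis using True by (simp add: extended_def)
  qed
  then show "(\<lambda>n. case u n of (x, w0, w) \<Rightarrow> extended q \<Phi> \<Phi>_inf x w0 w)
      \<longlonglongrightarrow> (case b of (x, w0, w) \<Rightarrow> extended q \<Phi> \<Phi>_inf x w0 w)"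
    by (simp add: X_def r_def W_def x_def r0_def w_def case_prod_beta)
qed

locale recession_problem = control_problem A f l q K C1 C2
  for A :: "'b::euclidean_space set" and f :: "'a::euclidean_space \<Rightarrow> 'b \<Rightarrow> 'a"
    and l :: "'a \<Rightarrow> 'b \<Rightarrow> real" and q :: nat and K C1 C2 :: real +
  fixes f_inf :: "'a \<Rightarrow> 'b \<Rightarrow> 'a" and l_inf :: "'a \<Rightarrow> 'b \<Rightarrow> real"
  assumes f_recession: "recession_limit A q f f_inf" and l_recession: "recession_limit A q l l_inf"
begin

abbreviation fbar :: "'a \<Rightarrow> real \<Rightarrow> 'b \<Rightarrow> 'a" where "fbar \<equiv> extended q f f_inf"
abbreviation lbar :: "'a \<Rightarrow> real \<Rightarrow> 'b \<Rightarrow> real" where "lbar \<equiv> extended q l l_inf"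

lemma fbar_continuous: "continuous_on (UNIV \<times> {0..} \<times> A) (\<lambda>(x, w0, w). fbar x w0 w)"
  by (rule extended_continuous_on[OF closed_A cone_A f_continuous f_recession])

lemma lbar_continuous: "continuous_on (UNIV \<times> {0..} \<times> A) (\<lambda>(x, w0, w). lbar x w0 w)"
  by (rule extended_continuous_on[OF closed_A cone_A l_continuous l_recession])

lemma extended_at_right:
  fixes G :: "'a \<Rightarrow> real \<Rightarrow> 'b \<Rightarrow> 'c::topological_space"
  assumes "continuous_on (UNIV \<times> {0..} \<times> A) (\<lambda>(x, w0, w). G x w0 w)" "w \<in> A"
  shows "((\<lambda>r. G x r w) \<longlongrightarrow> G x 0 w) (at_right 0)"
proof -
  have "((\<lambda>r. (\<lambda>(x, w0, w). G x w0 w) (x, r, w)) \<longlongrightarrow> (\<lambda>(x, w0, w). G x w0 w) (x, 0, w)) (at_right 0)"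
  proof (rule continuous_on_tendsto_compose[OF assms(1)])
    show "((\<lambda>r. (x, r, w)) \<longlongrightarrow> (x, 0, w)) (at_right 0)" by (intro tendsto_intros)
    show "eventually (\<lambda>r. (x, r, w) \<in> UNIV \<times> {0..} \<times> A) (at_right (0::real))"
      by (rule eventually_mono[OF eventually_at_right_less]) (use assms(2) in auto)
  qed (use assms in auto)
  then show ?thesis by simp
qed

lemmas fbar_at_right = extended_at_right[OF fbar_continuous]
lemmas lbar_at_right = extended_at_right[OF lbar_continuous]

text \<open>The weight becomes homogeneous of degree \<open>q\<close> in \<open>(w0, w)\<close> and
  equals 1 on the extended sphere, so the bounds derived from it are uniform there.\<close>

lemma scaled_control:
  assumes "0 < w0" "w \<in> A"
  shows "w /\<^sub>R w0 \<in> A" and "w0 ^ q * (1 + norm (w /\<^sub>R w0) ^ q) = w0 ^ q + norm w ^ q"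
  using assms mem_cone[OF cone_A] by (auto simp: field_simps power_mult_distrib power_inverse)

text \<open>For positive \<open>w0\<close> the extended data are rescalings of the original ones,
  and inequalities are stable under letting \<open>w0\<close> tend to 0. This is how bounds reach
  \<open>f_inf\<close> and \<open>l_inf\<close>, which are known only as limits.\<close>

lemma extended_le:
  fixes g h :: "real \<Rightarrow> real"
  assumes pos: "\<And>w0. 0 < w0 \<Longrightarrow> g w0 \<le> h w0"
    and "(g \<longlongrightarrow> g 0) (at_right 0)" "(h \<longlongrightarrow> h 0) (at_right 0)" and "0 \<le> w0"
  shows "g w0 \<le> h w0"
proof (cases "w0 = 0")
  case True
  have "g 0 \<le> h 0"
    by (rule tendsto_le[OF trivial_limit_at_right_real assms(3,2)])
      (rule eventually_mono[OF eventually_at_right_less pos])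
  then show ?thesis using True by simp
qed (use assms in auto)

lemma weight_at_right: "((\<lambda>w0. c * (w0 ^ q + norm w ^ q)) \<longlongrightarrow> c * (0 ^ q + norm w ^ q)) (at_right (0::real))"
  for c :: real
  by (intro tendsto_intros)

lemma fbar_bound:
  assumes "0 \<le> w0" "w \<in> A"
  shows "norm (fbar x w0 w) \<le> K * (w0 ^ q + norm w ^ q)"
proof (rule extended_le[where g = "\<lambda>w0. norm (fbar x w0 w)" and h = "\<lambda>w0. K * (w0 ^ q + norm w ^ q)"])
  show "norm (fbar x w0 w) \<le> K * (w0 ^ q + norm w ^ q)" if "0 < w0" for w0
  proof -
    have "norm (fbar x w0 w) = w0 ^ q * norm (f x (w /\<^sub>R w0))"
      using that by (simp add: extended_def)
    also have "\<dots> \<le> w0 ^ q * (K * (1 + norm (w /\<^sub>R w0) ^ q))"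
      using that scaled_control(1)[OF that assms(2)] by (intro mult_left_mono f_bound) auto
    also have "\<dots> = K * (w0 ^ q + norm w ^ q)"
      using scaled_control(2)[OF that assms(2)] by (metis mult.left_commute)
    finally show ?thesis .
  qed
qed (use assms in \<open>auto intro!: tendsto_norm fbar_at_right weight_at_right\<close>)

lemma fbar_lipschitz:
  assumes "0 \<le> w0" "w \<in> A"
  shows "norm (fbar x w0 w - fbar y w0 w) \<le> K * norm (x - y) * (w0 ^ q + norm w ^ q)"
proof (rule extended_le[where g = "\<lambda>w0. norm (fbar x w0 w - fbar y w0 w)"
      and h = "\<lambda>w0. K * norm (x - y) * (w0 ^ q + norm w ^ q)"])
  show "norm (fbar x w0 w - fbar y w0 w) \<le> K * norm (x - y) * (w0 ^ q + norm w ^ q)" if "0 < w0" for w0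
  proof -
    have "norm (fbar x w0 w - fbar y w0 w) = w0 ^ q * norm (f x (w /\<^sub>R w0) - f y (w /\<^sub>R w0))"
      using that by (simp add: extended_def scaleR_diff_right[symmetric])
    also have "\<dots> \<le> w0 ^ q * (K * (1 + norm (w /\<^sub>R w0) ^ q) * norm (x - y))"
      using that scaled_control(1)[OF that assms(2)] by (intro mult_left_mono f_lipschitz) auto
    also have "\<dots> = K * norm (x - y) * (w0 ^ q * (1 + norm (w /\<^sub>R w0) ^ q))"
      by (simp only: mult_ac)
    finally show ?thesis using scaled_control(2)[OF that assms(2)] by simp
  qed
qed (use assms in \<open>auto intro!: tendsto_norm tendsto_diff fbar_at_right weight_at_right\<close>)

lemma lbar_bound:
  assumes "0 \<le> w0" "w \<in> A"
  shows "lbar x w0 w \<le> K * (w0 ^ q + norm w ^ q)"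
proof (rule extended_le[where g = "\<lambda>w0. lbar x w0 w" and h = "\<lambda>w0. K * (w0 ^ q + norm w ^ q)"])
  show "lbar x w0 w \<le> K * (w0 ^ q + norm w ^ q)" if "0 < w0" for w0
  proof -
    have "lbar x w0 w = w0 ^ q * l x (w /\<^sub>R w0)"
      using that by (simp add: extended_def)
    also have "\<dots> \<le> w0 ^ q * (K * (1 + norm (w /\<^sub>R w0) ^ q))"
      using that scaled_control(1)[OF that assms(2)] by (intro mult_left_mono l_bound) auto
    also have "\<dots> = K * (w0 ^ q + norm w ^ q)"
      using scaled_control(2)[OF that assms(2)] by (metis mult.left_commute)
    finally show ?thesis .
  qed
qed (use assms in \<open>auto intro!: lbar_at_right weight_at_right\<close>)

text \<open>At a local maximum of \<open>u - \<phi>\<close> the test function may replace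
  \<open>u\<close> in the dynamic programming inequality, and the right derivative at time 0 then
  has a sign. The cost is undiscounted and the rate \<open>c\<close> arbitrary, so that the lemma
  serves the discounted value with \<open>c = 0\<close> and the limit function with
  \<open>c = lam\<close>.\<close>

lemma subsolution_constant_control:
  assumes a: "a \<in> A"
    and u: "\<And>h. 0 \<le> h \<Longrightarrow> u x \<le> cost 0 (\<lambda>_. a) x h - c * h + u (traj (\<lambda>_. a) x h)"
    and \<phi>: "\<And>y. GDERIV \<phi> y :> D y"
    and max: "eventually (\<lambda>y. u y - \<phi> y \<le> u x - \<phi> x) (nhds x)"
  shows "c - f x a \<bullet> D x - l x a \<le> 0"
proof -
  define y where "y = traj (\<lambda>_. a) x"
  have ctrl: "(\<lambda>_. a) \<in> \<A>" using a by (rule constant_control)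
  have y0: "y 0 = x" and ycont: "continuous_on {0..1} y"
    unfolding y_def by (rule traj_0[OF ctrl], rule traj_continuous_on[OF ctrl])
  have along: "continuous_on {0..1} (\<lambda>s. G (y s) a)"
    if "continuous_on (UNIV \<times> A) (\<lambda>(x, a). G x a)" for G :: "'a \<Rightarrow> 'b \<Rightarrow> 'c::topological_space"
  proof -
    have "continuous_on {0..1} (\<lambda>s. (\<lambda>(x, a). G x a) (y s, a))"
      by (rule continuous_on_compose2[OF that]) (use ycont a in \<open>auto intro!: continuous_intros\<close>)
    then show ?thesis by simp
  qed
  have dcost: "((\<lambda>h. cost 0 (\<lambda>_. a) x h) has_real_derivative l x a) (at 0 within {0..1})"
    using integral_has_vector_derivative[OF along[OF l_continuous], of 0] y0
    by (simp add: cost_def y_def has_real_derivative_iff_has_vector_derivative)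
  have "((\<lambda>h. x + integral {0..h} (\<lambda>s. f (y s) a)) has_vector_derivative f x a) (at 0 within {0..1})"
    using has_vector_derivative_add[OF has_vector_derivative_const[of x]
        integral_has_vector_derivative[OF along[OF f_continuous], of 0]] y0
    by simp
  then have "(y has_vector_derivative f x a) (at 0 within {0..1})"
    by (rule has_vector_derivative_transform[rotated 2])
      (use traj_integral[OF ctrl, of _ x] in \<open>auto simp: y_def\<close>)
  then have dy: "(y has_derivative (\<lambda>h. h *\<^sub>R f x a)) (at 0 within {0..1})"
    by (simp add: has_vector_derivative_def)
  have "((\<lambda>h. \<phi> (y h)) has_derivative (\<lambda>h. (h *\<^sub>R f x a) \<bullet> D x)) (at 0 within {0..1})"
    by (rule has_derivative_compose[OF dy]) (use \<phi>[of x] y0 in \<open>simp add: gderiv_def\<close>)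
  then have dphi: "((\<lambda>h. \<phi> (y h)) has_real_derivative f x a \<bullet> D x) (at 0 within {0..1})"
    by (simp add: has_field_derivative_def mult_commute_abs)
  define \<psi> where "\<psi> = (\<lambda>h. cost 0 (\<lambda>_. a) x h - c * h + \<phi> (y h))"
  have "(\<psi> has_real_derivative l x a - c * 1 + f x a \<bullet> D x) (at 0 within {0..1})"
    unfolding \<psi>_def by (intro DERIV_add DERIV_diff dcost dphi DERIV_cmult DERIV_ident)
  then have lim: "((\<lambda>h. (\<psi> h - \<psi> 0) / (h - 0)) \<longlongrightarrow> l x a - c * 1 + f x a \<bullet> D x) (at_right 0)"
    unfolding has_field_derivative_iff by (simp add: at_within_Icc_at_right)
  have "(y \<longlongrightarrow> x) (at_right 0)"
    using ycont y0 by (auto simp: continuous_on_def at_within_Icc_at_right dest!: bspec[of _ _ 0])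
  then have "eventually (\<lambda>h. u (y h) - \<phi> (y h) \<le> u x - \<phi> x) (at_right 0)"
    using max by (rule eventually_compose_filterlim[rotated])
  then have "eventually (\<lambda>h. 0 \<le> (\<psi> h - \<psi> 0) / (h - 0)) (at_right 0)"
    using eventually_at_right_less[of "0::real"]
  proof eventually_elim
    case (elim h)
    have "\<psi> 0 = \<phi> x" by (simp add: \<psi>_def cost_def y0)
    then have "0 \<le> \<psi> h - \<psi> 0" using u[of h] elim by (simp add: \<psi>_def y_def)
    then show ?case using elim by simp
  qed
  from tendsto_lowerbound[OF lim this] show ?thesis by simp
qed

text \<open>For positive \<open>w0\<close> this is the inequality of the constant control
  \<open>w /\<^sub>R w0\<close> multiplied by \<open>w0 ^ q\<close>; the face \<open>w0 = 0\<close>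
  follows by the limit.\<close>

lemma subsolution_extended_control:
  assumes u: "\<And>a h. a \<in> A \<Longrightarrow> 0 \<le> h \<Longrightarrow> u x \<le> cost 0 (\<lambda>_. a) x h - c * h + u (traj (\<lambda>_. a) x h)"
    and \<phi>: "\<And>y. GDERIV \<phi> y :> D y"
    and max: "eventually (\<lambda>y. u y - \<phi> y \<le> u x - \<phi> x) (nhds x)"
    and w: "0 \<le> w0" "w \<in> A"
  shows "- (fbar x w0 w \<bullet> D x) - lbar x w0 w + c * w0 ^ q \<le> 0"
proof (rule extended_le[where g = "\<lambda>w0. - (fbar x w0 w \<bullet> D x) - lbar x w0 w + c * w0 ^ q" and h = "\<lambda>_. 0"])
  show "- (fbar x w0 w \<bullet> D x) - lbar x w0 w + c * w0 ^ q \<le> 0" if "0 < w0" for w0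
  proof -
    have "c - f x (w /\<^sub>R w0) \<bullet> D x - l x (w /\<^sub>R w0) \<le> 0"
      using scaled_control(1)[OF that w(2)] u \<phi> max by (intro subsolution_constant_control) auto
    then have "w0 ^ q * (c - f x (w /\<^sub>R w0) \<bullet> D x - l x (w /\<^sub>R w0)) \<le> 0"
      using that by (simp add: mult_le_0_iff)
    then show ?thesis using that by (simp add: extended_def algebra_simps)
  qed
qed (use w in \<open>auto intro!: tendsto_intros fbar_at_right lbar_at_right\<close>)

end

section \<open>Relaxed trajectories\<close>

text \<open>Links the weak-star sigma-algebra in \<open>relaxed_controls\<close> to measurability in
  time of the averaged velocity.\<close>

lemma integral_in_weak_star_sets:
  fixes \<phi> :: "'b::euclidean_space \<Rightarrow> real"
  assumes "continuous_on S \<phi>"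
  shows "(\<lambda>\<nu>. \<integral>w. \<phi> w \<partial>\<nu>) \<in> borel_measurable
    (sigma (prob_measures S) {U. openin (weak_star_topology S) U})"
proof (rule borel_measurableI)
  fix U :: "real set" assume "open U"
  define B where "B = {{\<nu> \<in> prob_measures S. (\<integral>w. \<phi> w \<partial>\<nu>) \<in> U} | (\<phi> :: 'b \<Rightarrow> real) U.
    continuous_on S \<phi> \<and> open U}"
  have top: "weak_star_topology S = topology_generated_by B"
    by (simp add: weak_star_topology_def B_def)
  have "{\<nu> \<in> prob_measures S. (\<integral>w. \<phi> w \<partial>\<nu>) \<in> U} \<in> B"
    unfolding B_def using assms \<open>open U\<close> by blast
  then have "openin (weak_star_topology S) {\<nu> \<in> prob_measures S. (\<integral>w. \<phi> w \<partial>\<nu>) \<in> U}"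
    unfolding top by (rule topology_generated_by_Basis)
  moreover have "{U. openin (weak_star_topology S) U} \<subseteq> Pow (prob_measures S)"
  proof
    fix W assume "W \<in> {U. openin (weak_star_topology S) U}"
    then have "W \<subseteq> topspace (weak_star_topology S)" using openin_subset by blast
    also have "\<dots> \<subseteq> prob_measures S" unfolding top by (auto simp: B_def)
    finally show "W \<in> Pow (prob_measures S)" by simp
  qed
  ultimately show "(\<lambda>\<nu>. \<integral>w. \<phi> w \<partial>\<nu>) -` U \<inter> space (sigma (prob_measures S) {U. openin (weak_star_topology S) U})
      \<in> sets (sigma (prob_measures S) {U. openin (weak_star_topology S) U})"
    by (simp add: space_measure_of_conv sets_measure_of vimage_def Int_def conj_commute sigma_sets.Basic)
qed

lemma GDERIV_scaled_square_distance:
  "GDERIV (\<lambda>y. c * (norm (y - z))\<^sup>2) y :> (2 * c) *\<^sub>R (y - z)"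
proof -
  have "((\<lambda>y. c * ((y - z) \<bullet> (y - z))) has_derivative (\<lambda>h. h \<bullet> ((2 * c) *\<^sub>R (y - z)))) (at y)"
    by (auto intro!: derivative_eq_intros simp: inner_commute algebra_simps)
  then show ?thesis by (simp add: gderiv_def power2_norm_eq_inner)
qed

context recession_problem
begin

abbreviation B\<^sub>A :: "'b set" where "B\<^sub>A \<equiv> cball 0 1 \<inter> A"
abbreviation fr :: "'a \<Rightarrow> 'b measure \<Rightarrow> 'a" where "fr \<equiv> relaxed_field q f f_inf"
abbreviation \<xi>r :: "'a \<Rightarrow> (real \<Rightarrow> 'b measure) \<Rightarrow> real \<Rightarrow> 'a" where
  "\<xi>r \<equiv> relaxed_trajectory q f f_inf"

definition relaxed_integrand :: "'a \<Rightarrow> 'b \<Rightarrow> 'a" where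
  "relaxed_integrand y w = fbar y (root q (1 - norm w ^ q)) w"

text \<open>Places the integration points of the relaxed field on the extended sphere, where the
  weight is 1. This is why relaxed velocities are bounded by \<open>K\<close> and have Lipschitz
  constant \<open>K\<close> in space.\<close>

lemma relaxed_weight:
  assumes "w \<in> B\<^sub>A"
  shows "0 \<le> root q (1 - norm w ^ q)" "root q (1 - norm w ^ q) ^ q + norm w ^ q = 1"
proof -
  have "norm w ^ q \<le> 1" using assms by (intro power_le_one) auto
  then show "0 \<le> root q (1 - norm w ^ q)" "root q (1 - norm w ^ q) ^ q + norm w ^ q = 1"
    using q_pos by auto
qed

lemma relaxed_integrand_continuous: "continuous_on B\<^sub>A (relaxed_integrand y)"
proof -
  have "continuous_on B\<^sub>A (\<lambda>w. (\<lambda>(x, w0, w). fbar x w0 w) (y, root q (1 - norm w ^ q), w))"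
    by (rule continuous_on_compose2[OF fbar_continuous])
      (use relaxed_weight in \<open>auto intro!: continuous_intros\<close>)
  then show ?thesis by (simp add: relaxed_integrand_def[abs_def])
qed

lemma relaxed_integrand_bound: "w \<in> B\<^sub>A \<Longrightarrow> norm (relaxed_integrand y w) \<le> K"
  using fbar_bound[OF relaxed_weight(1), of w w y] relaxed_weight(2)[of w]
  by (simp add: relaxed_integrand_def)

lemma relaxed_integrand_lipschitz:
  "w \<in> B\<^sub>A \<Longrightarrow> norm (relaxed_integrand x w - relaxed_integrand y w) \<le> K * norm (x - y)"
  using fbar_lipschitz[OF relaxed_weight(1), of w w x y] relaxed_weight(2)[of w]
  by (simp add: relaxed_integrand_def)

lemma prob_measuresD:
  assumes "\<nu> \<in> prob_measures S"
  shows "prob_space \<nu>" "sets \<nu> = sets (restrict_space borel S)" "space \<nu> = S"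
  using assms sets_eq_imp_space_eq[of \<nu> "restrict_space borel S"]
  by (auto simp: prob_measures_def space_restrict_space)

lemma relaxed_integrand_integrable:
  assumes \<nu>: "\<nu> \<in> prob_measures B\<^sub>A"
  shows "integrable \<nu> (relaxed_integrand y)"
proof -
  interpret prob_space \<nu> using prob_measuresD[OF \<nu>] by simp
  have "relaxed_integrand y \<in> borel_measurable (restrict_space borel B\<^sub>A)"
    by (rule borel_measurable_continuous_on_restrict[OF relaxed_integrand_continuous])
  then have "relaxed_integrand y \<in> borel_measurable \<nu>"
    using measurable_cong_sets[OF prob_measuresD(2)[OF \<nu>] refl] by blast
  then show ?thesis
    by (rule integrable_const_bound[of _ K, rotated])
      (use relaxed_integrand_bound prob_measuresD(3)[OF \<nu>] in \<open>auto intro!: AE_I2\<close>)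
qed

lemma relaxed_field_eq: "fr y \<nu> = (\<integral>w. relaxed_integrand y w \<partial>\<nu>)"
  by (simp add: relaxed_field_def relaxed_integrand_def)

lemma norm_integral_prob_le:
  assumes "\<nu> \<in> prob_measures S" "integrable \<nu> h" "\<And>w. w \<in> S \<Longrightarrow> norm (h w :: 'a) \<le> c"
  shows "norm (\<integral>w. h w \<partial>\<nu>) \<le> c"
proof -
  interpret prob_space \<nu> using prob_measuresD[OF assms(1)] by simp
  have "norm (\<integral>w. h w \<partial>\<nu>) \<le> (\<integral>w. norm (h w) \<partial>\<nu>)" by (rule integral_norm_bound)
  also have "\<dots> \<le> c"
    using assms prob_measuresD(3)[OF assms(1)] by (intro integral_le_const) (auto intro!: AE_I2)
  finally show ?thesis .
qed

lemma relaxed_field_bound: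
  assumes \<nu>: "\<nu> \<in> prob_measures B\<^sub>A"
  shows "norm (fr y \<nu>) \<le> K"
  unfolding relaxed_field_eq
  by (intro norm_integral_prob_le[OF \<nu>] relaxed_integrand_integrable[OF \<nu>] relaxed_integrand_bound)

lemma relaxed_field_lipschitz:
  assumes \<nu>: "\<nu> \<in> prob_measures B\<^sub>A"
  shows "norm (fr x \<nu> - fr y \<nu>) \<le> K * norm (x - y)"
proof -
  note int = relaxed_integrand_integrable[OF \<nu>]
  have "fr x \<nu> - fr y \<nu>
      = (\<integral>w. relaxed_integrand x w - relaxed_integrand y w \<partial>\<nu>)"
    unfolding relaxed_field_eq by (rule Bochner_Integration.integral_diff[symmetric, OF int int])
  also have "norm \<dots> \<le> K * norm (x - y)"
    by (intro norm_integral_prob_le[OF \<nu>] relaxed_integrand_lipschitz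
        Bochner_Integration.integrable_diff int)
  finally show ?thesis .
qed

text \<open>The averaging step: pairing with \<open>p\<close> is linear in the velocity, so a bound
  valid for every single extended control passes to every probability measure on them.\<close>

lemma relaxed_field_inner_ge:
  assumes \<nu>: "\<nu> \<in> prob_measures B\<^sub>A"
    and "\<And>w. w \<in> B\<^sub>A \<Longrightarrow> c \<le> relaxed_integrand y w \<bullet> p"
  shows "c \<le> fr y \<nu> \<bullet> p"
proof -
  interpret prob_space \<nu> using prob_measuresD[OF \<nu>] by simp
  have "c \<le> (\<integral>w. relaxed_integrand y w \<bullet> p \<partial>\<nu>)"
    using assms(2) prob_measuresD(3)[OF \<nu>]
    by (intro integral_ge_const integrable_inner_left impI relaxed_integrand_integrable[OF \<nu>])
      (auto intro!: AE_I2)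
  also have "\<dots> = (\<integral>w. relaxed_integrand y w \<partial>\<nu>) \<bullet> p"
    by (intro integral_inner_left impI relaxed_integrand_integrable[OF \<nu>])
  finally show ?thesis by (simp add: relaxed_field_eq)
qed

lemma relaxed_controls_values:
  assumes "\<mu> \<in> relaxed_controls A" "0 \<le> s"
  shows "\<mu> s \<in> prob_measures B\<^sub>A"
proof -
  have "\<mu> s \<in> space (sigma (prob_measures B\<^sub>A) {U. openin (weak_star_topology B\<^sub>A) U})"
    by (rule measurable_space[of \<mu> "lebesgue_on {0..}"])
      (use assms in \<open>simp_all add: relaxed_controls_def Let_def space_restrict_space\<close>)
  then show ?thesis by (simp add: space_measure_of_conv)
qed

lemma lipschitz_field_relaxed:
  assumes \<mu>: "\<mu> \<in> relaxed_controls A"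
  shows "lipschitz_field (\<lambda>s y. fr y (\<mu> s)) (\<lambda>_. K)"
proof
  note val = relaxed_controls_values[OF \<mu>]
  show "(\<lambda>s. fr y (\<mu> s)) \<in> borel_measurable (lebesgue_on {0..})" for y
  proof (subst borel_measurable_euclidean_space, rule ballI)
    \<comment> \<open>The weak-star topology tests scalar integrands, so measurability is checked
      coordinate by coordinate.\<close>
    fix i :: 'a assume "i \<in> Basis"
    have "continuous_on B\<^sub>A (\<lambda>w. relaxed_integrand y w \<bullet> i)"
      by (intro continuous_intros relaxed_integrand_continuous)
    note * = integral_in_weak_star_sets[OF this]
    have "\<mu> \<in> measurable (lebesgue_on {0..})
        (sigma (prob_measures B\<^sub>A) {U. openin (weak_star_topology B\<^sub>A) U})"
      using \<mu> by (simp add: relaxed_controls_def Let_def)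
    from measurable_comp[OF this *]
    have "(\<lambda>s. \<integral>w. relaxed_integrand y w \<bullet> i \<partial>\<mu> s) \<in> borel_measurable (lebesgue_on {0..})"
      by (simp add: o_def)
    also have "?this \<longleftrightarrow> (\<lambda>s. fr y (\<mu> s) \<bullet> i) \<in> borel_measurable (lebesgue_on {0..})"
    proof (rule measurable_cong)
      fix s :: real assume "s \<in> space (lebesgue_on {0..})"
      then have "0 \<le> s" by (simp add: space_restrict_space)
      show "(\<integral>w. relaxed_integrand y w \<bullet> i \<partial>\<mu> s) = fr y (\<mu> s) \<bullet> i"
        unfolding relaxed_field_eq
        by (intro integral_inner_left impI relaxed_integrand_integrable val \<open>0 \<le> s\<close>)
    qed
    finally show "(\<lambda>s. fr y (\<mu> s) \<bullet> i) \<in> borel_measurable (lebesgue_on {0..})" .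
  qed
next
  fix s :: real and x y :: 'a assume "0 \<le> s"
  from relaxed_controls_values[OF \<mu> this]
  show "norm (fr x (\<mu> s) - fr y (\<mu> s)) \<le> K * norm (x - y)"
    by (rule relaxed_field_lipschitz)
next
  fix s :: real assume "0 \<le> s"
  from relaxed_controls_values[OF \<mu> this] show "norm (fr 0 (\<mu> s)) \<le> K"
    by (rule relaxed_field_bound)
qed (auto intro: integrable_const_ivl)

text \<open>Along a relaxed trajectory \<open>\<xi>\<close> the sup-convolution
  \<open>t \<mapsto> Max_y (u y - c * |y - \<xi> t|\<^sup>2)\<close> decreases at rate at most \<open>K\<close> up to small errors: at a maximum
  point \<open>y\<close>, the vector \<open>p = 2 c (y - \<xi> t)\<close> is a test gradient, and the resulting inequality
  \<open>p \<bullet> fbar \<ge> - K\<close> is linear in the velocity, hence survives averaging over any relaxed control.\<close>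

lemma subsolution_along_relaxed_trajectory:
  assumes uc: "uniformly_continuous_on UNIV u" and u0: "\<And>x. 0 \<le> u x" and uB: "\<And>x. u x \<le> B"
    and sub: "\<And>x a h. a \<in> A \<Longrightarrow> 0 \<le> h \<Longrightarrow> u x \<le> cost 0 (\<lambda>_. a) x h + u (traj (\<lambda>_. a) x h)"
    and \<mu>: "\<mu> \<in> relaxed_controls A" and S: "0 \<le> S"
  shows "u x \<le> u (\<xi>r x \<mu> S) + K * S"
proof -
  define F where "F = (\<lambda>s y. fr y (\<mu> s))"
  define \<xi> where "\<xi> = trajectory F x"
  interpret lipschitz_field F "\<lambda>_. K" unfolding F_def by (rule lipschitz_field_relaxed[OF \<mu>])
  note val = relaxed_controls_values[OF \<mu>]
  have F_le: "norm (F s y) \<le> K" if "0 \<le> s" for s y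
    unfolding F_def by (rule relaxed_field_bound[OF val[OF that]])
  have \<xi>int: "(\<lambda>s. F s (\<xi> s)) integrable_on {a..b}" if "0 \<le> a" for a b
    by (rule integrable_on_subinterval[of _ "{0..max b 0}"])
      (use trajectory_integrable[of "max b 0" x] that in \<open>auto simp: \<xi>_def absolutely_integrable_on_def\<close>)
  have \<xi>diff: "\<xi> b - \<xi> a = integral {a..b} (\<lambda>s. F s (\<xi> s))" if "0 \<le> a" "a \<le> b" for a b
    using trajectory_integral[of a x] trajectory_integral[of b x] that
      integral_combine_HK[of 0 a b "\<lambda>s. F s (\<xi> s)"] \<xi>int[of 0 b]
    unfolding \<xi>_def by (auto simp: algebra_simps)
  have speed: "norm (\<xi> b - \<xi> a) \<le> K * (b - a)" if "0 \<le> a" "a \<le> b" for a b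
  proof -
    have "norm (integral {a..b} (\<lambda>s. F s (\<xi> s))) \<le> integral {a..b} (\<lambda>s. K)"
      by (intro integral_norm_bound_integral \<xi>int integrable_const_ivl F_le) (use that in auto)
    then show ?thesis using \<xi>diff[OF that] that by (simp add: mult.commute)
  qed
  \<comment> \<open>Error budget: one \<open>\<eta>\<close> for replacing \<open>Y (\<xi> S)\<close>
    by \<open>\<xi> S\<close> at the end, and the rate \<open>K + 2 * K * \<eta> + \<eta>\<close> in
    between.\<close>
  have approx: "u x \<le> u (\<xi> S) + K * S + \<eta> * (1 + (2 * K + 1) * S)" if \<eta>: "0 < \<eta>" for \<eta>
  proof -
    obtain d0 where "0 < d0" and d0: "\<And>y z. dist y z < d0 \<Longrightarrow> dist (u y) (u z) < \<eta>"
      using uc \<eta> unfolding uniformly_continuous_on_def by (metis UNIV_I)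
    define d where "d = d0 / 2"
    have d: "0 < d" using \<open>0 < d0\<close> by (simp add: d_def)
    have ud: "u y - u z \<le> \<eta>" if "norm (y - z) \<le> d" for y z
      using d0[of y z] that \<open>0 < d0\<close> by (simp add: d_def dist_norm dist_real_def)
    \<comment> \<open>The penalty at distance \<open>d\<close> is \<open>B + 1\<close>, more than
      \<open>u\<close> can gain, so a maximum over the ball of radius \<open>d\<close> is a global
      one.\<close>
    define c where "c = (B + 1) / d\<^sup>2"
    have B: "0 \<le> B" using u0[of 0] uB[of 0] by simp
    then have c: "0 < c" "c * d\<^sup>2 = B + 1" using d by (auto simp: c_def)
    have "\<exists>Y. \<forall>z. norm (Y z - z) \<le> d \<and> (\<forall>y. u y - c * (norm (y - z))\<^sup>2 \<le> u (Y z) - c * (norm (Y z - z))\<^sup>2)"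
    proof (intro choice allI)
      fix z
      have ucont: "continuous_on T u" for T
        using uniformly_continuous_imp_continuous[OF uc] continuous_on_subset by blast
      have "continuous_on (cball z d) (\<lambda>y. u y - c * (norm (y - z))\<^sup>2)"
        by (intro continuous_intros ucont)
      moreover have "cball z d \<noteq> {}" using d by simp
      ultimately obtain y where y: "y \<in> cball z d"
        "\<And>y'. y' \<in> cball z d \<Longrightarrow> u y' - c * (norm (y' - z))\<^sup>2 \<le> u y - c * (norm (y - z))\<^sup>2"
        using continuous_attains_sup[OF compact_cball] by blast
      have "u y' - c * (norm (y' - z))\<^sup>2 \<le> u y - c * (norm (y - z))\<^sup>2" for y'
      proof (cases "y' \<in> cball z d")
        case False
        then have "d\<^sup>2 \<le> (norm (y' - z))\<^sup>2" using d by (intro power_mono) (auto simp: dist_norm norm_minus_commute)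
        then have "c * d\<^sup>2 \<le> c * (norm (y' - z))\<^sup>2" using c(1) by simp
        then have "u y' - c * (norm (y' - z))\<^sup>2 \<le> 0" using c(2) uB[of y'] by simp
        also have "0 \<le> u z - c * (norm (z - z))\<^sup>2" using u0[of z] by simp
        also have "\<dots> \<le> u y - c * (norm (y - z))\<^sup>2" using d by (intro y(2)) simp
        finally show ?thesis .
      qed (rule y(2))
      then show "\<exists>Y. norm (Y - z) \<le> d \<and> (\<forall>y. u y - c * (norm (y - z))\<^sup>2 \<le> u Y - c * (norm (Y - z))\<^sup>2)"
        using y(1) by (auto simp: dist_norm norm_minus_commute)
    qed
    then obtain Y where Yd: "\<And>z. norm (Y z - z) \<le> d"
      and Ymax: "\<And>z y. u y - c * (norm (y - z))\<^sup>2 \<le> u (Y z) - c * (norm (Y z - z))\<^sup>2"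
      by blast
    \<comment> \<open>\<open>z\<close> itself is a competitor, so the whole penalty is small and not
      only the distance. The Lipschitz error of the field contains
      \<open>K * norm v * norm p = 2 * K * c * (norm v)\<^sup>2\<close>, which is small for this
      reason although \<open>c\<close> may be large.\<close>
    have Y\<eta>: "c * (norm (Y z - z))\<^sup>2 \<le> \<eta>" for z
      using Ymax[of z z] ud[OF Yd[of z]] by simp
    define g where "g = (\<lambda>t. u (Y (\<xi> t)) - c * (norm (Y (\<xi> t) - \<xi> t))\<^sup>2)"
    \<comment> \<open>\<open>M\<close> collects the coefficients of the errors quadratic in the step
      length: from the motion of \<open>\<xi>\<close> within a step, and from the square of
      \<open>norm \<Delta>\<close>. Steps of length at most \<open>\<eta> / M\<close> keep them
      below \<open>\<eta>\<close> per unit time.\<close>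
    define M where "M = 2 * c * d * K * K + c * K * K"
    have M: "0 < M" unfolding M_def using c d K_pos by (intro add_pos_pos mult_pos_pos) auto
    define m where "m = K + 2 * K * \<eta> + \<eta>"
    have step: "- g b - - g a \<le> m * b - m * a" if ab: "0 \<le> a" "a \<le> b" "b \<le> S" "b - a \<le> \<eta> / M" for a b
    proof -
      define v where "v = Y (\<xi> a) - \<xi> a"
      define p where "p = (2 * c) *\<^sub>R v"
      define \<Delta> where "\<Delta> = \<xi> b - \<xi> a"
      define h where "h = b - a"
      have h: "0 \<le> h" using ab by (simp add: h_def)
      have v: "norm v \<le> d" "c * (norm v)\<^sup>2 \<le> \<eta>" using Yd Y\<eta> by (auto simp: v_def)
      have \<Delta>: "norm \<Delta> \<le> K * h" using speed[OF ab(1,2)] by (simp add: \<Delta>_def h_def)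
      have test: "- K \<le> relaxed_integrand (Y (\<xi> a)) w \<bullet> p" if w: "w \<in> B\<^sub>A" for w
      proof -
        define w0 where "w0 = root q (1 - norm w ^ q)"
        note w0 = relaxed_weight[OF w, folded w0_def]
        have "- (fbar (Y (\<xi> a)) w0 w \<bullet> p) - lbar (Y (\<xi> a)) w0 w + 0 * w0 ^ q \<le> 0"
          unfolding p_def v_def
        proof (rule subsolution_extended_control[where u = u and D = "\<lambda>y. (2 * c) *\<^sub>R (y - \<xi> a)"])
          show "GDERIV (\<lambda>y. c * (norm (y - \<xi> a))\<^sup>2) y :> (2 * c) *\<^sub>R (y - \<xi> a)" for y
            by (rule GDERIV_scaled_square_distance)
          show "\<forall>\<^sub>F y in nhds (Y (\<xi> a)). u y - c * (norm (y - \<xi> a))\<^sup>2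
              \<le> u (Y (\<xi> a)) - c * (norm (Y (\<xi> a) - \<xi> a))\<^sup>2"
            by (intro always_eventually allI Ymax)
        qed (use sub w w0 in auto)
        moreover have "lbar (Y (\<xi> a)) w0 w \<le> K" using lbar_bound[OF w0(1), of w "Y (\<xi> a)"] w0(2) w by simp
        ultimately show ?thesis by (simp add: relaxed_integrand_def w0_def)
      qed
      \<comment> \<open>The test inequality holds at \<open>Y (\<xi> a)\<close>, while the velocity
        is taken at \<open>\<xi> s\<close>; the two points are at most \<open>K * h + norm v\<close>
        apart.\<close>
      have vel: "- K - 2 * K * \<eta> - 2 * c * d * K * K * h \<le> F s (\<xi> s) \<bullet> p" if s: "s \<in> {a..b}" for s
      proof -
        have s0: "0 \<le> s" using s ab by auto
        have "norm (\<xi> s - Y (\<xi> a)) \<le> norm (\<xi> s - \<xi> a) + norm v"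
          unfolding v_def using norm_triangle_ineq4[of "\<xi> s - \<xi> a" "Y (\<xi> a) - \<xi> a"] by simp
        also have "norm (\<xi> s - \<xi> a) \<le> K * h"
        proof -
          have "norm (\<xi> s - \<xi> a) \<le> K * (s - a)" using speed[OF ab(1), of s] s by auto
          also have "\<dots> \<le> K * h" using s K_pos by (auto simp: h_def)
          finally show ?thesis .
        qed
        finally have near: "norm (\<xi> s - Y (\<xi> a)) \<le> K * h + norm v" by simp
        have "- K \<le> F s (Y (\<xi> a)) \<bullet> p"
          unfolding F_def by (rule relaxed_field_inner_ge[OF val[OF s0] test])
        moreover have "\<bar>(F s (\<xi> s) - F s (Y (\<xi> a))) \<bullet> p\<bar> \<le> 2 * K * \<eta> + 2 * c * d * K * K * h"
        proof -
          have "\<bar>(F s (\<xi> s) - F s (Y (\<xi> a))) \<bullet> p\<bar> \<le> norm (F s (\<xi> s) - F s (Y (\<xi> a))) * norm p"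
            by (rule Cauchy_Schwarz_ineq2)
          also have "\<dots> \<le> (K * (K * h + norm v)) * (2 * c * norm v)"
          proof (intro mult_mono)
            show "norm (F s (\<xi> s) - F s (Y (\<xi> a))) \<le> K * (K * h + norm v)"
              using F_lipschitz[OF s0, of "\<xi> s" "Y (\<xi> a)"] mult_left_mono[OF near, of K] K_pos by linarith
          qed (use c K_pos h in \<open>auto simp: p_def\<close>)
          also have "\<dots> = 2 * K * (c * (norm v)\<^sup>2) + 2 * c * K * K * h * norm v"
            by (simp add: algebra_simps power2_eq_square)
          also have "\<dots> \<le> 2 * K * \<eta> + 2 * c * K * K * h * d"
            using v c K_pos h by (intro add_mono mult_left_mono) auto
          finally show ?thesis by (simp add: mult_ac)
        qed
        ultimately show ?thesis by (simp add: inner_diff_left)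
      qed
      have int: "(\<lambda>s. F s (\<xi> s)) integrable_on {a..b}" by (rule \<xi>int[OF ab(1)])
      have "(- K - 2 * K * \<eta> - 2 * c * d * K * K * h) * h
          = integral {a..b} (\<lambda>s. - K - 2 * K * \<eta> - 2 * c * d * K * K * h)"
        using ab by (simp add: h_def)
      also have "\<dots> \<le> integral {a..b} (\<lambda>s. F s (\<xi> s) \<bullet> p)"
        using integrable_linear[OF int bounded_linear_inner_left[of p]]
        by (intro integral_le integrable_const_ivl vel) (auto simp: o_def)
      also have "\<dots> = \<Delta> \<bullet> p"
        using integral_linear[OF int bounded_linear_inner_left[of p]] \<xi>diff[OF ab(1,2)]
        by (simp add: o_def \<Delta>_def)
      finally have 1: "(- K - 2 * K * \<eta> - 2 * c * d * K * K * h) * h \<le> \<Delta> \<bullet> p" .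
      have "(norm \<Delta>)\<^sup>2 \<le> (K * h)\<^sup>2" using \<Delta> by (intro power_mono) auto
      then have 2: "c * (norm \<Delta>)\<^sup>2 \<le> c * K * K * h * h"
        using c(1) by (simp add: power2_eq_square mult_ac mult_left_mono)
      \<comment> \<open>The maximum point for time \<open>a\<close> is kept as competitor at time
        \<open>b\<close>. Expanding the square leaves \<open>\<Delta> \<bullet> p\<close> as the
        first-order term.\<close>
      have "(norm (Y (\<xi> a) - \<xi> b))\<^sup>2 = (norm v)\<^sup>2 - 2 * (\<Delta> \<bullet> v) + (norm \<Delta>)\<^sup>2"
        unfolding power2_norm_eq_inner v_def \<Delta>_def
        by (simp add: inner_diff_left inner_diff_right inner_commute)
      then have "c * (norm (Y (\<xi> a) - \<xi> b))\<^sup>2 = c * ((norm v)\<^sup>2 - 2 * (\<Delta> \<bullet> v) + (norm \<Delta>)\<^sup>2)"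
        by (rule arg_cong)
      then have "u (Y (\<xi> a)) - c * (norm (Y (\<xi> a) - \<xi> b))\<^sup>2 = g a + \<Delta> \<bullet> p - c * (norm \<Delta>)\<^sup>2"
        unfolding g_def v_def[symmetric] p_def by (simp add: algebra_simps)
      moreover have "u (Y (\<xi> a)) - c * (norm (Y (\<xi> a) - \<xi> b))\<^sup>2 \<le> g b"
        unfolding g_def by (rule Ymax)
      ultimately have "g a + (- K - 2 * K * \<eta> - 2 * c * d * K * K * h) * h - c * K * K * h * h \<le> g b"
        using 1 2 by linarith
      moreover have "M * h \<le> \<eta>" using ab(4) M by (simp add: h_def field_simps)
      then have "M * h * h \<le> \<eta> * h" using h by (rule mult_right_mono)
      ultimately have "g a - g b \<le> m * h"
        by (simp add: m_def M_def algebra_simps)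
      then show ?thesis by (simp add: h_def algebra_simps)
    qed
    have "- g S - - g 0 \<le> m * S - m * 0"
      by (rule increment_le_if_small_increment_le[of "\<eta> / M"]) (use step \<eta> M S in auto)
    moreover have "u x \<le> g 0"
      using Ymax[of x "\<xi> 0"] trajectory_0[of x] by (simp add: g_def \<xi>_def)
    moreover have "g S \<le> u (\<xi> S) + \<eta>"
    proof -
      have "g S \<le> u (Y (\<xi> S))" using c(1) by (simp add: g_def)
      then show ?thesis using ud[OF Yd[of "\<xi> S"]] by simp
    qed
    ultimately show ?thesis by (simp add: m_def algebra_simps)
  qed
  have "u x \<le> u (\<xi> S) + K * S"
  proof (rule field_le_epsilon)
    fix e :: real assume e: "0 < e"
    define D where "D = 1 + (2 * K + 1) * S"
    have D: "0 < D" using S K_pos by (simp add: D_def add_pos_nonneg)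
    have "u x \<le> u (\<xi> S) + K * S + (e / D) * D"
      unfolding D_def by (rule approx) (use D e in \<open>auto simp: D_def\<close>)
    then show "u x \<le> u (\<xi> S) + K * S + e" using D by simp
  qed
  then show ?thesis by (simp add: \<xi>_def F_def relaxed_trajectory_def)
qed

text \<open>As \<open>l\<close> and \<open>V\<close> are nonnegative, dropping the discount factors
  weakens the dynamic programming inequality to the case \<open>c = 0\<close>. The rate
  \<open>K\<close> is therefore the same for all \<open>\<delta>\<close>.\<close>

lemma V_along_relaxed_trajectory:
  assumes \<delta>: "0 < \<delta>" and "\<mu> \<in> relaxed_controls A" "0 \<le> S"
  shows "V \<delta> x \<le> V \<delta> (\<xi>r x \<mu> S) + K * S"
proof (rule subsolution_along_relaxed_trajectory[OF V_uniformly_continuous[OF \<delta>] V_nonneg V_le[OF \<delta>] _ assms(2,3)])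
  fix x a and h :: real assume a: "a \<in> A" and h: "0 \<le> h"
  have ctrl: "(\<lambda>_. a) \<in> \<A>" by (rule constant_control[OF a])
  have "cost \<delta> (\<lambda>_. a) x h \<le> cost 0 (\<lambda>_. a) x h"
    unfolding cost_def using \<delta> h a l_nonneg[OF a]
    by (intro integral_le cost_integrand_integrable ctrl) (auto intro!: mult_left_le_one_le)
  moreover have "exp (- \<delta> * h) * V \<delta> (traj (\<lambda>_. a) x h) \<le> 1 * V \<delta> (traj (\<lambda>_. a) x h)"
    using \<delta> h V_nonneg by (intro mult_right_mono) auto
  ultimately show "V \<delta> x \<le> cost 0 (\<lambda>_. a) x h + V \<delta> (traj (\<lambda>_. a) x h)"
    using V_le_cost[OF \<delta> ctrl h, of x] by linarith
qed

end

section \<open>Periodicity\<close>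

lemma periodic_int_shift:
  fixes g :: "real ^ 'n \<Rightarrow> 'c" and k :: int
  assumes "\<And>x. g (x + axis i c) = g x"
  shows "g (x + axis i (of_int k * c)) = g x"
proof -
  have nat: "g (x + axis i (real n * c)) = g x" for n x
  proof (induction n)
    case (Suc n)
    have "axis i (real (Suc n) * c) = axis i (real n * c) + (axis i c :: real ^ 'n)"
      by (simp add: axis_def vec_eq_iff algebra_simps)
    then show ?case using assms[of "x + axis i (real n * c)"] Suc by (simp add: add.assoc)
  qed (simp add: axis_def zero_vec_def[symmetric])
  show ?thesis
  proof (cases k)
    case (nonneg n)
    then show ?thesis using nat by simp
  next
    case (neg n)
    have "real_of_int k * c = - (real (Suc n) * c)" unfolding neg by (simp del: of_nat_Suc)
    then have "axis i (of_int k * c) + axis i (real (Suc n) * c) = (0 :: real ^ 'n)"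
      by (simp only: axis_def vec_eq_iff) simp
    then show ?thesis
      using nat[of "x + axis i (of_int k * c)" "Suc n"] by (simp add: add.assoc)
  qed
qed

lemma periodic_torus_eq:
  fixes g :: "real ^ 'n \<Rightarrow> 'c"
  assumes per: "\<And>i x. g (x + axis i (T $ i)) = g x" and "torus_eq T x z"
  shows "g x = g z"
proof -
  obtain k :: "'n \<Rightarrow> int" where k: "\<And>i. x $ i - z $ i = of_int (k i) * T $ i"
    using assms(2) unfolding torus_eq_def by metis
  have "g (z + (\<Sum>i\<in>S. axis i (of_int (k i) * T $ i))) = g z" if "finite S" for S
    using that
  proof induction
    case (insert i S)
    then show ?case
      using periodic_int_shift[of g i "T $ i", OF per, of "z + (\<Sum>i\<in>S. axis i (of_int (k i) * T $ i))" "k i"]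
      by (simp add: ac_simps)
  qed simp
  moreover have "z + (\<Sum>i\<in>UNIV. axis i (of_int (k i) * T $ i)) = x"
    by (simp add: vec_eq_iff axis_def k[symmetric] if_distrib sum.delta cong: if_cong)
  ultimately show ?thesis by (metis finite)
qed

definition cube_rep :: "real ^ 'n \<Rightarrow> real ^ 'n \<Rightarrow> real ^ 'n" where
  "cube_rep T x = (\<chi> i. x $ i - of_int \<lfloor>x $ i / T $ i\<rfloor> * T $ i)"

lemma floor_remainder:
  assumes "0 < (c::real)"
  shows "0 \<le> x - of_int \<lfloor>x / c\<rfloor> * c" "x - of_int \<lfloor>x / c\<rfloor> * c < c"
proof -
  have "of_int \<lfloor>x / c\<rfloor> * c \<le> x / c * c" using assms by (intro mult_right_mono) auto
  then show "0 \<le> x - of_int \<lfloor>x / c\<rfloor> * c" using assms by simp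
  have "x / c * c < (of_int \<lfloor>x / c\<rfloor> + 1) * c" using assms by (intro mult_strict_right_mono) linarith+
  then show "x - of_int \<lfloor>x / c\<rfloor> * c < c" using assms by (simp add: algebra_simps)
qed

lemma cube_rep:
  assumes "\<And>i. 0 < T $ i"
  shows "cube_rep T x \<in> cbox 0 T" "torus_eq T x (cube_rep T x)"
  using floor_remainder(1)[OF assms] less_imp_le[OF floor_remainder(2)[OF assms]]
  by (auto simp: cube_rep_def mem_box_cart torus_eq_def)

text \<open>A lattice vector moves \<open>x\<close> into the cell and \<open>z\<close> along with
  it; as \<open>r \<le> T $ i\<close>, the image of \<open>z\<close> lies beyond at most one face.
  The segment is cut at that face, which is identified with the opposite one: two pieces inside the
  cell, hence the factor 2.\<close>

lemma periodic_dist_le_coordinate: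
  fixes g :: "real ^ 'n \<Rightarrow> 'c::metric_space"
  assumes T: "\<And>i. 0 < T $ i" and per: "\<And>i x. g (x + axis i (T $ i)) = g x"
    and cube: "\<And>x z. x \<in> cbox 0 T \<Longrightarrow> z \<in> cbox 0 T \<Longrightarrow> norm (x - z) \<le> r \<Longrightarrow> dist (g x) (g z) \<le> e"
    and r: "r \<le> T $ i"
    and xz: "\<And>j. j \<noteq> i \<Longrightarrow> x $ j = z $ j" "x $ i \<le> z $ i" "z $ i - x $ i \<le> r"
  shows "dist (g x) (g z) \<le> 2 * e"
proof -
  note eqD = periodic_torus_eq[OF per]
  have "0 \<le> r" using xz by simp
  have T0: "0 \<le> T $ j" for j using T[of j] by simp
  then have "(0 :: real ^ 'n) \<in> cbox 0 T" by (simp add: mem_box_cart)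
  with \<open>0 \<le> r\<close> have e: "0 \<le> e" using cube[of 0 0] by simp
  define s where "s j = of_int \<lfloor>x $ j / T $ j\<rfloor> * T $ j" for j
  define x' :: "real ^ 'n" where "x' = (\<chi> j. x $ j - s j)"
  define z' :: "real ^ 'n" where "z' = (\<chi> j. z $ j - s j)"
  have x'0: "0 \<le> x' $ j" "x' $ j < T $ j" "x' $ j \<le> T $ j" for j
    using floor_remainder[OF T, of "x $ j" j] by (simp_all add: x'_def s_def)
  have gx: "g x = g x'" "g z = g z'" by (rule eqD; auto simp: torus_eq_def x'_def z'_def s_def)+
  have z'j: "z' $ j = x' $ j" if "j \<noteq> i" for j using xz(1)[OF that] by (simp add: x'_def z'_def)
  have z'i: "x' $ i \<le> z' $ i" "z' $ i - x' $ i \<le> r" using xz(2,3) by (auto simp: x'_def z'_def)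
  have x'c: "x' \<in> cbox 0 T" using x'0 by (simp add: mem_box_cart)
  have one: "norm (u - v) = \<bar>u $ i - v $ i\<bar>" if "\<And>j. j \<noteq> i \<Longrightarrow> u $ j = v $ j" for u v :: "real ^ 'n"
  proof -
    have "u - v = axis i (u $ i - v $ i)" using that by (auto simp: vec_eq_iff axis_def)
    then have "norm (u - v) = norm (axis i (u $ i - v $ i) :: real ^ 'n)" by (rule arg_cong)
    then show ?thesis by (simp add: norm_eq_sqrt_inner[of "axis _ _"] inner_axis_axis)
  qed
  show ?thesis
  proof (cases "z' $ i \<le> T $ i")
    case True
    have "z' $ j \<le> T $ j" "0 \<le> z' $ j" for j
      using True z'j[of j] x'0[of j] z'i x'0[of i]
      by (cases "j = i"; simp)+
    then have "z' \<in> cbox 0 T" by (auto simp: mem_box_cart)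
    then have "dist (g x') (g z') \<le> e"
      using z'j z'i by (intro cube x'c) (auto simp: one)
    then show ?thesis using e gx by simp
  next
    case False
    \<comment> \<open>\<open>m\<close> is the crossing point on the far face, \<open>m'\<close> its
      copy on the near face, and \<open>y\<close> is \<open>z'\<close> moved back by one
      period.\<close>
    define m where "m = (\<chi> j. if j = i then T $ i else x' $ j)"
    define m' where "m' = (\<chi> j. if j = i then 0 else x' $ j)"
    define y where "y = (\<chi> j. if j = i then z' $ i - T $ i else x' $ j)"
    have "m = m' + axis i (T $ i)" "z' = y + axis i (T $ i)"
      using z'j by (auto simp: m_def m'_def y_def vec_eq_iff axis_def)
    then have gm: "g m = g m'" "g z' = g y" using per by auto
    have zi: "z' $ i \<le> T $ i + r" using z'i x'0(2)[of i] by simp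
    have "m \<in> cbox 0 T" "m' \<in> cbox 0 T" "y \<in> cbox 0 T"
      using x'0 T0 zi r False
      by (auto simp: mem_box_cart m_def m'_def y_def)
    moreover have "norm (x' - m) \<le> r" using False z'i x'0(2)[of i] by (subst one) (auto simp: m_def)
    moreover have "norm (m' - y) \<le> r" using False zi by (subst one) (auto simp: m'_def y_def)
    ultimately have "dist (g x') (g m) \<le> e" "dist (g m') (g y) \<le> e" using x'c by (auto intro!: cube)
    then show ?thesis
      using dist_triangle[of "g x'" "g y" "g m"] gx gm by simp
  qed
qed

text \<open>Moduli of continuity on the cube \<open>cbox 0 T\<close> pass to the whole space by changing one coordinate
  at a time; each change crosses at most one face of the lattice.\<close>

lemma periodic_dist_le:
  fixes g :: "real ^ 'n \<Rightarrow> 'c::metric_space"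
  assumes T: "\<And>i. 0 < T $ i" and per: "\<And>i x. g (x + axis i (T $ i)) = g x"
    and cube: "\<And>x z. x \<in> cbox 0 T \<Longrightarrow> z \<in> cbox 0 T \<Longrightarrow> norm (x - z) \<le> r \<Longrightarrow> dist (g x) (g z) \<le> e"
    and r: "\<And>i. r \<le> T $ i" and xz: "norm (x - z) \<le> r"
  shows "dist (g x) (g z) \<le> 2 * real CARD('n) * e"
proof -
  have step: "dist (g x) (g z) \<le> 2 * e" if "\<And>j. j \<noteq> i \<Longrightarrow> x $ j = z $ j" "\<bar>x $ i - z $ i\<bar> \<le> r" for x z i
  proof (cases "x $ i \<le> z $ i")
    case True
    then show ?thesis using that by (intro periodic_dist_le_coordinate[OF T per cube r]) auto
  next
    case False
    then have "dist (g z) (g x) \<le> 2 * e"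
      using that by (intro periodic_dist_le_coordinate[OF T per cube r]) auto
    then show ?thesis by (simp add: dist_commute)
  qed
  have *: "dist (g x) (g z) \<le> 2 * real (card S) * e"
    if "finite S" "\<And>j. j \<notin> S \<Longrightarrow> x $ j = z $ j" "\<And>j. \<bar>x $ j - z $ j\<bar> \<le> r" for S x z
    using that
  proof (induction S arbitrary: x rule: finite_induct)
    case empty
    then have "x = z" by (simp add: vec_eq_iff)
    then show ?case by simp
  next
    case (insert i S)
    define y :: "real ^ 'n" where "y = (\<chi> j. if j = i then z $ i else x $ j)"
    have "0 \<le> r" using insert.prems(2)[of i] by simp
    then have "dist (g y) (g z) \<le> 2 * real (card S) * e"
      using insert.prems insert.hyps by (intro insert.IH) (auto simp: y_def)
    moreover have "dist (g x) (g y) \<le> 2 * e"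
      using insert.prems(2)[of i] by (intro step[of i]) (auto simp: y_def)
    ultimately show ?case
      using insert.hyps dist_triangle[of "g x" "g z" "g y"] by (simp add: algebra_simps)
  qed
  have "\<bar>x $ j - z $ j\<bar> \<le> r" for j
    using component_le_norm_cart[of "x - z" j] xz by simp
  then show ?thesis by (intro *) auto
qed

text \<open>For close points, \<open>periodic_dist_le\<close> is applied with their own distance as
  radius; for points further apart than \<open>r\<close>, the bound \<open>M\<close> is converted
  into a Lipschitz bound.\<close>

lemma periodic_lipschitz:
  fixes g :: "real ^ 'n \<Rightarrow> 'c::real_normed_vector"
  assumes T: "\<And>i. 0 < T $ i" and per: "\<And>i x. g (x + axis i (T $ i)) = g x"
    and lip: "\<And>x z. x \<in> cbox 0 T \<Longrightarrow> z \<in> cbox 0 T \<Longrightarrow> norm (g x - g z) \<le> L * norm (x - z)"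
    and bound: "\<And>x. norm (g x) \<le> M"
    and r: "0 < r" "\<And>i. r \<le> T $ i" and L: "0 \<le> L"
  shows "norm (g x - g z) \<le> (2 * real CARD('n) * L + 2 * M / r) * norm (x - z)"
proof (cases "norm (x - z) \<le> r")
  case True
  have M: "0 \<le> M" using bound[of 0] norm_ge_zero order_trans by blast
  have "dist (g x) (g z) \<le> 2 * real CARD('n) * (L * norm (x - z))"
  proof (rule periodic_dist_le[OF T per])
    fix x' z' :: "real ^ 'n" assume "x' \<in> cbox 0 T" "z' \<in> cbox 0 T" and le: "norm (x' - z') \<le> norm (x - z)"
    then have "norm (g x' - g z') \<le> L * norm (x' - z')" by (intro lip)
    also have "\<dots> \<le> L * norm (x - z)" using le L by (rule mult_left_mono)
    finally show "dist (g x') (g z') \<le> L * norm (x - z)" by (simp add: dist_norm)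
  next
    show "norm (x - z) \<le> T $ i" for i using True r(2)[of i] by simp
  qed simp
  moreover have "0 \<le> 2 * M / r * norm (x - z)" using M r by simp
  ultimately show ?thesis by (simp add: dist_norm algebra_simps)
next
  case False
  have M: "0 \<le> M" using bound[of 0] norm_ge_zero order_trans by blast
  have "norm (g x - g z) \<le> 2 * M" using norm_triangle_ineq4[of "g x" "g z"] bound[of x] bound[of z] by simp
  also have "\<dots> = 2 * M / r * r" using r by simp
  also have "\<dots> \<le> 2 * M / r * norm (x - z)" using False M r by (intro mult_left_mono) auto
  also have "\<dots> \<le> (2 * real CARD('n) * L + 2 * M / r) * norm (x - z)"
    using L by (intro mult_right_mono) auto
  finally show ?thesis .
qed

lemma min_period:
  fixes T :: "real ^ 'n"
  assumes "\<And>i. 0 < T $ i"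
  obtains r where "0 < r" "\<And>i. r \<le> T $ i"
proof
  show "0 < Min (range (($) T))" using assms by (subst Min_gr_iff) auto
  show "Min (range (($) T)) \<le> T $ i" for i by (intro Min_le) auto
qed

locale periodic_problem = recession_problem A f l q K C1 C2 f_inf l_inf
  for A :: "'b::euclidean_space set" and f :: "real ^ 'n \<Rightarrow> 'b \<Rightarrow> real ^ 'n"
    and l :: "real ^ 'n \<Rightarrow> 'b \<Rightarrow> real" and q :: nat and K C1 C2 :: real
    and f_inf :: "real ^ 'n \<Rightarrow> 'b \<Rightarrow> real ^ 'n" and l_inf :: "real ^ 'n \<Rightarrow> 'b \<Rightarrow> real" +
  fixes T :: "real ^ 'n" and C \<gamma> :: real
  assumes T_pos: "\<And>i. 0 < T $ i"
    and f_periodic: "\<And>i x a. a \<in> A \<Longrightarrow> f (x + axis i (T $ i)) a = f x a"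
    and l_periodic: "\<And>i x a. a \<in> A \<Longrightarrow> l (x + axis i (T $ i)) a = l x a"
    and C_pos: "0 < C" and \<gamma>_pos: "0 < \<gamma>"
    and controllable: "\<And>x z. x \<in> cbox 0 T \<Longrightarrow> z \<in> cbox 0 T \<Longrightarrow> \<not> torus_eq T x z \<Longrightarrow>
         \<exists>S>0. \<exists>\<mu>\<in>relaxed_controls A.
           torus_eq T (\<xi>r x \<mu> S) z \<and> S \<le> C * norm (x - z) powr \<gamma>"
begin

section \<open>Equicontinuity of the discounted values\<close>

lemma traj_periodic:
  assumes \<alpha>: "\<alpha> \<in> \<A>" and s: "0 \<le> s"
  shows "traj \<alpha> (x + axis i (T $ i)) s = traj \<alpha> x s + axis i (T $ i)"
proof -
  have A: "\<alpha> r \<in> A" if "0 \<le> r" for r using \<alpha> that by (simp add: controls_iff)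
  show ?thesis
  proof (rule traj_unique[OF \<alpha>, where t = s])
    show "continuous_on {0..s} (\<lambda>s. traj \<alpha> x s + axis i (T $ i))"
      by (intro continuous_intros traj_continuous_on \<alpha>)
    have eq: "f (traj \<alpha> x r + axis i (T $ i)) (\<alpha> r) = f (traj \<alpha> x r) (\<alpha> r)" if "0 \<le> r" for r
      by (rule f_periodic[OF A[OF that]])
    show "(\<lambda>r. f (traj \<alpha> x r + axis i (T $ i)) (\<alpha> r)) integrable_on {0..s'}" if "s' \<in> {0..s}" for s'
      by (rule integrable_eq[OF traj_integrable'[OF \<alpha>, of s' x]]) (use that eq in auto)
    show "traj \<alpha> x s' + axis i (T $ i) = x + axis i (T $ i) +
        integral {0..s'} (\<lambda>r. f (traj \<alpha> x r + axis i (T $ i)) (\<alpha> r))" if "s' \<in> {0..s}" for s'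
    proof -
      have "integral {0..s'} (\<lambda>r. f (traj \<alpha> x r + axis i (T $ i)) (\<alpha> r)) =
          integral {0..s'} (velocity \<alpha> x)"
        by (rule integral_cong) (use eq in auto)
      then show ?thesis using traj_integral[OF \<alpha>, of s' x] that by (simp add: algebra_simps)
    qed
  qed (use s in auto)
qed

lemma V_periodic: "V \<delta> (x + axis i (T $ i)) = V \<delta> x"
proof -
  have "total_cost \<delta> \<alpha> (x + axis i (T $ i)) = total_cost \<delta> \<alpha> x" if \<alpha>: "\<alpha> \<in> \<A>" for \<alpha>
    unfolding total_cost_def
    by (intro nn_integral_cong) (use \<alpha> traj_periodic[OF \<alpha>] l_periodic in \<open>auto simp: indicator_def controls_iff\<close>)
  then show ?thesis unfolding V_eq by (auto intro!: arg_cong[where f = enn2real] INF_cong)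
qed

lemma V_torus_eq: "torus_eq T x z \<Longrightarrow> V \<delta> x = V \<delta> z"
  by (rule periodic_torus_eq[OF V_periodic])

text \<open>The relaxed trajectory reaches \<open>z\<close> only up to a lattice vector, which the
  periodic function \<open>V \<delta>\<close> does not see; points equal on the torus have equal
  values.\<close>

lemma V_diff_le_cube:
  assumes "0 < \<delta>" "x \<in> cbox 0 T" "z \<in> cbox 0 T"
  shows "V \<delta> x - V \<delta> z \<le> K * (C * norm (x - z) powr \<gamma>)"
proof (cases "torus_eq T x z")
  case True
  then show ?thesis using V_torus_eq[of x z \<delta>] K_pos C_pos by simp
next
  case False
  then obtain S \<mu> where S: "0 < S" "\<mu> \<in> relaxed_controls A"
    "torus_eq T (\<xi>r x \<mu> S) z" "S \<le> C * norm (x - z) powr \<gamma>"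
    using controllable[OF assms(2,3)] by blast
  have "V \<delta> x \<le> V \<delta> z + K * S"
    using V_along_relaxed_trajectory[OF assms(1) S(2), of S x] S(1) V_torus_eq[OF S(3)] by simp
  moreover have "K * S \<le> K * (C * norm (x - z) powr \<gamma>)" using S(4) K_pos by simp
  ultimately show ?thesis by simp
qed

lemma V_dist_le_cube:
  assumes "0 < \<delta>" "x \<in> cbox 0 T" "z \<in> cbox 0 T"
  shows "\<bar>V \<delta> x - V \<delta> z\<bar> \<le> K * (C * norm (x - z) powr \<gamma>)"
  using V_diff_le_cube[OF assms] V_diff_le_cube[OF assms(1,3,2)] by (simp add: norm_minus_commute abs_le_iff)

lemma V_equicontinuous:
  assumes e: "0 < e"
  shows "\<exists>d>0. \<forall>\<delta>>0. \<forall>x z. norm (x - z) \<le> d \<longrightarrow> \<bar>V \<delta> x - V \<delta> z\<bar> \<le> e"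
proof -
  obtain r where r: "0 < r" "\<And>i. r \<le> T $ i" using min_period[OF T_pos] by blast
  \<comment> \<open>Chosen so that \<open>2 * real CARD('n) * (K * (C * e'))\<close> is
    \<open>e\<close>, which pays for passing from the cell to the whole space; \<open>d\<close> then
    inverts the Hoelder power.\<close>
  define e' where "e' = e / (2 * real CARD('n)) / (K * C)"
  have e': "0 < e'" using e K_pos C_pos by (simp add: e'_def)
  define d where "d = min r (e' powr (1 / \<gamma>))"
  have d: "0 < d" "d \<le> r" using r e' by (auto simp: d_def)
  have "d powr \<gamma> \<le> (e' powr (1 / \<gamma>)) powr \<gamma>" using d \<gamma>_pos by (intro powr_mono2) (auto simp: d_def)
  then have d\<gamma>: "d powr \<gamma> \<le> e'" using e' \<gamma>_pos by (simp add: powr_powr)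
  have "\<bar>V \<delta> x - V \<delta> z\<bar> \<le> e" if \<delta>: "0 < \<delta>" and xz: "norm (x - z) \<le> d" for \<delta> x z
  proof -
    have "dist (V \<delta> x) (V \<delta> z) \<le> 2 * real CARD('n) * (K * (C * e'))"
    proof (rule periodic_dist_le[OF T_pos V_periodic _ _ xz])
      fix x z assume xz: "x \<in> cbox 0 T" "z \<in> cbox 0 T" "norm (x - z) \<le> d"
      have "norm (x - z) powr \<gamma> \<le> d powr \<gamma>" using xz(3) \<gamma>_pos by (intro powr_mono2) auto
      then have "K * (C * norm (x - z) powr \<gamma>) \<le> K * (C * e')"
        using d\<gamma> K_pos C_pos by (intro mult_left_mono) auto
      then show "dist (V \<delta> x) (V \<delta> z) \<le> K * (C * e')"
        using V_dist_le_cube[OF \<delta> xz(1,2)] by (simp add: dist_real_def)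
    next
      show "d \<le> T $ i" for i using d(2) r(2)[of i] by simp
    qed
    also have "\<dots> = e" using K_pos C_pos by (simp add: e'_def)
    finally show ?thesis by (simp add: dist_real_def)
  qed
  then show ?thesis using d by blast
qed

text \<open>The Hoelder modulus of the discounted values at the diagonal of the cell.\<close>

definition osc :: real where "osc = K * (C * norm T powr \<gamma>)"

lemma V_osc:
  assumes "0 < \<delta>"
  shows "\<bar>V \<delta> x - V \<delta> z\<bar> \<le> osc"
proof -
  define x' z' where "x' = cube_rep T x" and "z' = cube_rep T z"
  have c: "x' \<in> cbox 0 T" "z' \<in> cbox 0 T" and eq: "V \<delta> x = V \<delta> x'" "V \<delta> z = V \<delta> z'"
    using cube_rep[OF T_pos] V_torus_eq by (auto simp: x'_def z'_def)
  have "norm (x' - z') \<le> norm T"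
    using c by (intro norm_le_componentwise_cart) (smt (verit) mem_box_cart(2) real_norm_def vector_minus_component zero_index)
  then have "norm (x' - z') powr \<gamma> \<le> norm T powr \<gamma>" using \<gamma>_pos by (intro powr_mono2) auto
  then have "K * (C * norm (x' - z') powr \<gamma>) \<le> osc"
    unfolding osc_def using K_pos C_pos by (intro mult_left_mono) auto
  then show ?thesis using V_dist_le_cube[OF assms c] eq by simp
qed

text \<open>The constants are extracted first, then the functions along that subsequence.
  Compactness is used on one cell; the limit is extended by \<open>cube_rep\<close>, and periodicity
  turns uniform convergence on the cell into uniform convergence on the whole space.\<close>

lemma vanishing_discount_subsequence:
  fixes d :: "nat \<Rightarrow> real"
  assumes d: "\<And>k. 0 < d k"
  obtains r :: "nat \<Rightarrow> nat" and lam W where "strict_mono r" "(\<lambda>k. d (r k) * V (d (r k)) 0) \<longlonglongrightarrow> lam"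
    "uniform_limit UNIV (\<lambda>k x. V (d (r k)) x - V (d (r k)) 0) W sequentially"
proof -
  have bd: "d k * V (d k) 0 \<in> {0..K}" for k
    using V_le[OF d, of k 0] V_nonneg[of "d k" 0] d[of k] by (simp add: field_simps)
  have "seq_compact {0..K}" by (simp add: compact_imp_seq_compact)
  from seq_compactE[OF this, of "\<lambda>k. d k * V (d k) 0"]
  obtain lam r1 where r1: "strict_mono r1" "((\<lambda>k. d k * V (d k) 0) \<circ> r1) \<longlonglongrightarrow> lam"
    using bd by metis
  define w where "w = (\<lambda>k x. V (d (r1 k)) x - V (d (r1 k)) 0)"
  obtain g and r2 :: "nat \<Rightarrow> nat" where r2: "strict_mono r2"
    and g: "\<And>e. 0 < e \<Longrightarrow> \<exists>N. \<forall>n x. N \<le> n \<and> x \<in> cbox 0 T \<longrightarrow> norm (w (r2 n) x - g x) < e"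
  proof (rule Arzela_Ascoli[of "cbox 0 T" w osc])
    show "norm (w n x) \<le> osc" for n x using V_osc[OF d] by (simp add: w_def)
    show "\<exists>\<delta>>0. \<forall>n y. y \<in> cbox 0 T \<and> norm (x - y) < \<delta> \<longrightarrow> norm (w n x - w n y) < e" if "0 < e" for x e
    proof -
      from V_equicontinuous[OF half_gt_zero[OF that]]
      obtain d' where "0 < d'"
        and d': "\<And>\<delta> x z. 0 < \<delta> \<Longrightarrow> norm (x - z) \<le> d' \<Longrightarrow> \<bar>V \<delta> x - V \<delta> z\<bar> \<le> e / 2"
        by blast
      have "norm (w n x - w n y) < e" if "norm (x - y) < d'" for n y
      proof -
        have "\<bar>V (d (r1 n)) x - V (d (r1 n)) y\<bar> \<le> e / 2" by (rule d'[OF d]) (use that in simp)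
        then show ?thesis using \<open>0 < e\<close> by (simp add: w_def)
      qed
      then show ?thesis using \<open>0 < d'\<close> by blast
    qed
  qed (auto intro: compact_cbox)
  define W where "W = (\<lambda>x. g (cube_rep T x))"
  have "uniform_limit UNIV (\<lambda>k x. w (r2 k) x) W sequentially"
  proof (rule uniform_limitI)
    fix e :: real assume "0 < e"
    from g[OF this] obtain N where N: "\<And>n x. N \<le> n \<Longrightarrow> x \<in> cbox 0 T \<Longrightarrow> norm (w (r2 n) x - g x) < e" by blast
    have "dist (w (r2 n) x) (W x) < e" if "N \<le> n" for n x
    proof -
      have "w (r2 n) x = w (r2 n) (cube_rep T x)"
        unfolding w_def using V_torus_eq[OF cube_rep(2)[OF T_pos]] by simp
      then show ?thesis using N[OF that cube_rep(1)[OF T_pos], of x] by (simp add: W_def dist_norm)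
    qed
    then show "\<forall>\<^sub>F n in sequentially. \<forall>x\<in>UNIV. dist (w (r2 n) x) (W x) < e"
      unfolding eventually_sequentially by blast
  qed
  moreover have "(\<lambda>k. d ((r1 \<circ> r2) k) * V (d ((r1 \<circ> r2) k)) 0) \<longlonglongrightarrow> lam"
    using LIMSEQ_subseq_LIMSEQ[OF r1(2) r2] by (simp add: o_def)
  ultimately show thesis
    using that[of "r1 \<circ> r2" lam W] strict_mono_o[OF r1(1) r2] by (simp add: w_def o_def)
qed

end

section \<open>The ergodic constant\<close>

text \<open>Second-order control of the discount over a fixed time: multiplied by \<open>V\<close>,
  which may be of order \<open>1 / \<delta>\<close>, the quadratic remainder still tends to
  0.\<close>

lemma one_minus_exp_bounds:
  fixes x :: real
  assumes "0 \<le> x"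
  shows "1 - exp (- x) \<le> x" "x - x\<^sup>2 \<le> 1 - exp (- x)"
proof -
  show "1 - exp (- x) \<le> x" using exp_ge_add_one_self[of "- x"] by simp
  have "exp (- x) = 1 / exp x" by (simp add: exp_minus field_simps)
  also have "\<dots> \<le> 1 / (1 + x)"
    using assms exp_ge_add_one_self[of x] by (intro divide_left_mono) auto
  also have "\<dots> \<le> 1 - x + x\<^sup>2"
  proof -
    have "(1 - x + x\<^sup>2) * (1 + x) = 1 + x ^ 3"
      by (simp add: algebra_simps power2_eq_square power3_eq_cube)
    then show ?thesis using assms by (simp add: pos_divide_le_eq)
  qed
  finally show "x - x\<^sup>2 \<le> 1 - exp (- x)" by simp
qed

context periodic_problem
begin

definition w :: "real \<Rightarrow> real ^ 'n \<Rightarrow> real" where "w \<delta> x = V \<delta> x - V \<delta> 0"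

lemma w_bound: "0 < \<delta> \<Longrightarrow> \<bar>w \<delta> x\<bar> \<le> osc"
  unfolding w_def by (rule V_osc)

lemma osc_nonneg: "0 \<le> osc"
  using K_pos C_pos by (simp add: osc_def)

text \<open>Subtracting \<open>V \<delta> 0\<close> in the dynamic programming principle leaves the
  term \<open>(1 - exp (- \<delta> * t)) * V \<delta> 0\<close>, the discounted counterpart of
  \<open>lam * t\<close>. The bound \<open>\<delta> * V \<delta> 0 \<le> K\<close> makes the
  remainder of order \<open>\<delta>\<close>.\<close>

lemma discounted_constant_bounds:
  assumes \<delta>: "0 < \<delta>" and t: "0 \<le> t"
  shows "(1 - exp (- \<delta> * t)) * V \<delta> 0 \<le> (\<delta> * V \<delta> 0) * t"
    and "(\<delta> * V \<delta> 0) * t - K * \<delta> * t\<^sup>2 \<le> (1 - exp (- \<delta> * t)) * V \<delta> 0"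
proof -
  have \<delta>t: "0 \<le> \<delta> * t" using assms by simp
  note b = one_minus_exp_bounds[OF \<delta>t]
  show "(1 - exp (- \<delta> * t)) * V \<delta> 0 \<le> (\<delta> * V \<delta> 0) * t"
    using mult_right_mono[OF b(1) V_nonneg[of \<delta> 0]] by (simp add: mult_ac)
  have "\<delta> * V \<delta> 0 \<le> K" using V_le[OF \<delta>, of 0] \<delta> by (simp add: field_simps)
  then have "\<delta> * V \<delta> 0 * (\<delta> * t\<^sup>2) \<le> K * (\<delta> * t\<^sup>2)" using \<delta> by (intro mult_right_mono) auto
  moreover have "(\<delta> * t - (\<delta> * t)\<^sup>2) * V \<delta> 0 \<le> (1 - exp (- \<delta> * t)) * V \<delta> 0"
    using mult_right_mono[OF b(2) V_nonneg[of \<delta> 0]] by simp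
  ultimately show "(\<delta> * V \<delta> 0) * t - K * \<delta> * t\<^sup>2 \<le> (1 - exp (- \<delta> * t)) * V \<delta> 0"
    by (simp add: algebra_simps power2_eq_square)
qed

lemma w_discount_le:
  assumes \<delta>: "0 < \<delta>" and t: "0 \<le> t"
  shows "\<bar>exp (- \<delta> * t) * w \<delta> y - w \<delta> y\<bar> \<le> \<delta> * t * osc"
proof -
  have \<delta>t: "0 \<le> \<delta> * t" using assms by simp
  have "exp (- \<delta> * t) * w \<delta> y - w \<delta> y = - ((1 - exp (- (\<delta> * t))) * w \<delta> y)" by (simp add: algebra_simps)
  then have "\<bar>exp (- \<delta> * t) * w \<delta> y - w \<delta> y\<bar> = (1 - exp (- (\<delta> * t))) * \<bar>w \<delta> y\<bar>"
    using \<delta>t by (simp add: abs_mult)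
  also have "\<dots> \<le> (\<delta> * t) * osc"
    using one_minus_exp_bounds[OF \<delta>t] w_bound[OF \<delta>] \<delta>t by (intro mult_mono) auto
  finally show ?thesis .
qed

lemma cost_le_cost_0:
  assumes \<alpha>: "\<alpha> \<in> \<A>" and "0 \<le> \<delta>" "0 \<le> t"
  shows "cost \<delta> \<alpha> x t \<le> cost 0 \<alpha> x t" and "cost 0 \<alpha> x t \<le> exp (\<delta> * t) * cost \<delta> \<alpha> x t"
proof -
  have nonneg: "0 \<le> l (traj \<alpha> x s) (\<alpha> s)" if "0 \<le> s" for s
    using l_nonneg \<alpha> that by (simp add: controls_iff)
  show "cost \<delta> \<alpha> x t \<le> cost 0 \<alpha> x t"
    unfolding cost_def
  proof (intro integral_le cost_integrand_integrable \<alpha> assms)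
    fix s assume s: "s \<in> {0..t}"
    then have "running_cost \<delta> \<alpha> x s \<le> 1 * l (traj \<alpha> x s) (\<alpha> s)"
      using assms by (intro mult_right_mono nonneg) auto
    then show "running_cost \<delta> \<alpha> x s \<le> exp (- 0 * s) * l (traj \<alpha> x s) (\<alpha> s)"
      by simp
  qed simp
  have "cost 0 \<alpha> x t \<le> integral {0..t} (\<lambda>s. exp (\<delta> * t) * (running_cost \<delta> \<alpha> x s))"
    unfolding cost_def
  proof (intro integral_le integrable_on_mult_right cost_integrand_integrable \<alpha> assms)
    fix s assume s: "s \<in> {0..t}"
    have "1 * l (traj \<alpha> x s) (\<alpha> s) \<le> exp (\<delta> * (t - s)) * l (traj \<alpha> x s) (\<alpha> s)"
      using s assms by (intro mult_right_mono nonneg) auto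
    also have "exp (\<delta> * (t - s)) = exp (\<delta> * t) * exp (- \<delta> * s)" by (simp add: mult_exp_exp algebra_simps)
    finally show "exp (- 0 * s) * l (traj \<alpha> x s) (\<alpha> s)
        \<le> exp (\<delta> * t) * (running_cost \<delta> \<alpha> x s)" by (simp add: mult.assoc)
  qed auto
  then show "cost 0 \<alpha> x t \<le> exp (\<delta> * t) * cost \<delta> \<alpha> x t" by (simp add: cost_def)
qed

text \<open>The dynamic programming principle of the limit problem. One control has to be
  near-optimal at all times of \<open>{0..h}\<close> simultaneously, since it will be stopped at an
  exit time that depends on it. The bound \<open>osc\<close> is common to all pairs, which makes
  their constants comparable.\<close>

definition ergodic_pair :: "real \<Rightarrow> (real ^ 'n \<Rightarrow> real) \<Rightarrow> bool" where
  "ergodic_pair lam W \<longleftrightarrow> (\<forall>x. \<bar>W x\<bar> \<le> osc) \<and>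
     (\<forall>x t. \<forall>\<alpha>\<in>\<A>. 0 \<le> t \<longrightarrow> W x \<le> cost 0 \<alpha> x t - lam * t + W (traj \<alpha> x t)) \<and>
     (\<forall>x h e. 0 \<le> h \<longrightarrow> 0 < e \<longrightarrow> (\<exists>\<alpha>\<in>\<A>. \<forall>t\<in>{0..h}.
        cost 0 \<alpha> x t - lam * t + W (traj \<alpha> x t) \<le> W x + e))"

text \<open>In the first inequality the control is fixed and the limit is pointwise. For the second
  no limit of controls is taken: a control near-optimal for a single sufficiently large
  \<open>k\<close> already serves the limit problem on \<open>{0..h}\<close>.\<close>

lemma ergodic_pair_limit:
  fixes d :: "nat \<Rightarrow> real"
  assumes d: "\<And>k. 0 < d k" "d \<longlonglongrightarrow> 0" and lam: "(\<lambda>k. d k * V (d k) 0) \<longlonglongrightarrow> lam"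
    and W: "uniform_limit UNIV (\<lambda>k. w (d k)) W sequentially"
  shows "ergodic_pair lam W"
  unfolding ergodic_pair_def
proof (intro conjI allI ballI impI)
  have Wx: "(\<lambda>k. w (d k) x) \<longlonglongrightarrow> W x" for x
    using W by (rule tendsto_uniform_limitI) simp
  show "\<bar>W x\<bar> \<le> osc" for x
  proof (rule tendsto_upperbound)
    show "(\<lambda>k. \<bar>w (d k) x\<bar>) \<longlonglongrightarrow> \<bar>W x\<bar>" by (intro tendsto_intros Wx)
  qed (use w_bound d(1) in auto)
  show "W x \<le> cost 0 \<alpha> x t - lam * t + W (traj \<alpha> x t)" if \<alpha>: "\<alpha> \<in> \<A>" and t: "0 \<le> t" for x t \<alpha>
  proof (rule LIMSEQ_le[OF Wx])
    let ?y = "traj \<alpha> x t"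
    have e1: "(\<lambda>k. d k * V (d k) 0 * t) \<longlonglongrightarrow> lam * t" using lam by (rule tendsto_mult_right)
    have e2: "(\<lambda>k. K * d k * t\<^sup>2) \<longlonglongrightarrow> K * 0 * t\<^sup>2" by (intro tendsto_intros d(2))
    have e3: "(\<lambda>k. exp (- d k * t) * w (d k) ?y) \<longlonglongrightarrow> exp (- 0 * t) * W ?y"
      by (intro tendsto_intros Wx d(2))
    from tendsto_add[OF tendsto_diff[OF tendsto_const[of "cost 0 \<alpha> x t"] tendsto_diff[OF e1 e2]] e3]
    show "(\<lambda>k. cost 0 \<alpha> x t - ((d k * V (d k) 0) * t - K * d k * t\<^sup>2) + exp (- d k * t) * w (d k) ?y)
        \<longlonglongrightarrow> cost 0 \<alpha> x t - lam * t + W ?y"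
      by simp
    have "w (d k) x \<le> cost 0 \<alpha> x t - ((d k * V (d k) 0) * t - K * d k * t\<^sup>2) + exp (- d k * t) * w (d k) ?y" for k
    proof -
      have "V (d k) x \<le> cost (d k) \<alpha> x t + exp (- d k * t) * V (d k) ?y"
        by (rule V_le_cost[OF d(1) \<alpha> t])
      moreover have "cost (d k) \<alpha> x t \<le> cost 0 \<alpha> x t" using cost_le_cost_0(1)[OF \<alpha>] d(1)[of k] t by simp
      ultimately show ?thesis
        using discounted_constant_bounds(2)[OF d(1)[of k] t] by (simp add: w_def algebra_simps)
    qed
    then show "\<exists>N. \<forall>n\<ge>N. w (d n) x \<le> cost 0 \<alpha> x t - ((d n * V (d n) 0) * t - K * d n * t\<^sup>2) + exp (- d n * t) * w (d n) ?y"
      by blast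
  qed
  show "\<exists>\<alpha>\<in>\<A>. \<forall>t\<in>{0..h}. cost 0 \<alpha> x t - lam * t + W (traj \<alpha> x t) \<le> W x + e"
    if h: "0 \<le> h" and e: "0 < e" for x h e
  proof -
    \<comment> \<open>Six portions: near-optimality, the discount on \<open>w\<close>, the discount
      on the cost, the convergence of \<open>\<delta> * V \<delta> 0\<close>, and the distance from
      \<open>w\<close> to \<open>W\<close> at both end points.\<close>
    define \<epsilon> where "\<epsilon> = min (e / 6) 1"
    have \<epsilon>: "0 < \<epsilon>" "\<epsilon> \<le> 1" "6 * \<epsilon> \<le> e" using e by (auto simp: \<epsilon>_def)
    \<comment> \<open>Will bound the discounted cost on \<open>{0..h}\<close>: \<open>K * h\<close>
      from the constant, \<open>osc\<close> from each of the two values of \<open>w\<close>, and 1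
      for \<open>\<epsilon>\<close>.\<close>
    define Q where "Q = K * h + 2 * osc + 1"
    have "(\<lambda>k. (exp (d k * h) - 1) * Q) \<longlonglongrightarrow> (exp (0 * h) - 1) * Q"
      by (intro tendsto_intros d(2))
    then have "\<forall>\<^sub>F k in sequentially. (exp (d k * h) - 1) * Q < \<epsilon>"
      using \<epsilon>(1) by (intro order_tendstoD) auto
    moreover have "(\<lambda>k. d k * h * osc) \<longlonglongrightarrow> 0 * h * osc" by (intro tendsto_intros d(2))
    then have "\<forall>\<^sub>F k in sequentially. d k * h * osc < \<epsilon>"
      using \<epsilon>(1) by (intro order_tendstoD) auto
    moreover have "(\<lambda>k. \<bar>d k * V (d k) 0 - lam\<bar> * h) \<longlonglongrightarrow> \<bar>lam - lam\<bar> * h"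
      by (intro tendsto_mult_right tendsto_rabs tendsto_diff lam tendsto_const)
    then have "\<forall>\<^sub>F k in sequentially. \<bar>d k * V (d k) 0 - lam\<bar> * h < \<epsilon>"
      using \<epsilon>(1) by (intro order_tendstoD) auto
    moreover have "\<forall>\<^sub>F k in sequentially. \<forall>y\<in>UNIV. dist (w (d k) y) (W y) < \<epsilon>"
      using W \<epsilon>(1) by (rule uniform_limitD)
    ultimately have "\<forall>\<^sub>F k in sequentially. (exp (d k * h) - 1) * Q < \<epsilon> \<and> d k * h * osc < \<epsilon> \<and>
        \<bar>d k * V (d k) 0 - lam\<bar> * h < \<epsilon> \<and> (\<forall>y\<in>UNIV. dist (w (d k) y) (W y) < \<epsilon>)"
      by eventually_elim auto
    then obtain k where k: "(exp (d k * h) - 1) * Q < \<epsilon>" "d k * h * osc < \<epsilon>"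
        "\<bar>d k * V (d k) 0 - lam\<bar> * h < \<epsilon>" "\<And>y. \<bar>w (d k) y - W y\<bar> < \<epsilon>"
      unfolding eventually_sequentially by (auto simp: dist_real_def)
    define \<delta> where "\<delta> = d k"
    have \<delta>: "0 < \<delta>" using d(1) by (simp add: \<delta>_def)
    note k = k[folded \<delta>_def]
    obtain \<alpha> where \<alpha>: "\<alpha> \<in> \<A>"
      "\<And>t. 0 \<le> t \<Longrightarrow> cost \<delta> \<alpha> x t + exp (- \<delta> * t) * V \<delta> (traj \<alpha> x t) \<le> V \<delta> x + \<epsilon>"
      using cost_le_V[OF \<delta> \<epsilon>(1)] by blast
    have "cost 0 \<alpha> x t - lam * t + W (traj \<alpha> x t) \<le> W x + e" if t: "t \<in> {0..h}" for t
    proof -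
      have t0: "0 \<le> t" "t \<le> h" using t by auto
      define y where "y = traj \<alpha> x t"
      have th: "\<delta> * t * osc \<le> \<delta> * h * osc" "\<bar>\<delta> * V \<delta> 0 - lam\<bar> * t \<le> \<bar>\<delta> * V \<delta> 0 - lam\<bar> * h"
        using t0 \<delta> osc_nonneg by (auto intro!: mult_left_mono mult_right_mono)
      have "cost \<delta> \<alpha> x t \<le> (1 - exp (- \<delta> * t)) * V \<delta> 0 + w \<delta> x - exp (- \<delta> * t) * w \<delta> y + \<epsilon>"
        using \<alpha>(2)[OF t0(1)] by (simp add: w_def y_def algebra_simps)
      also have "\<dots> \<le> \<delta> * V \<delta> 0 * t + w \<delta> x - w \<delta> y + \<delta> * t * osc + \<epsilon>"
        using discounted_constant_bounds(1)[OF \<delta> t0(1)] w_discount_le[OF \<delta> t0(1), of y] by linarith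
      finally have c: "cost \<delta> \<alpha> x t \<le> \<delta> * V \<delta> 0 * t + w \<delta> x - w \<delta> y + 2 * \<epsilon>" using k(2) th(1) by simp
      have "cost \<delta> \<alpha> x t \<le> Q"
      proof -
        have "\<delta> * V \<delta> 0 \<le> K" using V_le[OF \<delta>, of 0] \<delta> by (simp add: field_simps)
        then have "\<delta> * V \<delta> 0 * t \<le> K * h" using t0 K_pos V_nonneg[of \<delta> 0] \<delta> by (intro mult_mono) auto
        moreover have "exp (- \<delta> * t) * \<bar>w \<delta> y\<bar> \<le> 1 * osc" using w_bound[OF \<delta>, of y] \<delta> t0 by (intro mult_mono) auto
        then have "- (exp (- \<delta> * t) * w \<delta> y) \<le> osc"
          using abs_ge_minus_self[of "exp (- \<delta> * t) * w \<delta> y"] by (simp add: abs_mult)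
        ultimately show ?thesis
          using \<open>cost \<delta> \<alpha> x t \<le> (1 - exp (- \<delta> * t)) * V \<delta> 0 + w \<delta> x - exp (- \<delta> * t) * w \<delta> y + \<epsilon>\<close>
            discounted_constant_bounds(1)[OF \<delta> t0(1)] w_bound[OF \<delta>, of x] \<epsilon>(2)
          by (simp add: Q_def)
      qed
      moreover have "exp (\<delta> * t) - 1 \<le> exp (\<delta> * h) - 1" "0 \<le> exp (\<delta> * t) - 1" using t0 \<delta> by auto
      moreover have "0 \<le> cost \<delta> \<alpha> x t" using cost_nonneg[OF \<alpha>(1), of \<delta> t x] \<delta> t0 by simp
      ultimately have "(exp (\<delta> * t) - 1) * cost \<delta> \<alpha> x t \<le> (exp (\<delta> * h) - 1) * Q"
        by (intro mult_mono) auto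
      moreover have "cost 0 \<alpha> x t \<le> exp (\<delta> * t) * cost \<delta> \<alpha> x t"
        using cost_le_cost_0(2)[OF \<alpha>(1), of \<delta> t x] \<delta> t0 by simp
      ultimately have c0: "cost 0 \<alpha> x t \<le> cost \<delta> \<alpha> x t + \<epsilon>" using k(1) by (simp add: algebra_simps)
      have "\<delta> * V \<delta> 0 * t - lam * t \<le> \<bar>\<delta> * V \<delta> 0 - lam\<bar> * t"
        using t0 by (simp add: left_diff_distrib[symmetric] mult_right_mono)
      then have "\<delta> * V \<delta> 0 * t - lam * t \<le> \<epsilon>" using th(2) k(3) by linarith
      then show ?thesis
        using c c0 k(4)[of x] k(4)[of y] \<epsilon>(3) unfolding y_def[symmetric] by linarith
    qed
    then show ?thesis using \<alpha>(1) by blast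
  qed
qed

lemma VT_ergodic_pair:
  assumes "ergodic_pair lam W" and t: "0 \<le> t"
  shows "\<bar>VT t x - lam * t\<bar> \<le> 2 * osc"
proof -
  have W: "\<bar>W y\<bar> \<le> osc" for y using assms by (simp add: ergodic_pair_def)
  have "lam * t - 2 * osc \<le> VT t x"
  proof (rule VT_ge[OF t])
    fix \<alpha> assume "\<alpha> \<in> \<A>"
    then have "W x \<le> cost 0 \<alpha> x t - lam * t + W (traj \<alpha> x t)"
      using assms by (simp add: ergodic_pair_def)
    then show "lam * t - 2 * osc \<le> cost 0 \<alpha> x t" using W[of x] W[of "traj \<alpha> x t"] by linarith
  qed
  moreover have "VT t x \<le> lam * t + 2 * osc"
  proof (rule field_le_epsilon)
    fix e :: real assume "0 < e"
    then obtain \<alpha> where \<alpha>: "\<alpha> \<in> \<A>" "cost 0 \<alpha> x t - lam * t + W (traj \<alpha> x t) \<le> W x + e"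
      using assms unfolding ergodic_pair_def by (meson atLeastAtMost_iff order_refl)
    have "VT t x \<le> cost 0 \<alpha> x t" by (rule VT_le_cost[OF t \<alpha>(1)])
    then show "VT t x \<le> lam * t + 2 * osc + e" using \<alpha>(2) W[of x] W[of "traj \<alpha> x t"] by linarith
  qed
  ultimately show ?thesis by linarith
qed

lemma ergodic_pair_unique:
  assumes "ergodic_pair lam W" "ergodic_pair lam' W'"
  shows "lam = lam'"
proof (rule ccontr)
  assume ne: "lam \<noteq> lam'"
  \<comment> \<open>Each pair keeps \<open>VT t 0\<close> within \<open>2 * osc\<close> of its own
    line; at this time the lines are \<open>4 * osc + 1\<close> apart.\<close>
  define t where "t = (4 * osc + 1) / \<bar>lam - lam'\<bar>"
  have t: "0 \<le> t" using osc_nonneg by (simp add: t_def)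
  have "\<bar>lam - lam'\<bar> * t = 4 * osc + 1" using ne by (simp add: t_def)
  moreover have "\<bar>lam - lam'\<bar> * t = \<bar>lam * t - lam' * t\<bar>"
    using t by (simp add: abs_mult left_diff_distrib[symmetric])
  ultimately show False
    using VT_ergodic_pair[OF assms(1) t, of 0] VT_ergodic_pair[OF assms(2) t, of 0] by linarith
qed

lemma ergodic_pair_exists:
  fixes d :: "nat \<Rightarrow> real"
  assumes d: "\<And>k. 0 < d k" "d \<longlonglongrightarrow> 0"
  obtains r :: "nat \<Rightarrow> nat" and lam W where "strict_mono r" "(\<lambda>k. d (r k) * V (d (r k)) 0) \<longlonglongrightarrow> lam"
    "uniform_limit UNIV (\<lambda>k. w (d (r k))) W sequentially" "ergodic_pair lam W"
proof -
  obtain r :: "nat \<Rightarrow> nat" and lam W where r: "strict_mono r" "(\<lambda>k. d (r k) * V (d (r k)) 0) \<longlonglongrightarrow> lam"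
    "uniform_limit UNIV (\<lambda>k x. V (d (r k)) x - V (d (r k)) 0) W sequentially"
    using vanishing_discount_subsequence[of d] d(1) by blast
  have W: "uniform_limit UNIV (\<lambda>k. w (d (r k))) W sequentially"
    using r(3) by (simp add: w_def[abs_def])
  have "(\<lambda>k. d (r k)) \<longlonglongrightarrow> 0" using LIMSEQ_subseq_LIMSEQ[OF d(2) r(1)] by (simp add: o_def)
  from ergodic_pair_limit[OF d(1) this r(2) W] show thesis using that r(1,2) W by blast
qed

text \<open>A sequence of discounts along which \<open>\<delta> * V \<delta> 0\<close> stays away
  from \<open>lam\<close> has a subsequence that produces an ergodic pair, whose constant must be
  \<open>lam\<close>: a contradiction. Uniformity in \<open>x\<close> follows because
  \<open>\<delta> * V \<delta> x\<close> deviates from the value at 0 by at most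
  \<open>\<delta> * osc\<close>.\<close>

lemma discounted_limit:
  assumes pair: "ergodic_pair lam W"
  shows "uniform_limit UNIV (\<lambda>\<delta> x. \<delta> * V \<delta> x) (\<lambda>_. lam) (at_right 0)"
proof -
  have lim0: "((\<lambda>\<delta>. \<delta> * V \<delta> 0) \<longlongrightarrow> lam) (at_right 0)"
  proof (rule tendstoI)
    fix e :: real assume e: "0 < e"
    show "\<forall>\<^sub>F \<delta> in at_right 0. dist (\<delta> * V \<delta> 0) lam < e"
    proof (rule sequentially_imp_eventually_at_right[of 0 1])
      fix s :: "nat \<Rightarrow> real" assume s: "\<And>n. 0 < s n" "s \<longlonglongrightarrow> 0"
      show "\<forall>\<^sub>F n in sequentially. dist (s n * V (s n) 0) lam < e"
      proof (rule ccontr)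
        assume "\<not> ?thesis"
        then obtain r :: "nat \<Rightarrow> nat" where r: "strict_mono r" "\<And>n. \<not> dist (s (r n) * V (s (r n)) 0) lam < e"
          using not_eventually_sequentiallyD by blast
        have sr: "\<And>n. 0 < s (r n)" "(\<lambda>n. s (r n)) \<longlonglongrightarrow> 0"
          using s LIMSEQ_subseq_LIMSEQ[OF s(2) r(1)] by (auto simp: o_def)
        obtain r' :: "nat \<Rightarrow> nat" and lam' W' where "(\<lambda>k. s (r (r' k)) * V (s (r (r' k))) 0) \<longlonglongrightarrow> lam'" "ergodic_pair lam' W'"
          using ergodic_pair_exists[of "\<lambda>n. s (r n)", OF sr] by blast
        with ergodic_pair_unique[OF pair] have "(\<lambda>k. s (r (r' k)) * V (s (r (r' k))) 0) \<longlonglongrightarrow> lam" by metis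
        then have "\<forall>\<^sub>F k in sequentially. dist (s (r (r' k)) * V (s (r (r' k))) 0) lam < e"
          using e by (rule tendstoD)
        then show False using r(2) by (auto simp: eventually_sequentially)
      qed
    qed simp
  qed
  show ?thesis
  proof (rule uniform_limitI)
    fix e :: real assume e: "0 < e"
    have "((\<lambda>\<delta>. \<delta> * osc) \<longlongrightarrow> 0 * osc) (at_right 0)" by (intro tendsto_intros)
    then have "\<forall>\<^sub>F \<delta> in at_right 0. \<delta> * osc < e / 2" using e by (intro order_tendstoD) auto
    moreover have "\<forall>\<^sub>F \<delta> in at_right 0. dist (\<delta> * V \<delta> 0) lam < e / 2" using lim0 e by (intro tendstoD) auto
    ultimately show "\<forall>\<^sub>F \<delta> in at_right 0. \<forall>x\<in>UNIV. dist (\<delta> * V \<delta> x) lam < e"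
      using eventually_at_right_less[of "0::real"]
    proof eventually_elim
      case (elim \<delta>)
      have *: "\<bar>\<delta> * V \<delta> x - \<delta> * V \<delta> 0\<bar> \<le> \<delta> * osc" for x
        using V_osc[of \<delta> x 0] elim(3) by (simp add: right_diff_distrib[symmetric] abs_mult)
      have "\<bar>\<delta> * V \<delta> x - lam\<bar> < e" for x
        using *[of x] elim(1,2) unfolding dist_real_def by linarith
      then show ?case by (simp add: dist_real_def)
    qed
  qed
qed

lemma finite_horizon_limit:
  assumes pair: "ergodic_pair lam W"
  shows "uniform_limit UNIV (\<lambda>t x. VT t x / t) (\<lambda>_. lam) at_top"
proof (rule uniform_limitI)
  fix e :: real assume e: "0 < e"
  have "\<forall>\<^sub>F t in at_top. (2 * osc + 1) / e < (t :: real)" by (rule eventually_gt_at_top)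
  then show "\<forall>\<^sub>F t in at_top. \<forall>x\<in>UNIV. dist (VT t x / t) lam < e"
  proof eventually_elim
    case (elim t)
    have "0 \<le> (2 * osc + 1) / e" using osc_nonneg e by simp
    then have t: "0 < t" using elim by linarith
    have te: "2 * osc < e * t" using elim e by (simp add: field_simps)
    have "dist (VT t x / t) lam < e" for x
    proof -
      have "dist (VT t x / t) lam = \<bar>VT t x - lam * t\<bar> / t"
        using t by (simp add: dist_real_def diff_divide_eq_iff[symmetric] abs_divide field_simps)
      also have "\<dots> \<le> 2 * osc / t" using VT_ergodic_pair[OF pair, of t x] t by (intro divide_right_mono) auto
      also have "\<dots> < e" using te t by (simp add: field_simps)
      finally show ?thesis .
    qed
    then show ?case by simp
  qed
qed

end

section \<open>The ergodic equation\<close>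

text \<open>Compactness of the parameter set gives one radius for all parameters. With the extended
  sphere as parameter set, all controls, however large, are treated at once.\<close>

lemma continuous_compact_eventually_le:
  fixes g :: "'a::euclidean_space \<times> 'c::metric_space \<Rightarrow> real"
  assumes "compact S" and cont: "continuous_on (UNIV \<times> S) g" and le: "\<And>s. s \<in> S \<Longrightarrow> g (x, s) \<le> c"
    and "0 < e"
  obtains r where "0 < r" "\<And>y s. y \<in> cball x r \<Longrightarrow> s \<in> S \<Longrightarrow> g (y, s) \<le> c + e"
proof -
  have "uniformly_continuous_on (cball x 1 \<times> S) g"
    using assms by (intro compact_uniformly_continuous compact_Times) (auto intro: continuous_on_subset)
  then obtain d where d: "0 < d"
    "\<And>u v. u \<in> cball x 1 \<times> S \<Longrightarrow> v \<in> cball x 1 \<times> S \<Longrightarrow> dist u v < d \<Longrightarrow> dist (g u) (g v) < e"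
    using \<open>0 < e\<close> unfolding uniformly_continuous_on_def by metis
  show thesis
  proof (rule that[of "min 1 (d / 2)"])
    show "0 < min 1 (d / 2)" using d(1) by simp
    fix y s assume y: "y \<in> cball x (min 1 (d / 2))" and s: "s \<in> S"
    have "dist (y, s) (x, s) < d" using y d(1) by (simp add: dist_Pair_Pair dist_commute)
    then have "dist (g (y, s)) (g (x, s)) < e" using y s by (intro d(2)) auto
    then show "g (y, s) \<le> c + e" using le[OF s] by (simp add: dist_real_def)
  qed
qed

text \<open>\<open>\<tau>\<close> is the least time at which the sphere of radius \<open>r\<close>
  is hit, or 1 if the curve stays in the ball. By the intermediate value theorem a point outside the
  ball is preceded by one on the sphere, so none occurs before \<open>\<tau>\<close>.\<close>

lemma first_exit_time:
  fixes y :: "real \<Rightarrow> 'a::euclidean_space"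
  assumes cont: "continuous_on {0..1} y" and y0: "y 0 = x" and r: "0 < r"
  obtains \<tau> where "0 \<le> \<tau>" "\<tau> \<le> 1" "\<And>s. s \<in> {0..\<tau>} \<Longrightarrow> y s \<in> cball x r" "\<tau> = 1 \<or> norm (y \<tau> - x) = r"
proof (cases "\<forall>s\<in>{0..1}. norm (y s - x) \<le> r")
  case True
  then show thesis by (intro that[of 1]) (auto simp: dist_norm norm_minus_commute)
next
  case False
  then obtain s0 where s0: "s0 \<in> {0..1}" "r < norm (y s0 - x)" by force
  define E where "E = {s \<in> {0..1}. norm (y s - x) = r}"
  have ncont: "continuous_on {0..1} (\<lambda>s. norm (y s - x))" by (intro continuous_intros cont)
  have hit: "\<exists>s. 0 \<le> s \<and> s \<le> t \<and> norm (y s - x) = r" if "0 \<le> t" "t \<le> 1" "r \<le> norm (y t - x)" for t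
    by (rule IVT') (use that y0 r continuous_on_subset[OF ncont] in auto)
  have "closed E"
    unfolding E_def using ncont by (intro continuous_closed_preimage_constant) auto
  moreover have "bounded E" by (rule bounded_subset[of "{0..1}"]) (auto simp: E_def)
  ultimately have "compact E" by (simp add: compact_eq_bounded_closed)
  moreover have "E \<noteq> {}"
  proof -
    obtain s where "0 \<le> s" "s \<le> s0" "norm (y s - x) = r" using hit[of s0] s0 by auto
    then have "s \<in> E" using s0 by (simp add: E_def)
    then show ?thesis by blast
  qed
  ultimately obtain \<tau> where \<tau>: "\<tau> \<in> E" "\<And>s. s \<in> E \<Longrightarrow> \<tau> \<le> s"
    using compact_attains_inf[of E] by blast
  show thesis
  proof (rule that[of \<tau>])
    show "0 \<le> \<tau>" "\<tau> \<le> 1" "\<tau> = 1 \<or> norm (y \<tau> - x) = r" using \<tau>(1) by (auto simp: E_def)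
    fix s assume s: "s \<in> {0..\<tau>}"
    have "norm (y s - x) \<le> r"
    proof (rule ccontr)
      assume "\<not> norm (y s - x) \<le> r"
      then obtain s' where s': "0 \<le> s'" "s' \<le> s" "norm (y s' - x) = r"
        using hit[of s] s \<tau>(1) by (auto simp: E_def)
      then have "\<tau> \<le> s'" using s \<tau>(1) by (intro \<tau>(2)) (auto simp: E_def)
      then have "s' = s" using s s' by auto
      then show False using s' \<open>\<not> norm (y s - x) \<le> r\<close> by simp
    qed
    then show "y s \<in> cball x r" by (simp add: dist_norm norm_minus_commute)
  qed
qed

context periodic_problem
begin

abbreviation H :: "real \<Rightarrow> real ^ 'n \<Rightarrow> real ^ 'n \<Rightarrow> real" where
  "H \<equiv> ergodic_hamiltonian A q f f_inf l l_inf"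
abbreviation SA :: "(real \<times> 'b) set" where "SA \<equiv> extended_sphere A q"

definition \<Psi> :: "real \<Rightarrow> real ^ 'n \<Rightarrow> real ^ 'n \<Rightarrow> real \<times> 'b \<Rightarrow> real" where
  "\<Psi> lam x p = (\<lambda>(w0, w). - (fbar x w0 w \<bullet> p) - lbar x w0 w + lam * w0 ^ q)"

lemma compact_sphere: "compact (SA)"
proof -
  have S: "SA = ({0..} \<times> A) \<inter> {z. fst z ^ q + norm (snd z) ^ q = 1}"
    by (auto simp: extended_sphere_def)
  have "closed (SA)"
    unfolding S using closed_A
    by (intro closed_Int closed_Times closed_Collect_eq continuous_intros) auto
  moreover have "SA \<subseteq> {0..1} \<times> cball 0 1"
  proof
    fix z assume "z \<in> SA"
    then obtain w0 w where z: "z = (w0, w)" "0 \<le> w0" "w0 ^ q + norm w ^ q = 1"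
      by (auto simp: extended_sphere_def)
    then have "0 \<le> w0 ^ q" "0 \<le> norm w ^ q" by auto
    then have le: "w0 ^ q \<le> 1 ^ q" "norm w ^ q \<le> 1 ^ q"
      using z(3) unfolding power_one by linarith+
    have "0 < q" using q_pos by simp
    have "w0 \<le> 1" using le(1) z(2) \<open>0 < q\<close> by (simp only: power_mono_iff zero_le_one)
    moreover have "norm w \<le> 1" using le(2) \<open>0 < q\<close> by (simp only: power_mono_iff zero_le_one norm_ge_zero)
    ultimately show "z \<in> {0..1} \<times> cball 0 1" using z by simp
  qed
  then have "bounded (SA)"
    by (rule bounded_subset[rotated]) (intro bounded_Times bounded_closed_interval bounded_cball)
  ultimately show ?thesis by (simp add: compact_eq_bounded_closed)
qed

lemma \<Psi>_continuous:
  assumes "continuous_on UNIV D"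
  shows "continuous_on (UNIV \<times> SA) (\<lambda>(y, z). \<Psi> lam y (D y) z)"
proof -
  have sub: "(\<lambda>u. (fst u, fst (snd u), snd (snd u))) ` (UNIV \<times> SA) \<subseteq> UNIV \<times> {0..} \<times> A"
    by (auto simp: extended_sphere_def)
  have "continuous_on (UNIV \<times> SA)
      (\<lambda>u. (\<lambda>(x, w0, w). fbar x w0 w) (fst u, fst (snd u), snd (snd u)))"
    by (rule continuous_on_compose2[OF fbar_continuous _ sub]) (intro continuous_intros)
  moreover have "continuous_on (UNIV \<times> SA)
      (\<lambda>u. (\<lambda>(x, w0, w). lbar x w0 w) (fst u, fst (snd u), snd (snd u)))"
    by (rule continuous_on_compose2[OF lbar_continuous _ sub]) (intro continuous_intros)
  moreover have "continuous_on (UNIV \<times> SA) (\<lambda>u. D (fst u))"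
    by (rule continuous_on_compose2[OF assms]) (auto intro!: continuous_intros)
  ultimately show ?thesis
    unfolding \<Psi>_def case_prod_beta by (auto intro!: continuous_intros)
qed

text \<open>Compactness of the extended sphere, which contains \<open>(1, 0)\<close>, makes
  \<open>GREATEST\<close> a true maximum.\<close>

lemma ergodic_hamiltonian_attained:
  obtains z where "z \<in> SA"
    "H lam x p = \<Psi> lam x p z"
    "\<And>z'. z' \<in> SA \<Longrightarrow> \<Psi> lam x p z' \<le> \<Psi> lam x p z"
proof -
  have "continuous_on (SA) (\<lambda>z. (\<lambda>(y, z). \<Psi> lam y p z) (x, z))"
    by (rule continuous_on_compose2[OF \<Psi>_continuous]) (auto intro!: continuous_intros)
  then have "continuous_on (SA) (\<Psi> lam x p)" by simp
  moreover have "(1, 0) \<in> SA"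
    using zero_A q_pos by (simp add: extended_sphere_def power_0_left)
  then have "SA \<noteq> {}" by blast
  ultimately obtain z where z: "z \<in> SA"
    "\<And>z'. z' \<in> SA \<Longrightarrow> \<Psi> lam x p z' \<le> \<Psi> lam x p z"
    using continuous_attains_sup[OF compact_sphere] by blast
  have "H lam x p = (GREATEST v. v \<in> \<Psi> lam x p ` SA)"
    unfolding ergodic_hamiltonian_def \<Psi>_def ..
  also have "\<dots> = \<Psi> lam x p z" using z by (intro Greatest_equality) auto
  finally show thesis using that z by blast
qed

lemma ergodic_pair_subsolution:
  assumes pair: "ergodic_pair lam W"
  shows "viscosity_subsolution (H lam) W"
  unfolding viscosity_subsolution_def
proof (intro allI impI, elim conjE)
  fix \<phi> D and x :: "real ^ 'n"
  assume \<phi>: "\<forall>y. GDERIV \<phi> y :> D y" and max: "\<forall>\<^sub>F y in nhds x. W y - \<phi> y \<le> W x - \<phi> x"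
  obtain z where z: "z \<in> SA"
    "H lam x (D x) = \<Psi> lam x (D x) z"
    using ergodic_hamiltonian_attained by blast
  obtain w0 w where w: "z = (w0, w)" "0 \<le> w0" "w \<in> A" using z(1) by (auto simp: extended_sphere_def)
  have "- (fbar x w0 w \<bullet> D x) - lbar x w0 w + lam * w0 ^ q \<le> 0"
  proof (rule subsolution_extended_control[where u = W])
    show "W x \<le> cost 0 (\<lambda>_. a) x h - lam * h + W (traj (\<lambda>_. a) x h)" if "a \<in> A" "0 \<le> h" for a h
      using pair constant_control[OF that(1)] that(2) unfolding ergodic_pair_def by blast
  qed (use \<phi> max w in auto)
  then show "H lam x (D x) \<le> 0"
    using z(2) w by (simp add: \<Psi>_def)
qed

text \<open>Scaling \<open>(1, a)\<close> onto the sphere uses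
  \<open>w0 ^ q = 1 / (1 + norm a ^ q)\<close>, and \<open>\<Psi>\<close> at the scaled point is the
  left-hand side times \<open>w0 ^ q\<close>. A bound on the sphere thus gains the full weight of
  \<open>a\<close>.\<close>

lemma \<Psi>_normalized_control:
  assumes a: "a \<in> A" and le: "\<And>z. z \<in> SA \<Longrightarrow> \<Psi> lam y p z \<le> c"
  shows "lam - f y a \<bullet> p - l y a \<le> c * (1 + norm a ^ q)"
proof -
  define s where "s = 1 + norm a ^ q"
  have s: "0 < s" by (simp add: s_def add_pos_nonneg)
  define w0 where "w0 = 1 / root q s"
  have q: "0 < q" using q_pos by simp
  have w0: "0 < w0" "w0 ^ q = 1 / s" using s q by (auto simp: w0_def power_one_over)
  have "w0 ^ q + norm (w0 *\<^sub>R a) ^ q = w0 ^ q * s"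
    using w0(1) by (simp add: s_def power_mult_distrib algebra_simps)
  then have "(w0, w0 *\<^sub>R a) \<in> SA"
    using w0 s a mem_cone[OF cone_A a] by (simp add: extended_sphere_def)
  from le[OF this] have "w0 ^ q * (lam - f y a \<bullet> p - l y a) \<le> c"
    using w0(1) by (simp add: \<Psi>_def extended_def algebra_simps)
  then show ?thesis using w0(2) s by (simp add: field_simps s_def[symmetric])
qed

text \<open>A large control can leave the ball where the test inequality holds in an arbitrarily short time.
  The strict inequality gains \<open>\<eta> (1 + |\<alpha>|\<^sup>q)\<close>, which dominates the distance travelled, so an
  early exit is as costly as staying in the ball up to time 1.\<close>

lemma ergodic_pair_supersolution:
  assumes pair: "ergodic_pair lam W"
  shows "viscosity_supersolution (H lam) W"
  unfolding viscosity_supersolution_def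
proof (intro allI impI, elim conjE)
  fix \<phi> D and x :: "real ^ 'n"
  assume \<phi>: "\<forall>y. GDERIV \<phi> y :> D y" and D: "continuous_on UNIV D"
    and min: "\<forall>\<^sub>F y in nhds x. W x - \<phi> x \<le> W y - \<phi> y"
  show "0 \<le> H lam x (D x)"
  proof (rule ccontr)
    \<comment> \<open>The gap is \<open>2 * \<eta>\<close>: continuity spends one
      \<open>\<eta>\<close>, the other remains as the strict inequality near
      \<open>x\<close>.\<close>
    define \<eta> where "\<eta> = - H lam x (D x) / 2"
    assume "\<not> ?thesis"
    then have \<eta>: "0 < \<eta>" by (simp add: \<eta>_def)
    have le: "\<Psi> lam x (D x) z \<le> - 2 * \<eta>" if "z \<in> SA" for z
    proof -
      obtain z' where "H lam x (D x) = \<Psi> lam x (D x) z'"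
        "\<Psi> lam x (D x) z \<le> \<Psi> lam x (D x) z'"
        using ergodic_hamiltonian_attained[of lam x "D x"] \<open>z \<in> SA\<close> by metis
      then show ?thesis by (simp add: \<eta>_def)
    qed
    obtain r1 where r1: "0 < r1"
      "\<And>y z. y \<in> cball x r1 \<Longrightarrow> z \<in> SA \<Longrightarrow> \<Psi> lam y (D y) z \<le> - \<eta>"
    proof (rule continuous_compact_eventually_le[OF compact_sphere \<Psi>_continuous[OF D, of lam], of x "- 2 * \<eta>" \<eta>])
      fix r assume "0 < r" "\<And>y s. y \<in> cball x r \<Longrightarrow> s \<in> SA \<Longrightarrow>
        (case (y, s) of (y, z) \<Rightarrow> \<Psi> lam y (D y) z) \<le> - 2 * \<eta> + \<eta>"
      then show thesis by (intro that[of r]) auto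
    qed (use le \<eta> in auto)
    obtain r2 where r2: "0 < r2" "\<And>y. dist y x < r2 \<Longrightarrow> W x - \<phi> x \<le> W y - \<phi> y"
      using min unfolding eventually_nhds_metric by blast
    define r where "r = min r1 (r2 / 2)"
    have r: "0 < r" using r1 r2 by (simp add: r_def)
    \<comment> \<open>The gain \<open>\<eta> / K\<close> times the integral of \<open>k\<close> is
      at least \<open>\<eta>\<close> over unit time, and at least \<open>m\<close> if the trajectory
      travels the distance \<open>r\<close>, since \<open>k\<close> dominates the speed.
      \<open>e\<close> is taken below both.\<close>
    define m where "m = \<eta> / K * r"
    have "0 < m" using \<eta> r K_pos by (simp add: m_def)
    define e where "e = min \<eta> m / 2"
    have e: "0 < e" "e < \<eta>" "e < m" using \<eta> \<open>0 < m\<close> by (auto simp: e_def min_def)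
    \<comment> \<open>One control for all times of \<open>{0..1}\<close>, because the exit time is
      determined by the control and known only afterwards.\<close>
    obtain \<alpha> where \<alpha>: "\<alpha> \<in> \<A>"
      "\<And>t. t \<in> {0..1} \<Longrightarrow> cost 0 \<alpha> x t - lam * t + W (traj \<alpha> x t) \<le> W x + e"
      using pair e(1) unfolding ergodic_pair_def by (meson zero_le_one)
    define y where "y = traj \<alpha> x"
    obtain \<tau> where \<tau>: "0 \<le> \<tau>" "\<tau> \<le> 1" "\<And>s. s \<in> {0..\<tau>} \<Longrightarrow> y s \<in> cball x r"
      "\<tau> = 1 \<or> norm (y \<tau> - x) = r"
      using first_exit_time[OF traj_continuous_on[OF \<alpha>(1)] traj_0[OF \<alpha>(1)] r] unfolding y_def by blast
    have y\<tau>: "y \<tau> = x + integral {0..\<tau>} (\<lambda>s. f (y s) (\<alpha> s))"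
      unfolding y_def by (rule traj_integral[OF \<alpha>(1) \<tau>(1)])
    have fint: "(\<lambda>s. f (y s) (\<alpha> s)) absolutely_integrable_on {0..\<tau>}"
      unfolding y_def by (rule traj_integrable[OF \<alpha>(1) \<tau>(1)])
    have "y s = x + integral {0..s} (\<lambda>s. f (y s) (\<alpha> s))" if "s \<in> {0..\<tau>}" for s
      using traj_integral[OF \<alpha>(1), of s x] that by (simp add: y_def)
    note chain = integral_chain_rule[OF \<phi>[rule_format] D fint this \<tau>(1)]
    have kint: "k \<alpha> integrable_on {0..\<tau>}" by (rule k_integrable[OF \<alpha>(1) \<tau>(1)])
    have lint: "(\<lambda>s. l (y s) (\<alpha> s)) integrable_on {0..\<tau>}"
      using cost_integrand_integrable[OF \<alpha>(1), of 0 \<tau> x] \<tau>(1) by (simp add: y_def)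
    have Dint: "(\<lambda>s. D (y s) \<bullet> f (y s) (\<alpha> s)) integrable_on {0..\<tau>}"
      using chain(1) by (simp add: absolutely_integrable_on_def)
    \<comment> \<open>The strict inequality is integrated: the chain rule turns the gradient term
      into the increment of \<open>\<phi>\<close>, which the local minimum bounds by that of
      \<open>W\<close>, and near-optimality at \<open>\<tau>\<close> caps the gain by
      \<open>e\<close>.\<close>
    have "\<eta> / K * integral {0..\<tau>} (k \<alpha>) = integral {0..\<tau>} (\<lambda>s. \<eta> / K * k \<alpha> s)" by simp
    also have "\<dots> \<le> integral {0..\<tau>} (\<lambda>s. l (y s) (\<alpha> s) - lam + D (y s) \<bullet> f (y s) (\<alpha> s))"
    proof (rule integral_le)
      show "(\<lambda>s. \<eta> / K * k \<alpha> s) integrable_on {0..\<tau>}" by (intro integrable_on_mult_right kint)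
      show "(\<lambda>s. l (y s) (\<alpha> s) - lam + D (y s) \<bullet> f (y s) (\<alpha> s)) integrable_on {0..\<tau>}"
        by (intro integrable_add integrable_diff lint Dint integrable_const_ivl)
      fix s assume s: "s \<in> {0..\<tau>}"
      then have A: "\<alpha> s \<in> A" using \<alpha>(1) by (simp add: controls_iff)
      have "y s \<in> cball x r1" using \<tau>(3)[OF s] by (simp add: r_def)
      then have "lam - f (y s) (\<alpha> s) \<bullet> D (y s) - l (y s) (\<alpha> s) \<le> - \<eta> * (1 + norm (\<alpha> s) ^ q)"
        by (intro \<Psi>_normalized_control A r1(2))
      moreover have "\<eta> / K * k \<alpha> s = \<eta> * (1 + norm (\<alpha> s) ^ q)" using K_pos by (simp add: k_def)
      ultimately show "\<eta> / K * k \<alpha> s \<le> l (y s) (\<alpha> s) - lam + D (y s) \<bullet> f (y s) (\<alpha> s)"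
        by (simp add: inner_commute)
    qed
    also have "\<dots> = cost 0 \<alpha> x \<tau> - lam * \<tau> + (\<phi> (y \<tau>) - \<phi> x)"
      using chain(2) \<tau>(1) integral_add[OF integrable_diff[OF lint integrable_const_ivl[of lam]] Dint]
        integral_diff[OF lint integrable_const_ivl[of lam]]
      by (simp add: cost_def y_def mult.commute)
    also have "\<phi> (y \<tau>) - \<phi> x \<le> W (y \<tau>) - W x"
    proof -
      have "dist (y \<tau>) x < r2" using \<tau>(3)[of \<tau>] \<tau>(1) r2(1) by (auto simp: r_def dist_commute)
      from r2(2)[OF this] show ?thesis by simp
    qed
    finally have gain: "\<eta> / K * integral {0..\<tau>} (k \<alpha>) \<le> e" using \<alpha>(2)[of \<tau>] \<tau>(1,2) by (simp add: y_def)
    from \<tau>(4) show False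
    proof
      assume "\<tau> = 1"
      have "integral {0..\<tau>} (\<lambda>s. K) \<le> integral {0..\<tau>} (k \<alpha>)"
        using K_pos by (intro integral_le kint integrable_const_ivl) (auto simp: k_def)
      then have "K \<le> integral {0..\<tau>} (k \<alpha>)" using \<open>\<tau> = 1\<close> by simp
      then have "\<eta> / K * K \<le> \<eta> / K * integral {0..\<tau>} (k \<alpha>)" using \<eta> K_pos by (intro mult_left_mono) auto
      then show False using gain e(2) K_pos by simp
    next
      assume "norm (y \<tau> - x) = r"
      then have "r = norm (integral {0..\<tau>} (\<lambda>s. f (y s) (\<alpha> s)))" using y\<tau> by simp
      also have "\<dots> \<le> integral {0..\<tau>} (k \<alpha>)"
      proof (rule integral_norm_bound_integral)
        show "(\<lambda>s. f (y s) (\<alpha> s)) integrable_on {0..\<tau>}" using fint by (simp add: absolutely_integrable_on_def)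
        show "norm (f (y s) (\<alpha> s)) \<le> k \<alpha> s" if "s \<in> {0..\<tau>}" for s
          unfolding k_def by (rule f_bound) (use \<alpha>(1) that in \<open>simp add: controls_iff\<close>)
      qed (rule kint)
      finally have "\<eta> / K * r \<le> \<eta> / K * integral {0..\<tau>} (k \<alpha>)" using \<eta> K_pos by (intro mult_left_mono) auto
      then show False using gain e(3) by (simp add: m_def)
    qed
  qed
qed

end

theorem theorem7p1:
  fixes A :: "(real ^ 'm) set"
    and f f_inf :: "real ^ 'n \<Rightarrow> real ^ 'm \<Rightarrow> real ^ 'n"
    and l l_inf :: "real ^ 'n \<Rightarrow> real ^ 'm \<Rightarrow> real"
    and p q :: nat
    and C\<^sub>1 C\<^sub>2 L M C \<gamma> :: real
    and T :: "real ^ 'n"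
  assumes "\<not> bounded A" "convex A" "closed A" "cone A" "A \<noteq> {0}" "0 \<in> A"
    and "continuous_on (UNIV \<times> A) (\<lambda>(x, a). f x a)"
    and "continuous_on (UNIV \<times> A) (\<lambda>(x, a). l x a)"
    and "\<And>x a. a \<in> A \<Longrightarrow> l x a \<ge> 0"
    and "1 \<le> p" "p \<le> q"
    and "C\<^sub>1 \<ge> 0" "C\<^sub>2 > 0"
    and "\<And>x a. a \<in> A \<Longrightarrow> l x a \<ge> C\<^sub>2 * norm a ^ q - C\<^sub>1"
    and "recession_limit A q f f_inf" "recession_limit A q l l_inf"
    and period_pos: "\<And>i. T $ i > 0"
    and f_periodic: "\<And>i x a. a \<in> A \<Longrightarrow> f (x + axis i (T $ i)) a = f x a"
    and l_periodic: "\<And>i x a. a \<in> A \<Longrightarrow> l (x + axis i (T $ i)) a = l x a"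
    and "L > 0" "M > 0"
    and "\<And>x\<^sub>1 x\<^sub>2 a. x\<^sub>1 \<in> cbox 0 T \<Longrightarrow> x\<^sub>2 \<in> cbox 0 T \<Longrightarrow> a \<in> A \<Longrightarrow>
           norm (f x\<^sub>1 a - f x\<^sub>2 a) \<le> L * (1 + norm a ^ p) * norm (x\<^sub>1 - x\<^sub>2)"
    and "\<And>x\<^sub>1 x\<^sub>2 a. x\<^sub>1 \<in> cbox 0 T \<Longrightarrow> x\<^sub>2 \<in> cbox 0 T \<Longrightarrow> a \<in> A \<Longrightarrow>
           \<bar>l x\<^sub>1 a - l x\<^sub>2 a\<bar> \<le> L * (1 + norm a ^ q) * norm (x\<^sub>1 - x\<^sub>2)"
    and "\<And>x a. x \<in> cbox 0 T \<Longrightarrow> a \<in> A \<Longrightarrow> l x a \<le> M * (1 + norm a ^ q)"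
    and "\<And>x a. x \<in> cbox 0 T \<Longrightarrow> a \<in> A \<Longrightarrow> norm (f x a) \<le> M * (1 + norm a ^ p)"
    and "C > 0" "\<gamma> > 0"
    and controllability:
      "\<And>x z. x \<in> cbox 0 T \<Longrightarrow> z \<in> cbox 0 T \<Longrightarrow> \<not> torus_eq T x z \<Longrightarrow>
         \<exists>S>0. \<exists>\<mu>\<in>relaxed_controls A.
           torus_eq T (relaxed_trajectory q f f_inf x \<mu> S) z \<and> S \<le> C * norm (x - z) powr \<gamma>"
  shows "\<exists>lam\<ge>0.
     uniform_limit UNIV (\<lambda>\<delta> x. \<delta> * discounted_value A q f l \<delta> x) (\<lambda>x. lam) (at_right 0) \<and>
     uniform_limit UNIV (\<lambda>t x. finite_horizon_value A q f l t x / t) (\<lambda>x. lam) at_top \<and>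
     (\<exists>(d :: nat \<Rightarrow> real) W\<^sub>0.
        (\<forall>k. d k > 0) \<and> d \<longlonglongrightarrow> 0 \<and>
        uniform_limit UNIV
          (\<lambda>k x. discounted_value A q f l (d k) x - discounted_value A q f l (d k) 0)
          W\<^sub>0 sequentially \<and>
        W\<^sub>0 \<in> BUC \<and>
        viscosity_solution (ergodic_hamiltonian A q f f_inf l l_inf lam) W\<^sub>0)"
proof -
  note f_lip = assms(22) and l_lip = assms(23) and l_bd = assms(24) and f_bd = assms(25)
  have f_per: "(\<lambda>x. f x a) (x + axis i (T $ i)) = (\<lambda>x. f x a) x" if "a \<in> A" for i x a
    using f_periodic[OF that] .
  have l_per: "(\<lambda>x. l x a) (x + axis i (T $ i)) = (\<lambda>x. l x a) x" if "a \<in> A" for i x a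
    using l_periodic[OF that] .
  \<comment> \<open>The growth bounds are given on one cell; \<open>cube_rep\<close> and periodicity
    carry them to the whole space.\<close>
  have f_bound: "norm (f x a) \<le> M * (1 + norm a ^ p)" if a: "a \<in> A" for x a
    using f_bd[OF cube_rep(1)[OF period_pos] a, of x]
      periodic_torus_eq[OF f_per[OF a] cube_rep(2)[OF period_pos], of x] by simp
  have l_bound: "l x a \<le> M * (1 + norm a ^ q)" if a: "a \<in> A" for x a
    using l_bd[OF cube_rep(1)[OF period_pos] a, of x]
      periodic_torus_eq[OF l_per[OF a] cube_rep(2)[OF period_pos], of x] by simp
  obtain r where r: "0 < r" "\<And>i. r \<le> T $ i" using min_period[OF period_pos] by blast
  \<comment> \<open>The constant produced by \<open>periodic_lipschitz\<close> with the weight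
    factored out: for fixed \<open>a\<close>, both the Lipschitz constant on the cell and the bound
    carry the same weight.\<close>
  define c where "c = 2 * real CARD('n) * L + 2 * M / r"
  have c: "0 \<le> c" using \<open>L > 0\<close> \<open>M > 0\<close> r(1) by (simp add: c_def)
  have f_lipschitz: "norm (f x a - f y a) \<le> c * (1 + norm a ^ p) * norm (x - y)" if a: "a \<in> A" for x y a
  proof -
    have "norm (f x a - f y a) \<le> (2 * real CARD('n) * (L * (1 + norm a ^ p)) + 2 * (M * (1 + norm a ^ p)) / r) * norm (x - y)"
      by (rule periodic_lipschitz[OF period_pos f_per[OF a] f_lip[OF _ _ a] f_bound[OF a] r])
        (use \<open>L > 0\<close> in auto)
    then show ?thesis by (simp add: c_def algebra_simps add_divide_distrib)
  qed
  have l_lipschitz: "\<bar>l x a - l y a\<bar> \<le> c * (1 + norm a ^ q) * norm (x - y)" if a: "a \<in> A" for x y a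
  proof -
    have "norm (l x a) \<le> M * (1 + norm a ^ q)" for x using l_bound[OF a, of x] assms(9)[OF a, of x] by simp
    then have "norm (l x a - l y a) \<le> (2 * real CARD('n) * (L * (1 + norm a ^ q)) + 2 * (M * (1 + norm a ^ q)) / r) * norm (x - y)"
      using l_lip[OF _ _ a] by (intro periodic_lipschitz[OF period_pos l_per[OF a] _ _ r])
        (use \<open>L > 0\<close> in auto)
    then show ?thesis by (simp add: c_def algebra_simps add_divide_distrib)
  qed
  \<comment> \<open>The factors 2 pay for replacing the exponent \<open>p\<close> by
    \<open>q\<close> in the weight.\<close>
  define K where "K = 2 * c + 2 * M"
  have K: "0 < K" "2 * c \<le> K" "c \<le> K" "2 * M \<le> K" "M \<le> K" using c \<open>M > 0\<close> by (auto simp: K_def)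
  have pq: "1 + norm a ^ p \<le> 2 * (1 + norm a ^ q)" for a :: "real ^ 'm"
  proof (cases "norm a \<le> 1")
    case True
    then have "norm a ^ p \<le> 1" by (intro power_le_one) auto
    moreover have "0 \<le> norm a ^ q" by simp
    ultimately show ?thesis unfolding distrib_left by linarith
  next
    case False
    then have "norm a ^ p \<le> norm a ^ q" using \<open>p \<le> q\<close> by (intro power_increasing) auto
    moreover have "0 \<le> norm a ^ q" by simp
    ultimately show ?thesis unfolding distrib_left by linarith
  qed
  have pq': "b * (1 + norm a ^ p) \<le> K * (1 + norm a ^ q)" if "0 \<le> b" "2 * b \<le> K" for a :: "real ^ 'm" and b
  proof -
    have "b * (1 + norm a ^ p) \<le> b * (2 * (1 + norm a ^ q))" using that pq by (intro mult_left_mono)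
    also have "\<dots> = 2 * b * (1 + norm a ^ q)" by simp
    also have "\<dots> \<le> K * (1 + norm a ^ q)" using that by (intro mult_right_mono) auto
    finally show ?thesis .
  qed
  have qq: "b * (1 + norm a ^ q) \<le> K * (1 + norm a ^ q)" if "b \<le> K" for a :: "real ^ 'm" and b
    using that by (intro mult_right_mono) auto
  interpret periodic_problem A f l q K C\<^sub>1 C\<^sub>2 f_inf l_inf T C \<gamma>
  proof unfold_locales
    show "norm (f x a - f y a) \<le> K * (1 + norm a ^ q) * norm (x - y)" if "a \<in> A" for x y a
      using f_lipschitz[OF that, of x y] mult_right_mono[OF pq'[OF c K(2), of a] norm_ge_zero[of "x - y"]]
      by linarith
    show "\<bar>l x a - l y a\<bar> \<le> K * (1 + norm a ^ q) * norm (x - y)" if "a \<in> A" for x y a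
      using l_lipschitz[OF that, of x y] mult_right_mono[OF qq[OF K(3), of a] norm_ge_zero[of "x - y"]]
      by linarith
    show "norm (f x a) \<le> K * (1 + norm a ^ q)" if "a \<in> A" for x a
      using f_bound[OF that, of x] pq'[OF less_imp_le[OF \<open>M > 0\<close>] K(4), of a] by linarith
    show "l x a \<le> K * (1 + norm a ^ q)" if "a \<in> A" for x a
      using l_bound[OF that, of x] qq[OF K(5), of a] by linarith
    show "1 \<le> q" using \<open>1 \<le> p\<close> \<open>p \<le> q\<close> by simp
  qed (use assms K(1) in auto)
  define d :: "nat \<Rightarrow> real" where "d = (\<lambda>k. 1 / real (Suc k))"
  have d: "0 < d k" "d \<longlonglongrightarrow> 0" for k
    using lim_1_over_n[where 'a = real, THEN LIMSEQ_Suc] by (auto simp: d_def)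
  obtain r' :: "nat \<Rightarrow> nat" and lam W where r': "strict_mono r'" "(\<lambda>k. d (r' k) * V (d (r' k)) 0) \<longlonglongrightarrow> lam"
    "uniform_limit UNIV (\<lambda>k. w (d (r' k))) W sequentially" and pair: "ergodic_pair lam W"
    using ergodic_pair_exists[of d, OF d] by blast
  have "0 \<le> d (r' k) * V (d (r' k)) 0" for k
    using d(1)[of "r' k"] V_nonneg[of "d (r' k)" 0] by simp
  then have lam: "0 \<le> lam" using LIMSEQ_le_const[OF r'(2)] by blast
  have dr: "\<forall>k. 0 < d (r' k)" "(\<lambda>k. d (r' k)) \<longlonglongrightarrow> 0"
    using d(1) LIMSEQ_subseq_LIMSEQ[OF d(2) r'(1)] by (auto simp: o_def)
  \<comment> \<open>The modulus from \<open>V_equicontinuous\<close> is the same for all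
    \<open>\<delta>\<close>, hence survives the pointwise limit.\<close>
  have uc: "uniformly_continuous_on UNIV W"
    unfolding uniformly_continuous_on_def
  proof (intro allI impI)
    fix e :: real assume e: "0 < e"
    from V_equicontinuous[OF half_gt_zero[OF e]] obtain d' where d': "0 < d'"
      "\<And>\<delta> x z. 0 < \<delta> \<Longrightarrow> norm (x - z) \<le> d' \<Longrightarrow> \<bar>V \<delta> x - V \<delta> z\<bar> \<le> e / 2"
      by blast
    have lim: "(\<lambda>k. w (d (r' k)) x) \<longlonglongrightarrow> W x" for x using r'(3) by (rule tendsto_uniform_limitI) simp
    have "dist (W x') (W x) < e" if "dist x' x < d'" for x x'
    proof -
      have "\<bar>w (d (r' k)) x' - w (d (r' k)) x\<bar> \<le> e / 2" for k
        using d'(2)[of "d (r' k)" x' x] dr(1) that by (simp add: w_def dist_norm)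
      then have "\<bar>W x' - W x\<bar> \<le> e / 2"
        by (intro tendsto_upperbound[OF tendsto_rabs[OF tendsto_diff[OF lim[of x'] lim[of x]]]]) auto
      then show ?thesis using e by (simp add: dist_real_def)
    qed
    then show "\<exists>d>0. \<forall>x\<in>UNIV. \<forall>x'\<in>UNIV. dist x' x < d \<longrightarrow> dist (W x') (W x) < e"
      using d'(1) by blast
  qed
  have "bounded (range W)"
    using pair unfolding ergodic_pair_def bounded_iff by auto
  then have "W \<in> BUC" using uc by (simp add: BUC_def)
  moreover have "viscosity_solution (H lam) W"
    unfolding viscosity_solution_def
    using uc uniformly_continuous_imp_continuous ergodic_pair_subsolution[OF pair] ergodic_pair_supersolution[OF pair]
    by blast
  moreover have "uniform_limit UNIV
      (\<lambda>k x. discounted_value A q f l (d (r' k)) x - discounted_value A q f l (d (r' k)) 0) W sequentially"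
    using r'(3) by (simp add: w_def[abs_def] V_def)
  ultimately show ?thesis
    using dr lam discounted_limit[OF pair] finite_horizon_limit[OF pair]
    by (intro exI[of _ lam] exI[of _ "\<lambda>k. d (r' k)"] exI[of _ W] conjI) (simp_all add: V_def VT_def)
qed

end
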